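(* Let $\phi$ be a finite Blaschke product of order $n$. If $\mathcal{M}_1$ and $\mathcal{M}_2$ are two distinct nontrivial minimal reducing subspaces of $M_\phi$ on the Dirichlet space $D$, then $\mathcal{M}_1$ and $\mathcal{M}_2$ are orthogonal in $D$.
   Context: $\mathbb{D}=\{z\in\mathbb{C}:|z|<1\}$ and $dA$ is normalized Lebesgue area measure on $\mathbb{D}$. The Dirichlet space $D$ is the Hilbert space of holomorphic $f$ on $\mathbb{D}$ with $\int_{\mathbb{D}}|f'|^2dA<\infty$, with norm $\|f\|_D^2=\|f\|_{H^2}^2+\int_{\mathbb{D}}|f'|^2dA=\sum_{n\ge 0}(n+1)|\hat f(n)|^2$, where $\hat f(n)$ is the $n$-th Taylor coefficient and $H^2$ is the Hardy space. For $\lambda\in\mathbb{D}$, $\varphi_\lambda(z)=\frac{\lambda-z}{1-\overline{\lambda}z}$. A finite Blaschke product of order $n\ge1$ is a function $c\,\varphi_{\lambda_1}\cdots\varphi_{\lambda_n}$ with $\lambda_1,\dots,\lambda_n\in\mathbb{D}$ (not necessarily distinct) and $|c|=1$. $M_\phi f=\phi f$ is then a bounded operator on $D$. A closed subspace $\mathcal{M}$ of a Hilbert space is a reducing subspace of an operator $T$ if it is invariant under both $T$ and $T^*$; it is nontrivial if it is neither $\{0\}$ nor the whole space. A nontrivial reducing subspace $\mathcal{M}$ is minimal if the only reducing subspaces of $T$ contained in $\mathcal{M}$ are $\mathcal{M}$ and $\{0\}$. *)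

theory Defs
  imports "HOL-Complex_Analysis.Complex_Analysis"
begin

abbreviation unit_disc :: "complex set" where
  "unit_disc \<equiv> ball 0 1"

definition taylor_coeff :: "(complex \<Rightarrow> complex) \<Rightarrow> nat \<Rightarrow> complex" where
  "taylor_coeff f n = (deriv ^^ n) f 0 / fact n"

text \<open>
  A function on the disc is represented by its extension by \<open>0\<close> to the whole plane, so that
  equality of elements (and hence of subspaces) is equality of functions on the disc.
\<close>
definition dirichlet_space :: "(complex \<Rightarrow> complex) set" where
  "dirichlet_space = {f. f holomorphic_on unit_disc \<and> (\<forall>z. z \<notin> unit_disc \<longrightarrow> f z = 0) \<and>
     set_integrable lborel unit_disc (\<lambda>z. (cmod (deriv f z))\<^sup>2)}"

definition hardy_inner :: "(complex \<Rightarrow> complex) \<Rightarrow> (complex \<Rightarrow> complex) \<Rightarrow> complex" where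
  "hardy_inner f g = (\<Sum>n. taylor_coeff f n * cnj (taylor_coeff g n))"

text \<open>
  The inner product inducing the norm \<open>\<parallel>f\<parallel>\<^sup>2 = \<parallel>f\<parallel>\<^sup>2 (in H\<^sup>2) + \<integral> |f'|\<^sup>2 dA\<close>;
  the factor \<open>1 / pi\<close> normalizes the area measure of the disc.
\<close>
definition dirichlet_inner :: "(complex \<Rightarrow> complex) \<Rightarrow> (complex \<Rightarrow> complex) \<Rightarrow> complex" where
  "dirichlet_inner f g = hardy_inner f g +
     complex_of_real (1 / pi) * (LINT z:unit_disc|lborel. deriv f z * cnj (deriv g z))"

definition dirichlet_norm :: "(complex \<Rightarrow> complex) \<Rightarrow> real" where
  "dirichlet_norm f = sqrt (Re (dirichlet_inner f f))"

definition closed_dirichlet_subspace :: "(complex \<Rightarrow> complex) set \<Rightarrow> bool" where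
  "closed_dirichlet_subspace M \<longleftrightarrow>
     M \<subseteq> dirichlet_space \<and>
     (\<lambda>z. 0) \<in> M \<and>
     (\<forall>f\<in>M. \<forall>g\<in>M. (\<lambda>z. f z + g z) \<in> M) \<and>
     (\<forall>c. \<forall>f\<in>M. (\<lambda>z. c * f z) \<in> M) \<and>
     (\<forall>F g. (\<forall>k::nat. F k \<in> M) \<and> g \<in> dirichlet_space \<and>
        (\<lambda>k. dirichlet_norm (\<lambda>z. F k z - g z)) \<longlonglongrightarrow> 0 \<longrightarrow> g \<in> M)"

text \<open>
  The Hilbert space adjoint, meaningful on \<open>dirichlet_space\<close> for operators \<open>T\<close> that are
  bounded there: existence and uniqueness of the described element are then the Riesz
  representation theorem.
\<close>
definition dirichlet_adjoint ::
  "((complex \<Rightarrow> complex) \<Rightarrow> (complex \<Rightarrow> complex)) \<Rightarrow> (complex \<Rightarrow> complex) \<Rightarrow> (complex \<Rightarrow> complex)" where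
  "dirichlet_adjoint T g = (THE h. h \<in> dirichlet_space \<and>
     (\<forall>f\<in>dirichlet_space. dirichlet_inner (T f) g = dirichlet_inner f h))"

definition reducing_subspace ::
  "((complex \<Rightarrow> complex) \<Rightarrow> (complex \<Rightarrow> complex)) \<Rightarrow> (complex \<Rightarrow> complex) set \<Rightarrow> bool" where
  "reducing_subspace T M \<longleftrightarrow> closed_dirichlet_subspace M \<and>
     (\<forall>f\<in>M. T f \<in> M) \<and> (\<forall>f\<in>M. dirichlet_adjoint T f \<in> M)"

definition nontrivial_subspace :: "(complex \<Rightarrow> complex) set \<Rightarrow> bool" where
  "nontrivial_subspace M \<longleftrightarrow> M \<noteq> {\<lambda>z. 0} \<and> M \<noteq> dirichlet_space"

definition minimal_reducing_subspace ::
  "((complex \<Rightarrow> complex) \<Rightarrow> (complex \<Rightarrow> complex)) \<Rightarrow> (complex \<Rightarrow> complex) set \<Rightarrow> bool" where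
  "minimal_reducing_subspace T M \<longleftrightarrow> reducing_subspace T M \<and> nontrivial_subspace M \<and>
     (\<forall>N. reducing_subspace T N \<and> N \<subseteq> M \<longrightarrow> N = M \<or> N = {\<lambda>z. 0})"

definition mult_op :: "(complex \<Rightarrow> complex) \<Rightarrow> (complex \<Rightarrow> complex) \<Rightarrow> (complex \<Rightarrow> complex)" where
  "mult_op \<phi> f = (\<lambda>z. \<phi> z * f z)"

definition blaschke_factor :: "complex \<Rightarrow> complex \<Rightarrow> complex" where
  "blaschke_factor a z = (a - z) / (1 - cnj a * z)"

definition finite_blaschke_product :: "nat \<Rightarrow> (complex \<Rightarrow> complex) \<Rightarrow> bool" where
  "finite_blaschke_product n \<phi> \<longleftrightarrow> n \<ge> 1 \<and>
     (\<exists>c a. cmod c = 1 \<and> (\<forall>i<n. a i \<in> unit_disc) \<and>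
        (\<forall>z\<in>unit_disc. \<phi> z = c * (\<Prod>i<n. blaschke_factor (a i) z)))"

end

theory Submission
  imports Defs "HOL-Computational_Algebra.Fundamental_Theorem_Algebra"
begin

text \<open>
  Write \<open>\<langle>f, g\<rangle>\<close> for the inner product of the Dirichlet space \<open>D\<close> and \<open>M\<^sub>\<phi>\<close> for multiplication by \<open>\<phi>\<close>. The key fact is that
  the orthogonal projections \<open>P\<^sub>1\<close>, \<open>P\<^sub>2\<close> onto any two reducing subspaces \<open>M1\<close>, \<open>M2\<close> of \<open>M\<^sub>\<phi>\<close> commute
  (\<open>projections_commute\<close>). The theorem follows: \<open>M1 \<inter> M2\<close> is reducing, so by minimality it is \<open>0\<close> when \<open>M1\<close> and \<open>M2\<close>
  are distinct, and then \<open>P\<^sub>2 P\<^sub>1 = P\<^sub>1 P\<^sub>2\<close> has its range in \<open>M1 \<inter> M2 = 0\<close>.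

  To see that the projections commute, let \<open>gam\<close> be the parametrization of the unit circle along which \<open>\<phi>\<close> moves with unit
  speed, \<open>\<phi> (gam \<tau>) = \<kappa> e\<^sup>i\<^sup>\<tau>\<close>. The translation \<open>\<tau> \<mapsto> \<tau> + 2 \<pi>\<close> permutes each of the boundary fibres of \<open>\<phi>\<close>, which have \<open>n\<close>
  points, cyclically. Put \<open>tr f \<tau> = z f(z)\<close> with \<open>z = gam \<tau>\<close>. It turns out that for each reducing subspace, with projection
  \<open>P\<close>, there are constants \<open>p\<^sub>m\<close> such that
  \<open>tr (P f) \<tau> = \<Sum>\<^sub>m p\<^sub>m tr f (\<tau> + 2 \<pi> m)\<close>
  for sufficiently many \<open>f\<close> (\<open>projection_symbol\<close>). Operators of this form commute because translations do.

  Where the constants come from. For \<open>f\<close>, \<open>g\<close> holomorphic past the circle, \<open>\<langle>f, g\<rangle>\<close> is the mean of \<open>(z f)' cnj g\<close> over the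
  circle (\<open>dirichlet_inner_circle\<close>), since \<open>\<langle>f, g\<rangle> = \<Sum> (n + 1) a\<^sub>n cnj b\<^sub>n\<close>. If \<open>f\<close> lies in a reducing subspace and \<open>g\<close> in its
  orthogonal complement, then \<open>\<langle>\<phi>\<^sup>k f, \<phi>\<^sup>l g\<rangle> = 0\<close> for all \<open>k\<close>, \<open>l\<close>. Comparing these equations for different \<open>k\<close>, \<open>l\<close> and using
  uniqueness of Fourier coefficients, one finds that over every boundary fibre the vector of values of \<open>tr f\<close>, and also that
  of its derivative, is orthogonal to the vector of values of \<open>tr g\<close> (\<open>fibrewise_orthogonal\<close>). So over the fibres \<open>P\<close> acts by
  orthogonal projections of \<open>\<complex>\<^sup>n\<close> that commute with differentiation in \<open>\<tau>\<close>, which makes their matrices constant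
  (\<open>symbol_respects_derivative\<close>, \<open>solution_of_moving_system_constant\<close>).

  The functions \<open>f\<close> to which this is applied are the reproducing kernels of \<open>D\<close> at the \<open>n\<close> points of a generic fibre
  \<open>\<phi> = l\<close> inside the disc and their linear combinations. They are holomorphic past the circle. They are precisely the
  functions annihilated by the adjoint of \<open>M\<^sub>\<phi> - l\<close>, so \<open>P\<close> maps them to each other (\<open>proj_X_is_X\<close>). And their vectors
  of values exhaust \<open>\<complex>\<^sup>n\<close> over each boundary fibre, because \<open>M\<^sub>\<phi>\<close> strictly increases norms (\<open>X_zero_on_fibre_imp\<close>).
  Since the kernels at generic points determine every element of \<open>D\<close>, it suffices that the projections commute on them.
\<close>

section \<open>Area integrals over the disc\<close>

lemma lborel_complex_eq_distr:
  "(lborel :: complex measure) = distr (lborel \<Otimes>\<^sub>M lborel) borel (\<lambda>(x, y). Complex x y)"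
proof (rule lborel_eqI)
  fix l u :: complex
  assume le: "\<And>b. b \<in> Basis \<Longrightarrow> l \<bullet> b \<le> u \<bullet> b"
  have le': "Re l \<le> Re u" "Im l \<le> Im u"
    using le[of 1] le[of \<i>] by (auto simp: Basis_complex_def)
  have m: "(\<lambda>(x, y). Complex x y) \<in> borel_measurable (lborel \<Otimes>\<^sub>M lborel)"
    unfolding Complex_eq split_def lborel_prod by (auto intro!: borel_measurable_continuous_onI continuous_intros)
  have v: "(\<lambda>(x, y). Complex x y) -` box l u \<inter> space (lborel \<Otimes>\<^sub>M lborel) = box (Re l) (Re u) \<times> box (Im l) (Im u)"
    by (auto simp: box_def Basis_complex_def space_pair_measure)
  show "emeasure (distr (lborel \<Otimes>\<^sub>M lborel) borel (\<lambda>(x, y). Complex x y)) (box l u) = ennreal (\<Prod>b\<in>Basis. (u - l) \<bullet> b)"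
    using le' by (subst emeasure_distr[OF m]) (auto simp: v lborel.emeasure_pair_measure_Times Basis_complex_def ennreal_mult' ennreal_mult'' inner_complex_def)
qed simp

lemma nn_integral_complex_eq:
  fixes f :: "complex \<Rightarrow> ennreal"
  assumes [measurable]: "f \<in> borel_measurable borel"
  shows "(\<integral>\<^sup>+ z. f z \<partial>lborel) = (\<integral>\<^sup>+ x. \<integral>\<^sup>+ y. f (Complex x y) \<partial>lborel \<partial>lborel)"
    and "(\<integral>\<^sup>+ z. f z \<partial>lborel) = (\<integral>\<^sup>+ y. \<integral>\<^sup>+ x. f (Complex x y) \<partial>lborel \<partial>lborel)"
proof -
  have m[measurable]: "(\<lambda>p. Complex (fst p) (snd p)) \<in> borel_measurable (lborel \<Otimes>\<^sub>M lborel)"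
    unfolding Complex_eq split_def lborel_prod by (auto intro!: borel_measurable_continuous_onI continuous_intros)
  have m2[measurable]: "(\<lambda>p. f (Complex (fst p) (snd p))) \<in> borel_measurable (lborel \<Otimes>\<^sub>M lborel)"
    using measurable_compose[OF m assms] by simp
  have 1: "(\<integral>\<^sup>+ z. f z \<partial>lborel) = (\<integral>\<^sup>+ p. f (Complex (fst p) (snd p)) \<partial>(lborel \<Otimes>\<^sub>M lborel))"
    unfolding lborel_complex_eq_distr split_def by (subst nn_integral_distr) auto
  show "(\<integral>\<^sup>+ z. f z \<partial>lborel) = (\<integral>\<^sup>+ x. \<integral>\<^sup>+ y. f (Complex x y) \<partial>lborel \<partial>lborel)"
    unfolding 1 by (subst lborel.nn_integral_fst[symmetric]) auto
  show "(\<integral>\<^sup>+ z. f z \<partial>lborel) = (\<integral>\<^sup>+ y. \<integral>\<^sup>+ x. f (Complex x y) \<partial>lborel \<partial>lborel)"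
    unfolding 1 by (subst lborel_pair.nn_integral_snd[symmetric]) auto
qed

lemma nn_integral_lborel_shift:
  fixes f :: "real \<Rightarrow> ennreal"
  assumes "f \<in> borel_measurable borel"
  shows "(\<integral>\<^sup>+ x. f (x + t) \<partial>lborel) = (\<integral>\<^sup>+ x. f x \<partial>lborel)"
  using nn_integral_real_affine[OF assms, of 1 t] by (simp add: add.commute)

lemma nn_integral_complex_shear:
  fixes f :: "complex \<Rightarrow> ennreal"
  assumes [measurable]: "f \<in> borel_measurable borel"
  shows "(\<integral>\<^sup>+ z. f (Complex (Re z + t * Im z) (Im z)) \<partial>lborel) = (\<integral>\<^sup>+ z. f z \<partial>lborel)"
    and "(\<integral>\<^sup>+ z. f (Complex (Re z) (Im z + t * Re z)) \<partial>lborel) = (\<integral>\<^sup>+ z. f z \<partial>lborel)"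
proof -
  have c: "(\<lambda>z. Complex (g z) (h z)) \<in> borel_measurable borel" if "continuous_on UNIV g" "continuous_on UNIV h"
    for g h :: "'a::topological_space \<Rightarrow> real"
    unfolding Complex_eq using that by (auto intro!: borel_measurable_continuous_onI continuous_intros)
  have m1: "(\<lambda>z. f (Complex (Re z + t * Im z) (Im z))) \<in> borel_measurable borel"
    by (rule measurable_compose[OF c assms]) (auto intro!: continuous_intros)
  have m2: "(\<lambda>z. f (Complex (Re z) (Im z + t * Re z))) \<in> borel_measurable borel"
    by (rule measurable_compose[OF c assms]) (auto intro!: continuous_intros)
  have m3: "(\<lambda>x. f (Complex x y)) \<in> borel_measurable borel" for y
    by (rule measurable_compose[OF c assms]) (auto intro!: continuous_intros)
  have m4: "(\<lambda>y. f (Complex x y)) \<in> borel_measurable borel" for x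
    by (rule measurable_compose[OF c assms]) (auto intro!: continuous_intros)
  show "(\<integral>\<^sup>+ z. f (Complex (Re z + t * Im z) (Im z)) \<partial>lborel) = (\<integral>\<^sup>+ z. f z \<partial>lborel)"
    unfolding nn_integral_complex_eq(2)[OF m1] nn_integral_complex_eq(2)[OF assms]
    using nn_integral_lborel_shift[OF m3] by simp
  show "(\<integral>\<^sup>+ z. f (Complex (Re z) (Im z + t * Re z)) \<partial>lborel) = (\<integral>\<^sup>+ z. f z \<partial>lborel)"
    unfolding nn_integral_complex_eq(1)[OF m2] nn_integral_complex_eq(1)[OF assms]
    using nn_integral_lborel_shift[OF m4] by simp
qed

text \<open>
  A rotation is a product of three shears, and a shear preserves area because, with one coordinate
  fixed, it is a translation of the other. The factorization divides by the sine of the angle, so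
  that real \<open>u\<close> has to be left to the next lemma.
\<close>
lemma nn_integral_complex_rotate_aux:
  fixes f :: "complex \<Rightarrow> ennreal"
  assumes [measurable]: "f \<in> borel_measurable borel" and u: "cmod u = 1" "Im u \<noteq> 0"
  shows "(\<integral>\<^sup>+ z. f (u * z) \<partial>lborel) = (\<integral>\<^sup>+ z. f z \<partial>lborel)"
proof -
  define c s where "c = Re u" and "s = Im u"
  have cs: "c\<^sup>2 + s\<^sup>2 = 1" using u(1) unfolding c_def s_def cmod_def by simp
  define t where "t = (c - 1) / s"
  have s0: "s \<noteq> 0" using u s_def by simp
  have t1: "1 + t * s = c" using s0 by (simp add: t_def)
  have "t * (1 + c) = - s" using s0 cs unfolding t_def by (simp add: field_simps power2_eq_square)
  hence t2: "t + t * c = - s" by (simp add: algebra_simps)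
  define A where "A = (\<lambda>z. Complex (Re z + t * Im z) (Im z))"
  define B where "B = (\<lambda>z. Complex (Re z) (Im z + s * Re z))"
  have cA: "continuous_on UNIV A" and cB: "continuous_on UNIV B"
    unfolding A_def B_def Complex_eq by (auto intro!: continuous_intros)
  have mAB: "(\<lambda>z. f (A (B z))) \<in> borel_measurable borel"
    by (rule measurable_compose[OF _ assms(1)], rule borel_measurable_continuous_onI)
      (use continuous_on_compose2[OF cA cB] in auto)
  have mA[measurable]: "A \<in> borel_measurable borel" and mB[measurable]: "B \<in> borel_measurable borel"
    using cA cB by (auto intro!: borel_measurable_continuous_onI)
  have "u * z = A (B (A z))" for z
  proof -
    have "Re (A (B (A z))) = Re z * (1 + t * s) + Im z * (t + t * (1 + t * s))"
      unfolding A_def B_def by (simp add: algebra_simps)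
    moreover have "Im (A (B (A z))) = s * Re z + (1 + t * s) * Im z"
      unfolding A_def B_def by (simp add: algebra_simps)
    ultimately show ?thesis unfolding t1 t2 by (simp add: complex_eq_iff c_def s_def)
  qed
  hence "(\<integral>\<^sup>+ z. f (u * z) \<partial>lborel) = (\<integral>\<^sup>+ z. (\<lambda>z. f (A (B z))) (A z) \<partial>lborel)" by simp
  also have "\<dots> = (\<integral>\<^sup>+ z. (\<lambda>z. f (A z)) (B z) \<partial>lborel)"
    using nn_integral_complex_shear(1)[OF mAB, of t] unfolding A_def[symmetric] by (simp add: A_def)
  also have "\<dots> = (\<integral>\<^sup>+ z. f (A z) \<partial>lborel)"
    unfolding B_def by (subst nn_integral_complex_shear(2)) (auto simp: A_def[symmetric] measurable_compose[OF mA])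
  also have "\<dots> = (\<integral>\<^sup>+ z. f z \<partial>lborel)"
    unfolding A_def by (subst nn_integral_complex_shear(1)) auto
  finally show ?thesis .
qed

lemma nn_integral_complex_rotate:
  fixes f :: "complex \<Rightarrow> ennreal"
  assumes [measurable]: "f \<in> borel_measurable borel" and u: "cmod u = 1"
  shows "(\<integral>\<^sup>+ z. f (u * z) \<partial>lborel) = (\<integral>\<^sup>+ z. f z \<partial>lborel)"
proof (cases "Im u = 0")
  case True
  hence "Re u \<noteq> 0" using u by (auto simp: cmod_def)
  \<comment> \<open>A rotation by a real unit is the composite of two rotations by nonreal ones.\<close>
  have "(\<integral>\<^sup>+ z. f (u * z) \<partial>lborel) = (\<integral>\<^sup>+ z. f ((u * \<i>) * (-\<i> * z)) \<partial>lborel)" by (simp add: algebra_simps)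
  also have "\<dots> = (\<integral>\<^sup>+ z. f ((u * \<i>) * z) \<partial>lborel)"
    by (rule nn_integral_complex_rotate_aux[where f="\<lambda>z. f ((u * \<i>) * z)"]) auto
  also have "\<dots> = (\<integral>\<^sup>+ z. f z \<partial>lborel)"
    by (rule nn_integral_complex_rotate_aux) (use u \<open>Re u \<noteq> 0\<close> in \<open>auto simp: norm_mult\<close>)
  finally show ?thesis .
qed (rule nn_integral_complex_rotate_aux[OF assms])

text \<open>
  Layer cake formula, for \<open>n > 0\<close>: \<open>\<bar>z\<bar>\<^sup>2\<^sup>n\<close> is
  the integral of its derivative \<open>g\<close> over \<open>[0, \<bar>z\<bar>]\<close>, and the
  points of the disc with \<open>t \<le> \<bar>z\<bar>\<close> have area \<open>\<pi> (1 -
  t\<^sup>2)\<close>.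
\<close>
lemma nn_integral_disc_norm_power:
  "(\<integral>\<^sup>+ z. ennreal (cmod z ^ (2 * n)) * indicator (ball 0 1) z \<partial>lborel) = ennreal (pi / (n + 1))"
proof (cases "n = 0")
  case True
  have "(\<integral>\<^sup>+ z. ennreal (cmod z ^ (2 * n)) * indicator (ball 0 1) z \<partial>lborel) = emeasure lborel (ball (0::complex) 1)"
    by (simp add: True)
  also have "\<dots> = ennreal pi"
    by (subst emeasure_ball) (auto simp: unit_ball_vol_2)
  finally show ?thesis by (simp add: True)
next
  case False
  define g where "g t = 2 * real n * t ^ (2 * n - 1)" for t :: real
  have cg: "continuous_on UNIV g" unfolding g_def by (intro continuous_intros)
  have [measurable]: "g \<in> borel_measurable borel" by (rule borel_measurable_continuous_onI[OF cg])
  have g0: "g t \<ge> 0" if "t \<ge> 0" for t using that by (simp add: g_def)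
  have step: "ennreal (r ^ (2 * n)) = (\<integral>\<^sup>+ t. ennreal (g t) * indicator {0..r} t \<partial>lborel)" if "r \<ge> 0" for r
  proof (subst nn_integral_FTC_Icc[where F="\<lambda>t. t ^ (2 * n)"])
    fix x
    show "((\<lambda>t. t ^ (2 * n)) has_real_derivative g x) (at x)"
      unfolding g_def
      by (auto intro!: derivative_eq_intros)
  qed (use that g0 False in auto)
  have "(\<integral>\<^sup>+ z. ennreal (cmod z ^ (2 * n)) * indicator (ball 0 1) z \<partial>lborel)
      = (\<integral>\<^sup>+ z. (\<integral>\<^sup>+ t. ennreal (g t) * indicator {0..cmod z} t * indicator (ball 0 1) z \<partial>lborel) \<partial>lborel)"
    by (subst step) (auto intro!: nn_integral_cong simp: nn_integral_multc)
  also have "\<dots> = (\<integral>\<^sup>+ t. (\<integral>\<^sup>+ z. ennreal (g t) * indicator {0..cmod z} t * indicator (ball 0 1) z \<partial>lborel) \<partial>lborel)"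
    by (rule lborel_pair.Fubini') (unfold indicator_def split_def atLeastAtMost_iff mem_ball dist_0_norm, measurable)
  also have "\<dots> = (\<integral>\<^sup>+ t. ennreal (g t * (pi * (1 - t\<^sup>2))) * indicator {0..1} t \<partial>lborel)"
  proof (rule nn_integral_cong, goal_cases)
    case (1 t)
    show ?case
    proof (cases "t \<in> {0..1}")
      case True
      have "(\<integral>\<^sup>+ z. ennreal (g t) * indicator {0..cmod z} t * indicator (ball 0 1) z \<partial>lborel)
        = (\<integral>\<^sup>+ z. ennreal (g t) * indicator (ball 0 1 - ball 0 t) (z :: complex) \<partial>lborel)"
        by (rule nn_integral_cong) (use True in \<open>auto simp: indicator_def\<close>)
      also have "\<dots> = ennreal (g t) * emeasure lborel (ball 0 1 - ball 0 t :: complex set)"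
        by (simp add: nn_integral_cmult_indicator)
      also have "emeasure lborel (ball 0 1 - ball 0 t :: complex set) = ennreal (pi * (1 - t\<^sup>2))"
        using True by (subst emeasure_Diff)
          (auto simp: emeasure_ball unit_ball_vol_2 emeasure_lborel_ball_finite algebra_simps ennreal_minus)
      finally show ?thesis using True g0 by (simp add: ennreal_mult' power_le_one)
    next
      case False
      hence "(\<integral>\<^sup>+ z. ennreal (g t) * indicator {0..cmod z} t * indicator (ball 0 1) (z::complex) \<partial>lborel) = (\<integral>\<^sup>+ (z::complex). 0 \<partial>lborel)"
        by (intro nn_integral_cong) (auto simp: indicator_def)
      thus ?thesis using False by simp
    qed
  qed
  also have "\<dots> = ennreal (pi * (1 - real n / (n + 1)) - 0)"
  proof (subst nn_integral_FTC_Icc[where F="\<lambda>t. pi * (t ^ (2 * n) - real n / (n + 1) * t ^ (2 * n + 2))"])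
    fix x
    show "((\<lambda>t. pi * (t ^ (2 * n) - real n / (n + 1) * t ^ (2 * n + 2))) has_real_derivative g x * (pi * (1 - x\<^sup>2))) (at x)"
    proof -
      obtain k where k: "n = Suc k" using False by (cases n) auto
      have q: "real n / (n + 1) * real (2 * n + 2) = 2 * n" by (simp add: field_simps)
      have e: "2 * n - Suc 0 = 2 * k + 1" "2 * n - 1 = 2 * k + 1" "2 * n + 2 - Suc 0 = 2 * k + 3" using k by auto
      have x: "x ^ (2 * k + 3) = x ^ (2 * k + 1) * x\<^sup>2" by (simp add: eval_nat_numeral)
      have "pi * (real (2 * n) * x ^ (2 * k + 1) - real n / (n + 1) * (real (2 * n + 2) * x ^ (2 * k + 3)))
        = pi * (real (2 * n) * x ^ (2 * k + 1) - (real n / (n + 1) * real (2 * n + 2)) * x ^ (2 * k + 3))"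
        by (simp only: mult.assoc)
      also have "\<dots> = 2 * real n * x ^ (2 * k + 1) * (pi * (1 - x\<^sup>2))"
        unfolding q x by (simp add: algebra_simps)
      finally have fin: "pi * (real (2 * n) * x ^ (2 * k + 1) - real n / (n + 1) * (real (2 * n + 2) * x ^ (2 * k + 3)))
         = g x * (pi * (1 - x\<^sup>2))" unfolding g_def e .
      show ?thesis
        by (rule DERIV_cong[OF DERIV_cmult[OF DERIV_diff[OF DERIV_pow[of "2 * n" x]
              DERIV_cmult[OF DERIV_pow[of "2 * n + 2" x], of "real n / (n + 1)"]], of pi]])
           (unfold e, rule fin)
    qed
  next
    fix x :: real assume "x \<in> {0..1}"
    thus "0 \<le> g x * (pi * (1 - x\<^sup>2))" by (intro mult_nonneg_nonneg g0) (auto simp: power_le_one)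
  next
    show "(\<lambda>t. g t * (pi * (1 - t\<^sup>2))) \<in> borel_measurable borel" by measurable
  qed (use False in \<open>simp_all add: power_0_left\<close>)
  also have "pi * (1 - real n / (n + 1)) - 0 = pi / (n + 1)" by (simp add: field_simps)
  finally show ?thesis .
qed

lemma has_integral_suminf:
  fixes f :: "nat \<Rightarrow> real \<Rightarrow> complex"
  assumes f: "\<And>n. (f n has_integral I n) {a..b}" and M: "summable M"
    and c: "\<And>n. continuous_on {a..b} (f n)"
    and le: "\<And>n x. x \<in> {a..b} \<Longrightarrow> cmod (f n x) \<le> M n"
  shows "((\<lambda>x. \<Sum>n. f n x) has_integral (\<Sum>n. I n)) {a..b}" "summable I"
proof -
  have ul: "uniform_limit {a..b} (\<lambda>N x. \<Sum>n<N. f n x) (\<lambda>x. \<Sum>n. f n x) sequentially"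
    by (rule Weierstrass_m_test[OF le M])
  have hi: "((\<lambda>x. \<Sum>n<N. f n x) has_integral (\<Sum>n<N. I n)) (cbox a b)" for N
    using f by (intro has_integral_sum) auto
  obtain I' J where I': "\<And>N. ((\<lambda>x. \<Sum>n<N. f n x) has_integral I' N) {a..b}"
      and J: "((\<lambda>x. \<Sum>n. f n x) has_integral J) {a..b}" "I' \<longlonglongrightarrow> J"
    by (rule uniform_limit_integral[OF ul]) (auto intro!: continuous_intros c)
  have "I' N = (\<Sum>n<N. I n)" for N
    using has_integral_unique[OF I' hi[unfolded cbox_interval]] .
  hence "I' = (\<lambda>N. \<Sum>n<N. I n)" by auto
  hence "I sums J" using J(2) by (simp add: sums_def)
  with J show "((\<lambda>x. \<Sum>n. f n x) has_integral (\<Sum>n. I n)) {a..b}" "summable I"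
    by (auto simp: sums_iff)
qed

lemma has_integral_cis:
  "((\<lambda>\<theta>. cis \<theta> ^ n * cnj (cis \<theta> ^ m)) has_integral (if n = m then 2 * pi else 0)) {0..2 * pi}"
proof -
  have e: "cis \<theta> ^ n * cnj (cis \<theta> ^ m) = cis ((real n - real m) * \<theta>)" for \<theta>
  proof -
    have "cis \<theta> ^ n = cis (real n * \<theta>)" "cis (- \<theta>) ^ m = cis (real m * (- \<theta>))"
      by (rule Complex.DeMoivre)+
    thus ?thesis by (simp add: cis_cnj cis_mult algebra_simps)
  qed
  show ?thesis
  proof (cases "n = m")
    case True
    have "((\<lambda>\<theta>::real. 1 :: complex) has_integral measure lborel {0..2 * pi} *\<^sub>R 1) {0..2 * pi}"
      by (rule has_integral_const_real)
    thus ?thesis unfolding e by (simp add: True scaleR_conv_of_real)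
  next
    case False
    define k where "k = real n - real m"
    have k: "k \<noteq> 0" using False by (simp add: k_def)
    have c: "cis (k * (2 * pi)) = 1"
    proof -
      have "cis (k * (2 * pi)) = cis (2 * pi * of_int (int n - int m))" by (simp add: k_def algebra_simps)
      thus ?thesis by (simp add: cis_multiple_2pi)
    qed
    have "((\<lambda>\<theta>. cis (k * \<theta>)) has_integral cis (k * (2 * pi)) / (\<i> * k) - cis (k * 0) / (\<i> * k)) {0..2 * pi}"
    proof (rule fundamental_theorem_of_calculus)
      fix x
      show "((\<lambda>\<theta>. cis (k * \<theta>) / (\<i> * k)) has_vector_derivative cis (k * x)) (at x within {0..2 * pi})"
        unfolding cis_conv_exp
        by (auto intro!: derivative_eq_intros has_vector_derivative_real_field simp: k scaleR_conv_of_real mult_ac)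
    qed simp
    thus ?thesis unfolding e k_def[symmetric] using False by (simp add: c)
  qed
qed

text \<open>
  Both series converge uniformly on the circle, so that the integral may be taken term by term,
  first in \<open>a\<close> and then in \<open>b\<close>.
\<close>
lemma circle_parseval:
  fixes a b :: "nat \<Rightarrow> complex"
  assumes a: "summable (\<lambda>n. cmod (a n))" and b: "summable (\<lambda>n. cmod (b n))"
  shows "((\<lambda>\<theta>. (\<Sum>n. a n * cis \<theta> ^ n) * cnj (\<Sum>n. b n * cis \<theta> ^ n)) has_integral
           2 * pi * (\<Sum>n. a n * cnj (b n))) {0..2 * pi}"
    and "summable (\<lambda>n. a n * cnj (b n))"
proof -
  define A where "A \<theta> = (\<Sum>n. a n * cis \<theta> ^ n)" for \<theta>
  define B where "B \<theta> = (\<Sum>n. b n * cis \<theta> ^ n)" for \<theta>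
  have sa: "summable (\<lambda>n. a n * cis \<theta> ^ n)" for \<theta>
    by (rule summable_norm_cancel) (simp add: norm_mult norm_power a)
  have sb: "summable (\<lambda>n. b n * cis \<theta> ^ n)" for \<theta>
    by (rule summable_norm_cancel) (simp add: norm_mult norm_power b)
  have cA: "continuous_on {0..2 * pi} A"
  proof (rule uniform_limit_theorem)
    show "uniform_limit {0..2 * pi} (\<lambda>N x. \<Sum>n<N. a n * cis x ^ n) A sequentially"
      unfolding A_def by (rule Weierstrass_m_test[OF _ a]) (simp add: norm_mult norm_power)
  qed (auto intro!: always_eventually continuous_intros)
  have Am: "((\<lambda>\<theta>. A \<theta> * cnj (cis \<theta> ^ m)) has_integral 2 * pi * a m) {0..2 * pi}" for m
  proof -
    have "((\<lambda>\<theta>. \<Sum>n. a n * (cis \<theta> ^ n * cnj (cis \<theta> ^ m))) has_integral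
        (\<Sum>n. a n * (if n = m then 2 * pi else 0))) {0..2 * pi}"
      by (rule has_integral_suminf(1)[OF has_integral_mult_right[OF has_integral_cis] a])
         (auto intro!: continuous_intros simp: norm_mult norm_power)
    also have "(\<lambda>\<theta>. \<Sum>n. a n * (cis \<theta> ^ n * cnj (cis \<theta> ^ m))) = (\<lambda>\<theta>. A \<theta> * cnj (cis \<theta> ^ m))"
      unfolding A_def by (subst suminf_mult2[OF sa]) (simp add: mult.assoc)
    also have "(\<Sum>n. a n * complex_of_real (if n = m then 2 * pi else 0)) = (\<Sum>n\<in>{m}. a n * (if n = m then 2 * pi else 0))"
      by (rule suminf_finite) auto
    finally show ?thesis by (simp add: mult_ac)
  qed
  have bd: "cmod (A \<theta>) \<le> (\<Sum>n. cmod (a n))" for \<theta>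
    unfolding A_def by (rule order_trans[OF summable_norm]) (simp_all add: norm_mult norm_power a)
  have *: "((\<lambda>\<theta>. \<Sum>m. cnj (b m) * (A \<theta> * cnj (cis \<theta> ^ m))) has_integral
        (\<Sum>m. cnj (b m) * (2 * pi * a m))) {0..2 * pi}"
    "summable (\<lambda>m. cnj (b m) * (2 * pi * a m))"
  proof -
    have le: "cmod (cnj (b n) * (A x * cnj (cis x ^ n))) \<le> (\<Sum>n. cmod (a n)) * cmod (b n)" for n x
      using mult_right_mono[OF bd[of x], of "cmod (b n)"] by (simp add: norm_mult norm_power mult_ac)
    have i: "((\<lambda>\<theta>. cnj (b m) * (A \<theta> * cnj (cis \<theta> ^ m))) has_integral cnj (b m) * (2 * pi * a m)) {0..2 * pi}" for m
      by (rule has_integral_mult_right[OF Am])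
    have c: "continuous_on {0..2 * pi} (\<lambda>\<theta>. cnj (b m) * (A \<theta> * cnj (cis \<theta> ^ m)))" for m
      by (auto intro!: continuous_intros cA)
    note h = has_integral_suminf[OF i summable_mult[OF b] c le]
    show "((\<lambda>\<theta>. \<Sum>m. cnj (b m) * (A \<theta> * cnj (cis \<theta> ^ m))) has_integral
        (\<Sum>m. cnj (b m) * (2 * pi * a m))) {0..2 * pi}" by (rule h(1))
    show "summable (\<lambda>m. cnj (b m) * (2 * pi * a m))" by (rule h(2))
  qed
  have e: "cnj (b m) * (2 * pi * a m) = 2 * pi * (a m * cnj (b m))" for m by (simp add: mult_ac)
  show s: "summable (\<lambda>n. a n * cnj (b n))"
    using *(2) unfolding e by (subst (asm) summable_cmult_iff) auto
  have "(\<lambda>\<theta>. \<Sum>m. cnj (b m) * (A \<theta> * cnj (cis \<theta> ^ m))) = (\<lambda>\<theta>. A \<theta> * cnj (B \<theta>))"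
  proof
    fix \<theta>
    have "(\<lambda>m. cnj (b m * cis \<theta> ^ m)) sums cnj (B \<theta>)"
      unfolding B_def sums_cnj using sb[of \<theta>] by (rule summable_sums)
    from sums_mult[OF this, of "A \<theta>"]
    show "(\<Sum>m. cnj (b m) * (A \<theta> * cnj (cis \<theta> ^ m))) = A \<theta> * cnj (B \<theta>)"
      by (simp add: sums_iff mult_ac)
  qed
  thus "((\<lambda>\<theta>. (\<Sum>n. a n * cis \<theta> ^ n) * cnj (\<Sum>n. b n * cis \<theta> ^ n)) has_integral
           2 * pi * (\<Sum>n. a n * cnj (b n))) {0..2 * pi}"
    using *(1) suminf_mult[OF s, of "2 * pi"] unfolding e A_def B_def by simp
qed

lemma nn_integral_circle_mean_square:
  fixes c :: "nat \<Rightarrow> complex"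
  assumes c: "\<And>w. cmod w < 1 \<Longrightarrow> (\<lambda>n. c n * w ^ n) sums h w" and z: "cmod z < 1"
  shows "(\<integral>\<^sup>+ \<theta>. ennreal ((cmod (h (cis \<theta> * z)))\<^sup>2) * indicator {0..2 * pi} \<theta> \<partial>lborel)
     = (\<Sum>n. ennreal (2 * pi * (cmod (c n))\<^sup>2 * cmod z ^ (2 * n)))"
proof -
  define r where "r = cmod z"
  define a where "a n = c n * z ^ n" for n
  have a: "summable (\<lambda>n. cmod (a n))"
  proof -
    obtain s where s: "r < s" "s < 1" using z dense r_def by blast
    have "0 < s" using s(1) unfolding r_def by (meson le_less_trans norm_ge_zero)
    hence "summable (\<lambda>n. c n * of_real s ^ n)" using c[of "of_real s"] s by (auto simp: sums_iff)
    from powser_insidea[OF this, of z] show ?thesis using s \<open>0 < s\<close> by (simp add: a_def r_def)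
  qed
  have h: "h (cis \<theta> * z) = (\<Sum>n. a n * cis \<theta> ^ n)" for \<theta>
    using c[of "cis \<theta> * z"] z by (simp add: a_def norm_mult power_mult_distrib sums_iff mult_ac)
  have sq: "x * cnj x = of_real ((cmod x)\<^sup>2)" for x
    by (simp only: complex_norm_square)
  have s: "summable (\<lambda>n. (cmod (a n))\<^sup>2)"
    using circle_parseval(2)[OF a a] unfolding sq by (rule iffD1[OF summable_of_real_iff])
  have "((\<lambda>\<theta>. of_real ((cmod (h (cis \<theta> * z)))\<^sup>2) :: complex) has_integral of_real (2 * pi * (\<Sum>n. (cmod (a n))\<^sup>2))) {0..2 * pi}"
    using circle_parseval(1)[OF a a] unfolding h[symmetric] sq by (simp add: suminf_of_real[OF s])
  from has_integral_linear[OF this bounded_linear_Re]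
  have hi: "((\<lambda>\<theta>. (cmod (h (cis \<theta> * z)))\<^sup>2) has_integral (2 * pi * (\<Sum>n. (cmod (a n))\<^sup>2))) {0..2 * pi}"
    by (simp add: o_def del: of_real_power of_real_mult)
  have "(\<integral>\<^sup>+ \<theta>. ennreal ((cmod (h (cis \<theta> * z)))\<^sup>2) * indicator {0..2 * pi} \<theta> \<partial>lborel)
     = ennreal (2 * pi * (\<Sum>n. (cmod (a n))\<^sup>2))"
  proof -
    have "integral\<^sup>N lborel (\<lambda>\<theta>. indicator {0..2 * pi} \<theta> * (cmod (h (cis \<theta> * z)))\<^sup>2) = 2 * pi * (\<Sum>n. (cmod (a n))\<^sup>2)"
      by (rule nn_integral_has_integral_lebesgue[OF _ hi]) simp
    thus ?thesis by (subst nn_integral_set_ennreal) (simp add: mult.commute)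
  qed
  also have "\<dots> = (\<Sum>n. ennreal (2 * pi * (cmod (a n))\<^sup>2))"
    using suminf_mult[OF s, of "2 * pi"] summable_mult[OF s, of "2 * pi"] by (subst suminf_ennreal2) auto
  finally show ?thesis by (simp add: a_def norm_mult norm_power power_mult_distrib power_mult[symmetric] mult_ac)
qed

text \<open>
  By rotation invariance the integral over the disc equals its average over all rotations of the
  integrand; that average is a circle mean, which Parseval evaluates. All terms are nonnegative,
  so Tonelli's theorem applies and the identity also holds with the value
  \<open>\<infinity>\<close>.
\<close>
lemma nn_integral_disc_square:
  fixes c :: "nat \<Rightarrow> complex"
  assumes c: "\<And>w. cmod w < 1 \<Longrightarrow> (\<lambda>n. c n * w ^ n) sums h w" and hol: "h holomorphic_on ball 0 1"
  shows "(\<integral>\<^sup>+ z. ennreal ((cmod (h z))\<^sup>2) * indicator (ball 0 1) z \<partial>lborel)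
     = (\<Sum>n. ennreal (pi * (cmod (c n))\<^sup>2 / (n + 1)))"
proof -
  define g where "g z = ennreal ((cmod (h z))\<^sup>2) * indicator (ball 0 1) z" for z
  define G where "G z = indicator (ball 0 1) z *\<^sub>R h z" for z
  have [measurable]: "G \<in> borel_measurable borel"
    unfolding G_def by (rule borel_measurable_continuous_on_indicator) (use hol holomorphic_on_imp_continuous_on in auto)
  have "g = (\<lambda>z. ennreal ((cmod (G z))\<^sup>2))"
    by (auto simp: g_def G_def indicator_def fun_eq_iff)
  hence mg[measurable]: "g \<in> borel_measurable borel" by simp
  have mcis[measurable]: "(\<lambda>\<theta>. cis \<theta>) \<in> borel_measurable borel"
    by (intro borel_measurable_continuous_onI continuous_intros)
  let ?I = "\<integral>\<^sup>+ z. g z \<partial>lborel"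
  have "ennreal (2 * pi) * ?I = (\<integral>\<^sup>+ \<theta>. (\<integral>\<^sup>+ z. g (cis \<theta> * z) * indicator {0..2 * pi} \<theta> \<partial>lborel) \<partial>lborel)"
  proof -
    have "(\<integral>\<^sup>+ z. g (cis \<theta> * z) * indicator {0..2 * pi} \<theta> \<partial>lborel) = ?I * indicator {0..2 * pi} \<theta>" for \<theta>
      by (subst nn_integral_multc) (auto simp: nn_integral_complex_rotate[OF mg])
    thus ?thesis by (simp add: nn_integral_cmult_indicator mult.commute)
  qed
  also have "\<dots> = (\<integral>\<^sup>+ z. (\<integral>\<^sup>+ \<theta>. g (cis \<theta> * z) * indicator {0..2 * pi} \<theta> \<partial>lborel) \<partial>lborel)"
    by (rule lborel_pair.Fubini'[symmetric]) measurable
  also have "\<dots> = (\<integral>\<^sup>+ z. (\<Sum>n. ennreal (2 * pi * (cmod (c n))\<^sup>2) * (ennreal (cmod z ^ (2 * n)) * indicator (ball 0 1) z)) \<partial>lborel)"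
  proof (rule nn_integral_cong, goal_cases)
    case (1 z)
    show ?case
    proof (cases "cmod z < 1")
      case True
      hence "g (cis \<theta> * z) = ennreal ((cmod (h (cis \<theta> * z)))\<^sup>2)" for \<theta> by (simp add: g_def norm_mult)
      thus ?thesis using nn_integral_circle_mean_square[OF c True] True by (simp add: ennreal_mult')
    qed (simp add: g_def norm_mult)
  qed
  also have "\<dots> = (\<Sum>n. ennreal (2 * pi * (cmod (c n))\<^sup>2) * ennreal (pi / (n + 1)))"
  proof -
    have m: "(\<lambda>z::complex. ennreal (cmod z ^ (2 * n)) * indicator (ball 0 1) z) \<in> borel_measurable lborel" for n
      by (intro borel_measurable_times_ennreal borel_measurable_indicator) auto
    show ?thesis
      by (subst nn_integral_suminf, intro borel_measurable_times_ennreal[OF _ m])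
         (simp_all only: nn_integral_cmult[OF m] nn_integral_disc_norm_power, simp_all)
  qed
  also have "\<dots> = (\<Sum>n. ennreal (2 * pi) * ennreal (pi * (cmod (c n))\<^sup>2 / (n + 1)))"
    by (simp add: ennreal_mult'[symmetric] mult_ac)
  also have "\<dots> = ennreal (2 * pi) * (\<Sum>n. ennreal (pi * (cmod (c n))\<^sup>2 / (n + 1)))" by simp
  finally have "?I = (\<Sum>n. ennreal (pi * (cmod (c n))\<^sup>2 / (n + 1)))"
    by (simp add: ennreal_mult_cancel_left)
  thus ?thesis by (simp add: g_def)
qed

section \<open>Orthogonal projections in a Hilbert space of functions\<close>

text \<open>
  The vectors are functions with the pointwise operations, because this is how the elements of the
  Dirichlet space are given.
\<close>
locale function_hilbert_space =
  fixes H :: "('a \<Rightarrow> complex) set" and ip :: "('a \<Rightarrow> complex) \<Rightarrow> ('a \<Rightarrow> complex) \<Rightarrow> complex"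
  assumes zero: "(\<lambda>x. 0) \<in> H"
    and lin: "\<And>f g c. f \<in> H \<Longrightarrow> g \<in> H \<Longrightarrow> (\<lambda>x. f x + c * g x) \<in> H"
    and ip_lin: "\<And>f g h c. f \<in> H \<Longrightarrow> g \<in> H \<Longrightarrow> h \<in> H \<Longrightarrow> ip (\<lambda>x. f x + c * g x) h = ip f h + c * ip g h"
    and ip_cnj: "\<And>f g. f \<in> H \<Longrightarrow> g \<in> H \<Longrightarrow> ip g f = cnj (ip f g)"
    and ip_nonneg: "\<And>f. f \<in> H \<Longrightarrow> 0 \<le> Re (ip f f)"
    and ip_definite: "\<And>f. f \<in> H \<Longrightarrow> ip f f = 0 \<Longrightarrow> f = (\<lambda>x. 0)"
    and complete: "\<And>F :: nat \<Rightarrow> 'a \<Rightarrow> complex. (\<And>k. F k \<in> H) \<Longrightarrow>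
      (\<And>e. e > 0 \<Longrightarrow> \<exists>N. \<forall>m\<ge>N. \<forall>n\<ge>N. sqrt (Re (ip (\<lambda>x. F m x - F n x) (\<lambda>x. F m x - F n x))) < e) \<Longrightarrow>
      \<exists>g\<in>H. (\<lambda>k. sqrt (Re (ip (\<lambda>x. F k x - g x) (\<lambda>x. F k x - g x)))) \<longlonglongrightarrow> 0"
begin

definition nrm :: "('a \<Rightarrow> complex) \<Rightarrow> real" where "nrm f = sqrt (Re (ip f f))"

lemma add: "f \<in> H \<Longrightarrow> g \<in> H \<Longrightarrow> (\<lambda>x. f x + g x) \<in> H"
  using lin[of f g 1] by simp

lemma diff: "f \<in> H \<Longrightarrow> g \<in> H \<Longrightarrow> (\<lambda>x. f x - g x) \<in> H"
  using lin[of f g "-1"] by simp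

lemma scale: "f \<in> H \<Longrightarrow> (\<lambda>x. c * f x) \<in> H"
  using lin[of "\<lambda>x. 0" f c] zero by simp

lemma ip_zero_left: "h \<in> H \<Longrightarrow> ip (\<lambda>x. 0) h = 0"
  using ip_lin[of "\<lambda>x. 0" "\<lambda>x. 0" h 1] zero by simp

lemma ip_add: "f \<in> H \<Longrightarrow> g \<in> H \<Longrightarrow> h \<in> H \<Longrightarrow> ip (\<lambda>x. f x + g x) h = ip f h + ip g h"
  using ip_lin[of f g h 1] by simp

lemma ip_diff: "f \<in> H \<Longrightarrow> g \<in> H \<Longrightarrow> h \<in> H \<Longrightarrow> ip (\<lambda>x. f x - g x) h = ip f h - ip g h"
  using ip_lin[of f g h "-1"] by simp

lemma ip_scale: "f \<in> H \<Longrightarrow> h \<in> H \<Longrightarrow> ip (\<lambda>x. c * f x) h = c * ip f h"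
  using ip_lin[of "\<lambda>x. 0" f h c] zero by (simp add: ip_zero_left)

lemma ip_zero_right: "h \<in> H \<Longrightarrow> ip h (\<lambda>x. 0) = 0"
  using ip_cnj[of "\<lambda>x. 0" h] zero by (simp add: ip_zero_left)

lemma ip_add_right: "f \<in> H \<Longrightarrow> g \<in> H \<Longrightarrow> h \<in> H \<Longrightarrow> ip h (\<lambda>x. f x + g x) = ip h f + ip h g"
  using ip_cnj[of "\<lambda>x. f x + g x" h] ip_cnj[of f h] ip_cnj[of g h] by (simp add: ip_add add)

lemma ip_diff_right: "f \<in> H \<Longrightarrow> g \<in> H \<Longrightarrow> h \<in> H \<Longrightarrow> ip h (\<lambda>x. f x - g x) = ip h f - ip h g"
  using ip_cnj[of "\<lambda>x. f x - g x" h] ip_cnj[of f h] ip_cnj[of g h] by (simp add: ip_diff diff)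

lemma ip_scale_right: "f \<in> H \<Longrightarrow> h \<in> H \<Longrightarrow> ip h (\<lambda>x. c * f x) = cnj c * ip h f"
  using ip_cnj[of "\<lambda>x. c * f x" h] ip_cnj[of f h] by (simp add: ip_scale scale)

lemmas ip_simps = ip_add ip_diff ip_scale ip_add_right ip_diff_right ip_scale_right add diff scale

lemma sum_in: "finite A \<Longrightarrow> (\<And>i. i \<in> A \<Longrightarrow> f i \<in> H) \<Longrightarrow> (\<lambda>x. \<Sum>i\<in>A. c i * f i x) \<in> H"
  by (induction A rule: finite_induct) (auto intro!: zero add scale)

lemma ip_sum_right: "finite A \<Longrightarrow> (\<And>i. i \<in> A \<Longrightarrow> f i \<in> H) \<Longrightarrow> h \<in> H \<Longrightarrow>
   ip h (\<lambda>x. \<Sum>i\<in>A. c i * f i x) = (\<Sum>i\<in>A. cnj (c i) * ip h (f i))"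
  by (induction A rule: finite_induct) (auto simp: ip_zero_right ip_add_right ip_scale_right sum_in scale)

lemma ip_self: "f \<in> H \<Longrightarrow> ip f f = of_real ((nrm f)\<^sup>2)"
  using ip_cnj[of f f] ip_nonneg[of f] by (simp add: nrm_def complex_eq_iff)

lemma nrm_nonneg: "f \<in> H \<Longrightarrow> 0 \<le> nrm f"
  by (simp add: nrm_def ip_nonneg)

lemma nrm_sq: "f \<in> H \<Longrightarrow> (nrm f)\<^sup>2 = Re (ip f f)"
  by (simp add: ip_self)

lemma nrm_sq_add_scale:
  assumes "f \<in> H" "g \<in> H"
  shows "(nrm (\<lambda>x. f x + c * g x))\<^sup>2 = (nrm f)\<^sup>2 + 2 * Re (cnj c * ip f g) + (cmod c)\<^sup>2 * (nrm g)\<^sup>2"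
proof -
  have "ip (\<lambda>x. f x + c * g x) (\<lambda>x. f x + c * g x) = ip f f + cnj c * ip f g + cnj (cnj c * ip f g) + c * cnj c * ip g g"
    using assms ip_cnj[of f g] by (simp add: ip_simps algebra_simps)
  hence "Re (ip (\<lambda>x. f x + c * g x) (\<lambda>x. f x + c * g x)) = Re (ip f f) + 2 * Re (cnj c * ip f g) + Re (c * cnj c * ip g g)"
    by simp
  moreover have "c * cnj c * ip g g = of_real ((cmod c)\<^sup>2 * (nrm g)\<^sup>2)"
    using assms by (simp add: ip_self complex_norm_square[symmetric])
  ultimately show ?thesis using assms by (simp only: nrm_sq lin) (simp add: nrm_sq)
qed

lemma cauchy_schwarz:
  assumes f: "f \<in> H" and g: "g \<in> H"
  shows "cmod (ip f g) \<le> nrm f * nrm g"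
proof (cases "nrm g = 0")
  case True
  hence "ip g g = 0" using ip_self[OF g] by simp
  thus ?thesis using ip_definite[OF g] True f by (simp add: ip_zero_right)
next
  case False
  define c where "c = - ip f g / of_real ((nrm g)\<^sup>2)"
  have "0 \<le> (nrm f)\<^sup>2 + 2 * Re (cnj c * ip f g) + (cmod c)\<^sup>2 * (nrm g)\<^sup>2"
    unfolding nrm_sq_add_scale[OF f g, symmetric] by simp
  also have "cnj c * ip f g = of_real (- (cmod (ip f g))\<^sup>2 / (nrm g)\<^sup>2)"
    unfolding c_def using complex_norm_square[of "ip f g"] by (simp add: mult.commute)
  also have "(cmod c)\<^sup>2 = (cmod (ip f g))\<^sup>2 / ((nrm g)\<^sup>2)\<^sup>2"
    unfolding c_def by (simp add: norm_divide power_divide norm_power)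
  finally have "0 \<le> (nrm f)\<^sup>2 - (cmod (ip f g))\<^sup>2 / (nrm g)\<^sup>2"
    using False by (simp add: power2_eq_square)
  hence "(cmod (ip f g))\<^sup>2 \<le> (nrm f * nrm g)\<^sup>2"
    using False by (simp add: field_simps power_mult_distrib)
  thus ?thesis using nrm_nonneg f g by (meson mult_nonneg_nonneg power2_le_imp_le)
qed

lemma nrm_triangle:
  assumes f: "f \<in> H" and g: "g \<in> H"
  shows "nrm (\<lambda>x. f x + g x) \<le> nrm f + nrm g"
proof (rule power2_le_imp_le)
  have "(nrm (\<lambda>x. f x + g x))\<^sup>2 = (nrm f)\<^sup>2 + 2 * Re (ip f g) + (nrm g)\<^sup>2"
    using nrm_sq_add_scale[OF f g, of 1] by simp
  also have "Re (ip f g) \<le> nrm f * nrm g"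
    using cauchy_schwarz[OF f g] complex_Re_le_cmod order_trans by blast
  finally show "(nrm (\<lambda>x. f x + g x))\<^sup>2 \<le> (nrm f + nrm g)\<^sup>2" by (simp add: power2_sum)
qed (simp add: nrm_nonneg f g)

definition closed_sub :: "('a \<Rightarrow> complex) set \<Rightarrow> bool" where
  "closed_sub M \<longleftrightarrow> M \<subseteq> H \<and> (\<lambda>x. 0) \<in> M \<and> (\<forall>f\<in>M. \<forall>g\<in>M. (\<lambda>x. f x + g x) \<in> M) \<and>
     (\<forall>c. \<forall>f\<in>M. (\<lambda>x. c * f x) \<in> M) \<and>
     (\<forall>F g. (\<forall>k::nat. F k \<in> M) \<and> g \<in> H \<and> (\<lambda>k. nrm (\<lambda>x. F k x - g x)) \<longlonglongrightarrow> 0 \<longrightarrow> g \<in> M)"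

lemma closed_subD:
  assumes "closed_sub M"
  shows "f \<in> M \<Longrightarrow> f \<in> H" "(\<lambda>x. 0) \<in> M" "f \<in> M \<Longrightarrow> g \<in> M \<Longrightarrow> (\<lambda>x. f x + g x) \<in> M"
    "f \<in> M \<Longrightarrow> (\<lambda>x. c * f x) \<in> M" "f \<in> M \<Longrightarrow> g \<in> M \<Longrightarrow> (\<lambda>x. f x - g x) \<in> M"
    "(\<And>k::nat. F k \<in> M) \<Longrightarrow> g \<in> H \<Longrightarrow> (\<lambda>k. nrm (\<lambda>x. F k x - g x)) \<longlonglongrightarrow> 0 \<Longrightarrow> g \<in> M"
proof -
  show a: "f \<in> M \<Longrightarrow> f \<in> H" "(\<lambda>x. 0) \<in> M" "f \<in> M \<Longrightarrow> g \<in> M \<Longrightarrow> (\<lambda>x. f x + g x) \<in> M" 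
    "f \<in> M \<Longrightarrow> (\<lambda>x. c * f x) \<in> M" for f g c
    using assms unfolding closed_sub_def by blast+
  show "f \<in> M \<Longrightarrow> g \<in> M \<Longrightarrow> (\<lambda>x. f x - g x) \<in> M"
    using a(3)[of f, OF _ a(4)[of g "-1"]] by simp
  show "(\<And>k::nat. F k \<in> M) \<Longrightarrow> g \<in> H \<Longrightarrow> (\<lambda>k. nrm (\<lambda>x. F k x - g x)) \<longlonglongrightarrow> 0 \<Longrightarrow> g \<in> M"
    using assms unfolding closed_sub_def by blast
qed

text \<open>
  Otherwise a suitable multiple of \<open>y\<close> brings \<open>u\<close> closer to
  \<open>0\<close>: the choice of \<open>c\<close> below lowers the squared norm by
  \<open>\<bar>\<langle>u, y\<rangle>\<bar>\<^sup>2 / \<parallel>y\<parallel>\<^sup>2\<close>.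
\<close>
lemma nearest_imp_orthogonal:
  assumes M: "closed_sub M" and u: "u \<in> H" and y: "y \<in> M"
    and min: "\<And>c. (nrm u)\<^sup>2 \<le> (nrm (\<lambda>x. u x + c * y x))\<^sup>2"
  shows "ip u y = 0"
proof (cases "nrm y = 0")
  case True
  thus ?thesis using cauchy_schwarz[OF u closed_subD(1)[OF M y]] by simp
next
  case False
  have yH: "y \<in> H" using closed_subD(1)[OF M y] .
  define c where "c = - ip u y / of_real ((nrm y)\<^sup>2)"
  have "cnj c * ip u y = of_real (- (cmod (ip u y))\<^sup>2 / (nrm y)\<^sup>2)"
    unfolding c_def using complex_norm_square[of "ip u y"] by (simp add: mult.commute)
  moreover have "(cmod c)\<^sup>2 = (cmod (ip u y))\<^sup>2 / ((nrm y)\<^sup>2)\<^sup>2"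
    unfolding c_def by (simp add: norm_divide power_divide norm_power)
  ultimately have "(nrm (\<lambda>x. u x + c * y x))\<^sup>2 = (nrm u)\<^sup>2 - (cmod (ip u y))\<^sup>2 / (nrm y)\<^sup>2"
    using nrm_sq_add_scale[OF u yH, of c] False by (simp add: power2_eq_square)
  hence "(cmod (ip u y))\<^sup>2 / (nrm y)\<^sup>2 \<le> 0" using min[of c] by simp
  hence "(cmod (ip u y))\<^sup>2 \<le> 0" using False by (simp add: divide_le_0_iff)
  thus ?thesis by simp
qed

text \<open>
  A sequence in \<open>M\<close> that minimizes the distance to \<open>u\<close> is Cauchy by the
  parallelogram law, and its limit is a nearest point.
\<close>
lemma projection_exists:
  assumes M: "closed_sub M" and x: "u \<in> H"
  shows "\<exists>m\<in>M. \<forall>y\<in>M. ip (\<lambda>x. u x - m x) y = 0"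
proof -
  define Q where "Q m = (nrm (\<lambda>x. u x - m x))\<^sup>2" for m
  have H: "m \<in> M \<Longrightarrow> m \<in> H" for m using closed_subD(1)[OF M] .
  define d where "d = Inf (Q ` M)"
  have bdd: "bdd_below (Q ` M)" by (rule bdd_belowI[of _ 0]) (auto simp: Q_def)
  have ne: "Q ` M \<noteq> {}" using closed_subD(2)[OF M] by auto
  have dle: "m \<in> M \<Longrightarrow> d \<le> Q m" for m unfolding d_def by (rule cInf_lower[OF _ bdd]) auto
  have "\<exists>m\<in>M. Q m < d + 1 / (real k + 1)" for k
    using cInf_lessD[OF ne, of "d + 1 / (real k + 1)"] unfolding d_def[symmetric] by (auto simp: add_pos_nonneg)
  then obtain m where m: "\<And>k. m k \<in> M" "\<And>k. Q (m k) < d + 1 / (real k + 1)" by metis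
  have par: "(nrm (\<lambda>x. m k x - m l x))\<^sup>2 \<le> 2 / (real k + 1) + 2 / (real l + 1)" for k l
  proof -
    define a b where "a = (\<lambda>x. u x - m k x)" and "b = (\<lambda>x. u x - m l x)"
    have ab: "a \<in> H" "b \<in> H" unfolding a_def b_def using x H m by (auto intro: diff)
    have 1: "(nrm (\<lambda>x. b x + (-1) * a x))\<^sup>2 + (nrm (\<lambda>x. b x + 1 * a x))\<^sup>2 = 2 * (nrm a)\<^sup>2 + 2 * (nrm b)\<^sup>2"
      unfolding nrm_sq_add_scale[OF ab(2,1)] by simp
    define c where "c = (\<lambda>x. (1/2) * (m k x + m l x))"
    have c: "c \<in> M" unfolding c_def using m M by (intro closed_subD(4) closed_subD(3)) auto
    hence "4 * d \<le> 4 * Q c" using dle by auto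
    also have "4 * Q c = (nrm (\<lambda>x. 2 * (u x - c x)))\<^sup>2"
      using nrm_sq_add_scale[OF zero, of "\<lambda>x. u x - c x" 2] diff[OF x H[OF c]]
      by (simp add: Q_def nrm_def ip_zero_left[OF zero] ip_zero_left)
    also have "(\<lambda>x. 2 * (u x - c x)) = (\<lambda>x. b x + 1 * a x)" by (auto simp: a_def b_def c_def fun_eq_iff field_simps)
    finally have "4 * d \<le> (nrm (\<lambda>x. b x + 1 * a x))\<^sup>2" .
    moreover have "(\<lambda>x. b x + (-1) * a x) = (\<lambda>x. m k x - m l x)" by (auto simp: a_def b_def)
    moreover have "(nrm a)\<^sup>2 < d + 1 / (real k + 1)" "(nrm b)\<^sup>2 < d + 1 / (real l + 1)"
      using m unfolding a_def b_def Q_def by auto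
    ultimately show ?thesis using 1 by auto
  qed
  have "\<exists>g\<in>H. (\<lambda>k. sqrt (Re (ip (\<lambda>x. m k x - g x) (\<lambda>x. m k x - g x)))) \<longlonglongrightarrow> 0"
  proof (rule complete)
    fix e :: real assume e: "e > 0"
    obtain N :: nat where N: "4 / e\<^sup>2 < real N" using reals_Archimedean2 by blast
    show "\<exists>N. \<forall>k\<ge>N. \<forall>l\<ge>N. sqrt (Re (ip (\<lambda>x. m k x - m l x) (\<lambda>x. m k x - m l x))) < e"
    proof (intro exI[of _ N] allI impI)
      fix k l assume kl: "k \<ge> N" "l \<ge> N"
      have 1: "2 / (real j + 1) < e\<^sup>2 / 2" if "j \<ge> N" for j
      proof -
        have "4 / e\<^sup>2 < real j + 1" using N that by auto
        thus ?thesis using e by (simp add: field_simps)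
      qed
      have "(nrm (\<lambda>x. m k x - m l x))\<^sup>2 < e\<^sup>2" using par[of k l] 1[OF kl(1)] 1[OF kl(2)] by auto
      hence "nrm (\<lambda>x. m k x - m l x) < e" using e by (simp add: power2_less_imp_less)
      thus "sqrt (Re (ip (\<lambda>x. m k x - m l x) (\<lambda>x. m k x - m l x))) < e" by (simp add: nrm_def)
    qed
  qed (use m H in auto)
  then obtain g where g: "g \<in> H" "(\<lambda>k. nrm (\<lambda>x. m k x - g x)) \<longlonglongrightarrow> 0" unfolding nrm_def by blast
  have gM: "g \<in> M" using closed_subD(6)[OF M m(1) g] .
  have "nrm (\<lambda>x. u x - g x) \<le> sqrt d"
  proof (rule LIMSEQ_le_const)
    have l: "(\<lambda>k. sqrt (d + 1 / (real k + 1)) + nrm (\<lambda>x. m k x - g x)) \<longlonglongrightarrow> sqrt (d + 0) + 0"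
      by (intro tendsto_intros g(2)) (use LIMSEQ_inverse_real_of_nat in \<open>simp add: inverse_eq_divide add.commute\<close>)
    thus "(\<lambda>k. sqrt (d + 1 / (real k + 1)) + nrm (\<lambda>x. m k x - g x)) \<longlonglongrightarrow> sqrt d" by simp
    show "\<exists>N. \<forall>n\<ge>N. nrm (\<lambda>x. u x - g x) \<le> sqrt (d + 1 / (real n + 1)) + nrm (\<lambda>x. m n x - g x)"
    proof (intro exI allI impI)
      fix n
      have "nrm (\<lambda>x. u x - g x) = nrm (\<lambda>x. (u x - m n x) + (m n x - g x))" by simp
      also have "\<dots> \<le> nrm (\<lambda>x. u x - m n x) + nrm (\<lambda>x. m n x - g x)"
        by (rule nrm_triangle) (use x m H g in \<open>auto intro: diff\<close>)
      also have "nrm (\<lambda>x. u x - m n x) \<le> sqrt (d + 1 / (real n + 1))"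
        using m(2)[of n] unfolding Q_def by (intro real_le_rsqrt) auto
      finally show "nrm (\<lambda>x. u x - g x) \<le> sqrt (d + 1 / (real n + 1)) + nrm (\<lambda>x. m n x - g x)" by simp
    qed
  qed
  hence "Q g \<le> (sqrt d)\<^sup>2" unfolding Q_def using nrm_nonneg[OF diff[OF x g(1)]] by (rule power_mono)
  moreover have d0: "d \<ge> 0" unfolding d_def using ne by (rule cInf_greatest) (auto simp: Q_def)
  ultimately have Qg: "Q g \<le> d" by simp
  show ?thesis
  proof (intro bexI[OF _ gM] ballI)
    fix y assume y: "y \<in> M"
    show "ip (\<lambda>x. u x - g x) y = 0"
    proof (rule nearest_imp_orthogonal[OF M diff[OF x g(1)] y])
      fix c
      have "(\<lambda>x. g x - c * y x) \<in> M" using closed_subD(5)[OF M gM closed_subD(4)[OF M y]] .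
      from order_trans[OF Qg dle[OF this]]
      show "(nrm (\<lambda>x. u x - g x))\<^sup>2 \<le> (nrm (\<lambda>x. u x - g x + c * y x))\<^sup>2"
        unfolding Q_def by (simp add: algebra_simps)
    qed
  qed
qed

definition proj :: "('a \<Rightarrow> complex) set \<Rightarrow> ('a \<Rightarrow> complex) \<Rightarrow> ('a \<Rightarrow> complex)" where
  "proj M u = (SOME m. m \<in> M \<and> (\<forall>y\<in>M. ip (\<lambda>x. u x - m x) y = 0))"

lemma proj:
  assumes "closed_sub M" "u \<in> H"
  shows proj_in: "proj M u \<in> M" and proj_orth: "y \<in> M \<Longrightarrow> ip (\<lambda>x. u x - proj M u x) y = 0"
  using someI_ex[of "\<lambda>m. m \<in> M \<and> (\<forall>y\<in>M. ip (\<lambda>x. u x - m x) y = 0)"] projection_exists[OF assms]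
  unfolding proj_def by blast+

lemma proj_unique:
  assumes M: "closed_sub M" and u: "u \<in> H" and m: "m \<in> M" and o: "\<And>y. y \<in> M \<Longrightarrow> ip (\<lambda>x. u x - m x) y = 0"
  shows "proj M u = m"
proof -
  define p where "p = proj M u"
  have p: "p \<in> M" "\<And>y. y \<in> M \<Longrightarrow> ip (\<lambda>x. u x - p x) y = 0" using proj[OF M u] by (auto simp: p_def)
  note H = closed_subD(1)[OF M]
  define e where "e = (\<lambda>x. p x - m x)"
  have e: "e \<in> M" unfolding e_def by (rule closed_subD(5)[OF M p(1) m])
  have "e = (\<lambda>x. (u x - m x) - (u x - p x))" by (auto simp: e_def)
  hence "ip e e = ip (\<lambda>x. u x - m x) e - ip (\<lambda>x. u x - p x) e"
    using ip_diff[of "\<lambda>x. u x - m x" "\<lambda>x. u x - p x" e] H[OF e] H[OF m] H[OF p(1)] u by (simp add: diff)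
  hence "ip e e = 0" using o[OF e] p(2)[OF e] by simp
  hence "e = (\<lambda>x. 0)" using ip_definite H[OF e] by blast
  thus ?thesis unfolding e_def p_def[symmetric] by (auto simp: fun_eq_iff)
qed

lemma proj_H: "closed_sub M \<Longrightarrow> u \<in> H \<Longrightarrow> proj M u \<in> H"
  using proj_in closed_subD(1) by blast

lemma proj_id: "closed_sub M \<Longrightarrow> u \<in> M \<Longrightarrow> proj M u = u"
  by (rule proj_unique) (auto intro: closed_subD(1) ip_zero_left[OF closed_subD(1)])

lemma proj_self_adjoint:
  assumes M: "closed_sub M" and u: "u \<in> H" and v: "v \<in> H"
  shows "ip (proj M u) v = ip u (proj M v)"
proof -
  note PH = proj_H[OF M u] proj_H[OF M v]
  have "ip (\<lambda>x. u x - proj M u x) (proj M v) = 0" using proj_orth[OF M u] proj_in[OF M v] by blast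
  hence 1: "ip u (proj M v) = ip (proj M u) (proj M v)" using PH u by (simp add: ip_diff)
  have "ip (\<lambda>x. v x - proj M v x) (proj M u) = 0" using proj_orth[OF M v] proj_in[OF M u] by blast
  hence "ip v (proj M u) = ip (proj M v) (proj M u)" using PH v by (simp add: ip_diff)
  hence "ip (proj M u) v = ip (proj M u) (proj M v)"
    using ip_cnj[OF PH(1) v] ip_cnj[OF PH] by simp
  with 1 show ?thesis by simp
qed

lemma proj_lin:
  assumes M: "closed_sub M" and u: "u \<in> H" and v: "v \<in> H"
  shows "proj M (\<lambda>x. u x + c * v x) = (\<lambda>x. proj M u x + c * proj M v x)"
proof (rule proj_unique[OF M lin[OF u v]])
  show "(\<lambda>x. proj M u x + c * proj M v x) \<in> M"
    by (intro closed_subD(3)[OF M] closed_subD(4)[OF M] proj_in[OF M] u v)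
  fix y assume y: "y \<in> M"
  have "(\<lambda>x. u x + c * v x - (proj M u x + c * proj M v x)) = (\<lambda>x. (u x - proj M u x) + c * (v x - proj M v x))"
    by (auto simp: algebra_simps)
  thus "ip (\<lambda>x. u x + c * v x - (proj M u x + c * proj M v x)) y = 0"
    using ip_lin[of "\<lambda>x. u x - proj M u x" "\<lambda>x. v x - proj M v x" y c] proj_orth[OF M u y] proj_orth[OF M v y]
      proj_H[OF M u] proj_H[OF M v] closed_subD(1)[OF M y] u v by (simp add: diff)
qed

lemma proj_zero: "closed_sub M \<Longrightarrow> proj M (\<lambda>x. 0) = (\<lambda>x. 0)"
  by (rule proj_id) (auto intro: closed_subD)

lemma proj_sum:
  assumes M: "closed_sub M" and f: "\<And>i. i \<in> A \<Longrightarrow> f i \<in> H" and "finite A"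
  shows "proj M (\<lambda>x. \<Sum>i\<in>A. c i * f i x) = (\<lambda>x. \<Sum>i\<in>A. c i * proj M (f i) x)"
  using assms(3) f
proof (induction A rule: finite_induct)
  case (insert i A)
  have "(\<lambda>x. \<Sum>i\<in>insert i A. c i * f i x) = (\<lambda>x. (\<Sum>i\<in>A. c i * f i x) + c i * f i x)"
    using insert.hyps by (auto simp: add.commute)
  thus ?case using proj_lin[OF M sum_in[OF insert.hyps(1)], of f "f i" c "c i"] insert
    by (auto simp: add.commute)
qed (simp add: proj_zero[OF M])

text \<open>
  A vector orthogonal to the kernel of \<open>L\<close> represents \<open>L\<close> after
  rescaling.
\<close>
lemma riesz:
  assumes L: "\<And>f g c. f \<in> H \<Longrightarrow> g \<in> H \<Longrightarrow> L (\<lambda>x. f x + c * g x) = L f + c * L g"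
    and bd: "\<And>f. f \<in> H \<Longrightarrow> cmod (L f) \<le> C * nrm f"
  shows "\<exists>h\<in>H. \<forall>f\<in>H. L f = ip f h"
proof -
  have L0: "L (\<lambda>x. 0) = 0" using L[OF zero zero, of 1] by simp
  have Ls: "L (\<lambda>x. c * f x) = c * L f" if "f \<in> H" for f c using L[OF zero that, of c] L0 by simp
  have La: "L (\<lambda>x. f x + g x) = L f + L g" if "f \<in> H" "g \<in> H" for f g using L[OF that, of 1] by simp
  have Ld: "L (\<lambda>x. f x - g x) = L f - L g" if "f \<in> H" "g \<in> H" for f g using L[OF that, of "-1"] by simp
  define N where "N = {f \<in> H. L f = 0}"
  have N: "closed_sub N"
    unfolding closed_sub_def
  proof (intro conjI allI impI ballI; (elim conjE)?)
    fix F :: "nat \<Rightarrow> 'a \<Rightarrow> complex" and g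
    assume F: "\<forall>k. F k \<in> N" and g: "g \<in> H" and lim: "(\<lambda>k. nrm (\<lambda>x. F k x - g x)) \<longlonglongrightarrow> 0"
    have "cmod (L g) \<le> C * nrm (\<lambda>x. F k x - g x)" for k
      using bd[of "\<lambda>x. F k x - g x"] F g by (auto simp: N_def Ld diff)
    hence "cmod (L g) \<le> C * 0"
      by (intro LIMSEQ_le_const[OF tendsto_mult[OF tendsto_const lim]]) auto
    thus "g \<in> N" using g by (simp add: N_def)
  qed (auto simp: N_def zero L0 La Ls add scale)
  show ?thesis
  proof (cases "\<exists>f\<in>H. L f \<noteq> 0")
    case False
    thus ?thesis using zero by (intro bexI[of _ "\<lambda>x. 0"]) (auto simp: ip_zero_right)
  next
    case True
    then obtain u where u: "u \<in> H" "L u \<noteq> 0" by blast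
    define e where "e = (\<lambda>x. u x - proj N u x)"
    have pN: "proj N u \<in> N" by (rule proj_in[OF N u(1)])
    have e: "e \<in> H" "L e = L u" unfolding e_def using u pN by (auto simp: N_def Ld diff)
    have orth: "ip e y = 0" if "y \<in> N" for y unfolding e_def by (rule proj_orth[OF N u(1) that])
    have "e \<noteq> (\<lambda>x. 0)" using e u L0 by auto
    hence ee: "ip e e \<noteq> 0" using ip_definite e by blast
    define a where "a = cnj (L e) / cnj (ip e e)"
    show ?thesis
    proof (intro bexI[of _ "\<lambda>x. a * e x"] ballI)
      fix f assume f: "f \<in> H"
      define y where "y = (\<lambda>x. L e * f x - L f * e x)"
      have "y \<in> N" unfolding N_def y_def using f e by (auto simp: Ld Ls diff scale)
      from orth[OF this] have "ip y e = 0" using ip_cnj[of e y] e \<open>y \<in> N\<close> by (auto simp: N_def)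
      hence "L e * ip f e = L f * ip e e" unfolding y_def using f e by (simp add: ip_diff ip_scale scale)
      moreover have "ip f (\<lambda>x. a * e x) = L e / ip e e * ip f e"
        using ip_scale_right[OF e(1) f, of a] by (simp add: a_def)
      ultimately show "L f = ip f (\<lambda>x. a * e x)" using ee by (simp add: field_simps)
    qed (use e in \<open>auto intro: scale\<close>)
  qed
qed

end

section \<open>The Dirichlet space in terms of Taylor coefficients\<close>

lemma taylor_coeff_eqI:
  assumes c: "\<And>z. cmod z < r \<Longrightarrow> (\<lambda>n. c n * z ^ n) sums f z" and r: "0 < r"
  shows "taylor_coeff f n = c n"
proof -
  have "f has_fps_expansion Abs_fps c"
    unfolding has_fps_expansion_def
  proof
    have "summable (\<lambda>n. c n * of_real (r / 2) ^ n)"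
      by (rule sums_summable, rule c) (use r in \<open>simp add: norm_divide\<close>)
    from conv_radius_geI[OF this] have "ereal (r / 2) \<le> conv_radius c" using r by (simp add: norm_divide)
    thus "0 < fps_conv_radius (Abs_fps c)" using r
      by (simp add: fps_conv_radius_def) (metis ereal_less(2) half_gt_zero less_le_trans)
    have "\<forall>\<^sub>F z in nhds 0. z \<in> ball 0 r" using r by (intro eventually_nhds_in_open) auto
    thus "\<forall>\<^sub>F z in nhds 0. eval_fps (Abs_fps c) z = f z"
      by (rule eventually_mono) (use c in \<open>auto simp: eval_fps_def sums_iff\<close>)
  qed
  from fps_nth_fps_expansion[OF this] show ?thesis by (simp add: taylor_coeff_def)
qed

lemma taylor_coeff_sums:
  assumes "f holomorphic_on ball 0 r" "cmod z < r"
  shows "(\<lambda>n. taylor_coeff f n * z ^ n) sums f z"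
  using holomorphic_power_series[OF assms(1), of z] assms(2) by (simp add: taylor_coeff_def)

lemma taylor_coeff_lin:
  assumes "f holomorphic_on unit_disc" "g holomorphic_on unit_disc"
  shows "taylor_coeff (\<lambda>z. f z + c * g z) n = taylor_coeff f n + c * taylor_coeff g n"
proof (rule taylor_coeff_eqI[of 1])
  fix z :: complex assume z: "cmod z < 1"
  from sums_add[OF taylor_coeff_sums[OF assms(1) z] sums_mult[OF taylor_coeff_sums[OF assms(2) z], of c]]
  show "(\<lambda>n. (taylor_coeff f n + c * taylor_coeff g n) * z ^ n) sums (f z + c * g z)"
    by (simp add: algebra_simps)
qed simp

lemma taylor_coeff_deriv: "taylor_coeff (deriv f) n = of_nat (Suc n) * taylor_coeff f (Suc n)"
proof -
  have "(deriv ^^ n) (deriv f) = (deriv ^^ Suc n) f" by (simp only: funpow_Suc_right o_apply)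
  thus ?thesis by (simp add: taylor_coeff_def fact_Suc del: of_nat_Suc funpow.simps)
qed

lemma taylor_coeff_0: "taylor_coeff f 0 = f 0"
  by (simp add: taylor_coeff_def)

text \<open>
  The terms of the series for \<open>\<parallel>f\<parallel>\<^sup>2\<close>.
\<close>
definition weighted_sq :: "(complex \<Rightarrow> complex) \<Rightarrow> nat \<Rightarrow> real" where
  "weighted_sq f n = real (n + 1) * (cmod (taylor_coeff f n))\<^sup>2"

lemma nn_integral_disc_taylor:
  assumes "h holomorphic_on unit_disc"
  shows "(\<integral>\<^sup>+ z. ennreal ((cmod (h z))\<^sup>2) * indicator unit_disc z \<partial>lborel)
     = (\<Sum>n. ennreal (pi * (cmod (taylor_coeff h n))\<^sup>2 / (n + 1)))"
  by (rule nn_integral_disc_square[OF taylor_coeff_sums[OF assms] assms])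

lemma nn_integral_deriv_taylor:
  assumes "f holomorphic_on unit_disc"
  shows "(\<integral>\<^sup>+ z. ennreal ((cmod (deriv f z))\<^sup>2) * indicator unit_disc z \<partial>lborel)
     = (\<Sum>n. ennreal (pi * (real n * (cmod (taylor_coeff f n))\<^sup>2)))"
proof -
  have "(\<integral>\<^sup>+ z. ennreal ((cmod (deriv f z))\<^sup>2) * indicator unit_disc z \<partial>lborel)
     = (\<Sum>n. ennreal (pi * (cmod (taylor_coeff (deriv f) n))\<^sup>2 / (n + 1)))"
    by (intro nn_integral_disc_taylor holomorphic_deriv assms) auto
  also have "\<dots> = (\<Sum>n. ennreal (pi * (real (Suc n) * (cmod (taylor_coeff f (Suc n)))\<^sup>2)))"
  proof -
    have "pi * (cmod (of_nat (Suc n) * x))\<^sup>2 / real (n + 1) = pi * (real (Suc n) * (cmod x)\<^sup>2)" for n x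
      by (simp add: norm_mult power2_eq_square del: of_nat_Suc)
    thus ?thesis unfolding taylor_coeff_deriv by (simp only:)
  qed
  also have "\<dots> = (\<Sum>n. ennreal (pi * (real n * (cmod (taylor_coeff f n))\<^sup>2)))"
  proof -
    have "(\<Sum>n. F n) = F 0 + (\<Sum>n. F (Suc n))" for F :: "nat \<Rightarrow> ennreal"
      by (subst suminf_offset[of F 1]) (auto simp: add.commute)
    from this[of "\<lambda>n. ennreal (pi * (real n * (cmod (taylor_coeff f n))\<^sup>2))"] show ?thesis
      by (simp only:) simp
  qed
  finally show ?thesis .
qed

lemma disc_measurable:
  assumes "h holomorphic_on unit_disc"
  shows "(\<lambda>z. indicator unit_disc z *\<^sub>R h z) \<in> borel_measurable lborel"
  using borel_measurable_continuous_on_indicator[OF _ holomorphic_on_imp_continuous_on[OF assms]] by simp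

lemma set_integrable_sq_iff:
  assumes "h holomorphic_on unit_disc"
  shows "set_integrable lborel unit_disc (\<lambda>z. (cmod (h z))\<^sup>2) \<longleftrightarrow>
     (\<integral>\<^sup>+ z. ennreal ((cmod (h z))\<^sup>2) * indicator unit_disc z \<partial>lborel) < \<infinity>"
proof -
  define G where "G z = indicator unit_disc z *\<^sub>R h z" for z
  have [measurable]: "G \<in> borel_measurable lborel" using disc_measurable[OF assms] by (simp only: G_def[abs_def])
  have "(\<lambda>z. indicator unit_disc z *\<^sub>R (cmod (h z))\<^sup>2) = (\<lambda>z. (cmod (G z))\<^sup>2)"
    by (auto simp: G_def indicator_def fun_eq_iff)
  hence m: "(\<lambda>z. indicator unit_disc z *\<^sub>R (cmod (h z))\<^sup>2) \<in> borel_measurable lborel"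
    by simp
  have e: "(\<integral>\<^sup>+ z. ennreal (norm (indicator unit_disc z *\<^sub>R (cmod (h z))\<^sup>2)) \<partial>lborel)
     = (\<integral>\<^sup>+ z. ennreal ((cmod (h z))\<^sup>2) * indicator unit_disc z \<partial>lborel)"
    by (rule nn_integral_cong) (auto simp: indicator_def)
  show ?thesis unfolding set_integrable_def integrable_iff_bounded e using m by simp
qed

lemma summable_weighted_iff:
  "summable (weighted_sq f) \<longleftrightarrow> summable (\<lambda>n. pi * (real n * (cmod (taylor_coeff f n))\<^sup>2))"
proof
  assume "summable (weighted_sq f)"
  from summable_mult[OF this, of pi] show "summable (\<lambda>n. pi * (real n * (cmod (taylor_coeff f n))\<^sup>2))"
    by (rule summable_comparison_test'[where N=0]) (auto simp: weighted_sq_def intro!: mult_left_mono mult_right_mono)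
next
  assume "summable (\<lambda>n. pi * (real n * (cmod (taylor_coeff f n))\<^sup>2))"
  from summable_mult[OF this, of 2] show "summable (weighted_sq f)"
  proof (rule summable_comparison_test'[where N=1])
    fix n :: nat assume n: "1 \<le> n"
    have p: "1 \<le> pi" using pi_gt3 by simp
    have "real (n + 1) \<le> 2 * (1 * real n)" using n by simp
    also have "\<dots> \<le> 2 * (pi * real n)" by (intro mult_left_mono mult_right_mono p) auto
    finally show "norm (weighted_sq f n) \<le> 2 * (pi * (real n * (cmod (taylor_coeff f n))\<^sup>2))"
      unfolding weighted_sq_def using mult_right_mono[of "real (n+1)" "2 * (pi * real n)" "(cmod (taylor_coeff f n))\<^sup>2"]
      by (simp add: mult_ac)
  qed
qed

lemma suminf_ennreal_finite_iff:
  assumes "\<And>n. 0 \<le> f n"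
  shows "(\<Sum>n. ennreal (f n)) < \<infinity> \<longleftrightarrow> summable f"
proof
  assume "(\<Sum>n. ennreal (f n)) < \<infinity>"
  thus "summable f" by (intro summable_suminf_not_top assms) auto
next
  assume "summable f"
  thus "(\<Sum>n. ennreal (f n)) < \<infinity>" by (subst suminf_ennreal2[OF assms]) auto
qed

text \<open>
  The area integral of \<open>\<bar>f'\<bar>\<^sup>2\<close> is \<open>\<pi> \<Sum> n
  \<bar>a\<^sub>n\<bar>\<^sup>2\<close>, finite or not, and the factors \<open>n\<close> and
  \<open>n + 1\<close> are comparable for \<open>n \<ge> 1\<close>.
\<close>
lemma dirichlet_space_iff:
  "f \<in> dirichlet_space \<longleftrightarrow> f holomorphic_on unit_disc \<and> (\<forall>z. z \<notin> unit_disc \<longrightarrow> f z = 0) \<and> summable (weighted_sq f)"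
proof (cases "f holomorphic_on unit_disc")
  case True
  have "set_integrable lborel unit_disc (\<lambda>z. (cmod (deriv f z))\<^sup>2) \<longleftrightarrow> summable (weighted_sq f)"
    unfolding set_integrable_sq_iff[OF holomorphic_deriv[OF True open_ball]] nn_integral_deriv_taylor[OF True] summable_weighted_iff
    by (rule suminf_ennreal_finite_iff) simp
  thus ?thesis using True by (simp add: dirichlet_space_def)
qed (simp add: dirichlet_space_def)

lemma dirichlet_spaceD:
  assumes "f \<in> dirichlet_space"
  shows "f holomorphic_on unit_disc" "z \<notin> unit_disc \<Longrightarrow> f z = 0" "summable (weighted_sq f)"
  using assms dirichlet_space_iff by auto

lemma dirichlet_integral_eq:
  assumes "f \<in> dirichlet_space"
  shows "has_bochner_integral lborel (\<lambda>z. indicator unit_disc z *\<^sub>R (cmod (deriv f z))\<^sup>2)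
     (pi * (\<Sum>n. real n * (cmod (taylor_coeff f n))\<^sup>2))"
    and "summable (\<lambda>n. real n * (cmod (taylor_coeff f n))\<^sup>2)"
proof -
  note f = dirichlet_spaceD[OF assms]
  have s: "summable (\<lambda>n. pi * (real n * (cmod (taylor_coeff f n))\<^sup>2))"
    using f(3) summable_weighted_iff by simp
  thus s': "summable (\<lambda>n. real n * (cmod (taylor_coeff f n))\<^sup>2)"
    by (subst (asm) summable_cmult_iff) simp
  have i: "set_integrable lborel unit_disc (\<lambda>z. (cmod (deriv f z))\<^sup>2)" using assms by (simp add: dirichlet_space_def)
  show "has_bochner_integral lborel (\<lambda>z. indicator unit_disc z *\<^sub>R (cmod (deriv f z))\<^sup>2)
     (pi * (\<Sum>n. real n * (cmod (taylor_coeff f n))\<^sup>2))"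
  proof (rule has_bochner_integral_nn_integral)
    show "(\<lambda>z. indicator unit_disc z *\<^sub>R (cmod (deriv f z))\<^sup>2) \<in> borel_measurable lborel"
      using i unfolding set_integrable_def by (rule borel_measurable_integrable)
    have "(\<integral>\<^sup>+ z. ennreal (indicator unit_disc z *\<^sub>R (cmod (deriv f z))\<^sup>2) \<partial>lborel) = 
      (\<integral>\<^sup>+ z. ennreal ((cmod (deriv f z))\<^sup>2) * indicator unit_disc z \<partial>lborel)"
      by (rule nn_integral_cong) (auto simp: indicator_def)
    also have "\<dots> = (\<Sum>n. ennreal (pi * (real n * (cmod (taylor_coeff f n))\<^sup>2)))" by (rule nn_integral_deriv_taylor[OF f(1)])
    also have "\<dots> = ennreal (pi * (\<Sum>n. real n * (cmod (taylor_coeff f n))\<^sup>2))"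
      using s suminf_mult[OF s', of pi] by (subst suminf_ennreal2) auto
    finally show "(\<integral>\<^sup>+ z. ennreal (indicator unit_disc z *\<^sub>R (cmod (deriv f z))\<^sup>2) \<partial>lborel) = 
       ennreal (pi * (\<Sum>n. real n * (cmod (taylor_coeff f n))\<^sup>2))" .
  qed (auto intro!: mult_nonneg_nonneg suminf_nonneg s')
qed

lemma weighted_sq_lin_summable:
  assumes "summable (\<lambda>n. real (n + 1) * (cmod (a n))\<^sup>2)" "summable (\<lambda>n. real (n + 1) * (cmod (b n))\<^sup>2)"
  shows "summable (\<lambda>n. real (n + 1) * (cmod (a n + c * b n))\<^sup>2)"
proof (rule summable_comparison_test'[where N=0])
  show "summable (\<lambda>n. 2 * (real (n + 1) * (cmod (a n))\<^sup>2) + 2 * (cmod c)\<^sup>2 * (real (n + 1) * (cmod (b n))\<^sup>2))"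
    by (intro summable_add summable_mult assms)
  fix n
  have "(cmod (a n + c * b n))\<^sup>2 \<le> (cmod (a n) + cmod c * cmod (b n))\<^sup>2"
    by (intro power_mono) (auto intro: order_trans[OF norm_triangle_ineq] simp: norm_mult)
  also have "\<dots> \<le> 2 * (cmod (a n))\<^sup>2 + 2 * (cmod c * cmod (b n))\<^sup>2"
    using sum_squares_bound[of "cmod (a n)" "cmod c * cmod (b n)"] by (simp add: power2_sum)
  finally have "real (n + 1) * (cmod (a n + c * b n))\<^sup>2 \<le> real (n + 1) * (2 * (cmod (a n))\<^sup>2 + 2 * (cmod c * cmod (b n))\<^sup>2)"
    by (intro mult_left_mono) auto
  thus "norm (real (n + 1) * (cmod (a n + c * b n))\<^sup>2) \<le>
      2 * (real (n + 1) * (cmod (a n))\<^sup>2) + 2 * (cmod c)\<^sup>2 * (real (n + 1) * (cmod (b n))\<^sup>2)"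
    by (simp add: power_mult_distrib algebra_simps)
qed

lemma dirichlet_lin:
  assumes f: "f \<in> dirichlet_space" and g: "g \<in> dirichlet_space"
  shows "(\<lambda>z. f z + c * g z) \<in> dirichlet_space"
  using dirichlet_spaceD[OF f] dirichlet_spaceD[OF g]
    weighted_sq_lin_summable[of "taylor_coeff f" "taylor_coeff g" c] taylor_coeff_lin[of f g c]
  unfolding dirichlet_space_iff by (auto intro!: holomorphic_intros simp: weighted_sq_def[abs_def])

lemma polarization:
  fixes x y :: complex
  shows "x * cnj y = (of_real ((cmod (x + 1 * y))\<^sup>2) - of_real ((cmod (x + (-1) * y))\<^sup>2)
     + \<i> * of_real ((cmod (x + \<i> * y))\<^sup>2) - \<i> * of_real ((cmod (x + (-\<i>) * y))\<^sup>2)) / 4"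
  unfolding complex_norm_square by (simp add: algebra_simps)

text \<open>
  The coefficient formula is known for the area integrals of \<open>\<bar>f' + c
  g'\<bar>\<^sup>2\<close>; polarization carries it over to the integral of \<open>f' cnj
  g'\<close>.
\<close>
lemma dirichlet_inner_sums:
  assumes f: "f \<in> dirichlet_space" and g: "g \<in> dirichlet_space"
  shows "(\<lambda>n. of_nat (n + 1) * (taylor_coeff f n * cnj (taylor_coeff g n))) sums dirichlet_inner f g"
proof -
  note fD = dirichlet_spaceD[OF f] and gD = dirichlet_spaceD[OF g]
  define h where "h c = (\<lambda>z. f z + c * g z)" for c
  have hD: "h c \<in> dirichlet_space" for c unfolding h_def by (rule dirichlet_lin[OF f g])
  have ht: "taylor_coeff (h c) n = taylor_coeff f n + c * taylor_coeff g n" for c n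
    unfolding h_def by (rule taylor_coeff_lin[OF fD(1) gD(1)])
  have hd: "deriv (h c) z = deriv f z + c * deriv g z" if "z \<in> unit_disc" for c z
  proof -
    have "f field_differentiable at z" "g field_differentiable at z"
      using that fD(1) gD(1) holomorphic_on_imp_differentiable_at[OF _ open_ball] by blast+
    thus ?thesis unfolding h_def by (subst deriv_add) (auto intro!: derivative_intros)
  qed
  define S where "S c = (\<Sum>n. real n * (cmod (taylor_coeff f n + c * taylor_coeff g n))\<^sup>2)" for c
  have B: "has_bochner_integral lborel (\<lambda>z. complex_of_real (indicator unit_disc z *\<^sub>R (cmod (deriv f z + c * deriv g z))\<^sup>2)) (of_real (pi * S c))" for c
  proof -
    have "(\<lambda>z. indicator unit_disc z *\<^sub>R (cmod (deriv (h c) z))\<^sup>2) = (\<lambda>z. indicator unit_disc z *\<^sub>R (cmod (deriv f z + c * deriv g z))\<^sup>2)"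
      by (auto simp: fun_eq_iff indicator_def hd)
    with dirichlet_integral_eq(1)[OF hD[of c]] show ?thesis
      by (intro has_bochner_integral_of_real) (simp only: ht S_def)
  qed
  have Ss: "(\<lambda>n. complex_of_real (real n * (cmod (taylor_coeff f n + c * taylor_coeff g n))\<^sup>2)) sums of_real (S c)" for c
    unfolding S_def using dirichlet_integral_eq(2)[OF hD[of c]] unfolding ht by (intro sums_of_real summable_sums)
  define T where "T = (of_real (S 1) - of_real (S (-1)) + \<i> * of_real (S \<i>) - \<i> * of_real (S (-\<i>))) / 4"
  have "(\<lambda>n. (complex_of_real (real n * (cmod (taylor_coeff f n + 1 * taylor_coeff g n))\<^sup>2)
      - complex_of_real (real n * (cmod (taylor_coeff f n + (-1) * taylor_coeff g n))\<^sup>2)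
      + \<i> * complex_of_real (real n * (cmod (taylor_coeff f n + \<i> * taylor_coeff g n))\<^sup>2)
      - \<i> * complex_of_real (real n * (cmod (taylor_coeff f n + (-\<i>) * taylor_coeff g n))\<^sup>2)) / 4) sums T"
    unfolding T_def by (intro sums_divide sums_add sums_diff sums_mult Ss)
  also have "(\<lambda>n. (complex_of_real (real n * (cmod (taylor_coeff f n + 1 * taylor_coeff g n))\<^sup>2)
      - complex_of_real (real n * (cmod (taylor_coeff f n + (-1) * taylor_coeff g n))\<^sup>2)
      + \<i> * complex_of_real (real n * (cmod (taylor_coeff f n + \<i> * taylor_coeff g n))\<^sup>2)
      - \<i> * complex_of_real (real n * (cmod (taylor_coeff f n + (-\<i>) * taylor_coeff g n))\<^sup>2)) / 4)
      = (\<lambda>n. of_nat n * (taylor_coeff f n * cnj (taylor_coeff g n)))"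
    unfolding polarization[of "taylor_coeff f _" "taylor_coeff g _"] by (simp add: algebra_simps)
  finally have T: "(\<lambda>n. of_nat n * (taylor_coeff f n * cnj (taylor_coeff g n))) sums T" .
  have "has_bochner_integral lborel (\<lambda>z. (complex_of_real (indicator unit_disc z *\<^sub>R (cmod (deriv f z + 1 * deriv g z))\<^sup>2)
      - complex_of_real (indicator unit_disc z *\<^sub>R (cmod (deriv f z + (-1) * deriv g z))\<^sup>2)
      + \<i> * complex_of_real (indicator unit_disc z *\<^sub>R (cmod (deriv f z + \<i> * deriv g z))\<^sup>2)
      - \<i> * complex_of_real (indicator unit_disc z *\<^sub>R (cmod (deriv f z + (-\<i>) * deriv g z))\<^sup>2)) / 4)
      ((of_real (pi * S 1) - of_real (pi * S (-1)) + \<i> * of_real (pi * S \<i>) - \<i> * of_real (pi * S (-\<i>))) / 4)"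
    by (intro has_bochner_integral_divide_zero has_bochner_integral_add has_bochner_integral_diff has_bochner_integral_mult_right B)
  also have "(\<lambda>z. (complex_of_real (indicator unit_disc z *\<^sub>R (cmod (deriv f z + 1 * deriv g z))\<^sup>2)
      - complex_of_real (indicator unit_disc z *\<^sub>R (cmod (deriv f z + (-1) * deriv g z))\<^sup>2)
      + \<i> * complex_of_real (indicator unit_disc z *\<^sub>R (cmod (deriv f z + \<i> * deriv g z))\<^sup>2)
      - \<i> * complex_of_real (indicator unit_disc z *\<^sub>R (cmod (deriv f z + (-\<i>) * deriv g z))\<^sup>2)) / 4)
      = (\<lambda>z. indicator unit_disc z *\<^sub>R (deriv f z * cnj (deriv g z)))"
    unfolding polarization[of "deriv f _" "deriv g _"] by (auto simp: fun_eq_iff indicator_def)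
  also have "((of_real (pi * S 1) - of_real (pi * S (-1)) + \<i> * of_real (pi * S \<i>) - \<i> * of_real (pi * S (-\<i>))) / 4) = of_real pi * T"
    by (simp add: T_def algebra_simps)
  finally have L: "(LINT z:unit_disc|lborel. deriv f z * cnj (deriv g z)) = of_real pi * T"
    unfolding set_lebesgue_integral_def by (rule has_bochner_integral_integral_eq)
  have s: "summable (\<lambda>n. taylor_coeff f n * cnj (taylor_coeff g n))"
  proof (rule summable_comparison_test'[where N=0])
    show "summable (\<lambda>n. weighted_sq f n + weighted_sq g n)" by (intro summable_add fD gD)
    fix n
    have "cmod (taylor_coeff f n) * cmod (taylor_coeff g n) \<le> (cmod (taylor_coeff f n))\<^sup>2 + (cmod (taylor_coeff g n))\<^sup>2"
      using sum_squares_bound[of "cmod (taylor_coeff f n)" "cmod (taylor_coeff g n)"]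
        mult_nonneg_nonneg[OF norm_ge_zero[of "taylor_coeff f n"] norm_ge_zero[of "taylor_coeff g n"]] by linarith
    also have "\<dots> \<le> weighted_sq f n + weighted_sq g n"
      by (simp add: weighted_sq_def algebra_simps)
    finally show "norm (taylor_coeff f n * cnj (taylor_coeff g n)) \<le> weighted_sq f n + weighted_sq g n" by (simp add: norm_mult)
  qed
  have "(\<lambda>n. taylor_coeff f n * cnj (taylor_coeff g n) + of_nat n * (taylor_coeff f n * cnj (taylor_coeff g n))) sums
      (hardy_inner f g + T)"
    unfolding hardy_inner_def by (intro sums_add T summable_sums s)
  thus ?thesis unfolding dirichlet_inner_def L by (simp add: algebra_simps)
qed

lemma dirichlet_inner_self:
  assumes "f \<in> dirichlet_space"
  shows "dirichlet_inner f f = of_real (\<Sum>n. weighted_sq f n)"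
proof -
  have "(\<lambda>n. complex_of_real (weighted_sq f n)) sums dirichlet_inner f f"
    using dirichlet_inner_sums[OF assms assms] unfolding weighted_sq_def
    by (simp only: complex_norm_square[symmetric] of_real_mult of_real_of_nat_eq)
  moreover have "(\<lambda>n. complex_of_real (weighted_sq f n)) sums of_real (\<Sum>n. weighted_sq f n)"
    by (intro sums_of_real summable_sums dirichlet_spaceD[OF assms])
  ultimately show ?thesis by (rule sums_unique2)
qed

lemma weighted_sq_nonneg: "0 \<le> weighted_sq f n"
  by (simp add: weighted_sq_def)

lemma dirichlet_of_coeffs:
  assumes b: "summable (\<lambda>n. real (n + 1) * (cmod (b n))\<^sup>2)"
  defines "g \<equiv> (\<lambda>z. if z \<in> unit_disc then \<Sum>n. b n * z ^ n else 0)"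
  shows "g \<in> dirichlet_space" "taylor_coeff g n = b n"
proof -
  have s: "(\<lambda>n. b n * z ^ n) sums g z" if z: "cmod z < 1" for z
  proof -
    have "(\<lambda>n. real (n + 1) * (cmod (b n))\<^sup>2) \<longlonglongrightarrow> 0" by (rule summable_LIMSEQ_zero[OF b])
    hence "\<forall>\<^sub>F n in sequentially. real (n + 1) * (cmod (b n))\<^sup>2 < 1" by (rule order_tendstoD) simp
    then obtain N where N: "\<And>n. n \<ge> N \<Longrightarrow> real (n + 1) * (cmod (b n))\<^sup>2 < 1" unfolding eventually_sequentially by blast
    have "summable (\<lambda>n. b n * z ^ n)"
    proof (rule summable_comparison_test'[where N=N])
      show "summable (\<lambda>n. cmod z ^ n)" using z by (intro summable_geometric) simp
      fix n assume n: "N \<le> n"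
      have "(cmod (b n))\<^sup>2 \<le> real (n + 1) * (cmod (b n))\<^sup>2" by (simp add: algebra_simps)
      also have "\<dots> < 1" using N[OF n] .
      finally have "cmod (b n) \<le> 1" by (simp add: power_less_one_iff abs_square_less_1 less_imp_le)
      thus "norm (b n * z ^ n) \<le> cmod z ^ n" by (simp add: norm_mult norm_power mult_left_le_one_le)
    qed
    thus ?thesis using z unfolding g_def by (simp add: summable_sums)
  qed
  show t: "taylor_coeff g n = b n" for n by (rule taylor_coeff_eqI[of 1]) (use s in auto)
  have "g holomorphic_on unit_disc"
    by (rule power_series_holomorphic[of 0 1 b]) (use s in simp)
  thus "g \<in> dirichlet_space" using b t unfolding dirichlet_space_iff weighted_sq_def[abs_def] by (auto simp: g_def)
qed

text \<open>
  The bound passes to the limit in each partial sum; this is the step in which the norms of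
  \<open>F\<^sub>k - F\<^sub>l\<close> control the norm of \<open>F\<^sub>k - lim
  F\<^sub>l\<close>.
\<close>
lemma weighted_sum_le_of_coeff_limit:
  fixes a :: "nat \<Rightarrow> nat \<Rightarrow> complex"
  assumes lim: "\<And>n. (\<lambda>l. a l n) \<longlonglongrightarrow> b n"
    and le: "\<And>l. l \<ge> L \<Longrightarrow> summable (\<lambda>n. real (n + 1) * (cmod (c n - a l n))\<^sup>2) \<and>
        (\<Sum>n. real (n + 1) * (cmod (c n - a l n))\<^sup>2) \<le> e"
  shows "summable (\<lambda>n. real (n + 1) * (cmod (c n - b n))\<^sup>2)" "(\<Sum>n. real (n + 1) * (cmod (c n - b n))\<^sup>2) \<le> e"
proof -
  have part: "(\<Sum>n<N. real (n + 1) * (cmod (c n - b n))\<^sup>2) \<le> e" for N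
  proof (rule LIMSEQ_le_const2)
    show "(\<lambda>l. \<Sum>n<N. real (n + 1) * (cmod (c n - a l n))\<^sup>2) \<longlonglongrightarrow> (\<Sum>n<N. real (n + 1) * (cmod (c n - b n))\<^sup>2)"
      by (intro tendsto_intros lim)
    show "\<exists>K. \<forall>l\<ge>K. (\<Sum>n<N. real (n + 1) * (cmod (c n - a l n))\<^sup>2) \<le> e"
    proof (intro exI[of _ L] allI impI)
      fix l assume l: "l \<ge> L"
      have "(\<Sum>n<N. real (n + 1) * (cmod (c n - a l n))\<^sup>2) \<le> (\<Sum>n. real (n + 1) * (cmod (c n - a l n))\<^sup>2)"
        by (rule sum_le_suminf) (use le[OF l] in auto)
      thus "(\<Sum>n<N. real (n + 1) * (cmod (c n - a l n))\<^sup>2) \<le> e" using le[OF l] by linarith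
    qed
  qed
  show s: "summable (\<lambda>n. real (n + 1) * (cmod (c n - b n))\<^sup>2)"
    by (rule summableI_nonneg_bounded[OF _ part]) simp
  show "(\<Sum>n. real (n + 1) * (cmod (c n - b n))\<^sup>2) \<le> e"
    using s part by (intro suminf_le_const) auto
qed

lemma taylor_coeff_diff:
  assumes "f \<in> dirichlet_space" "g \<in> dirichlet_space"
  shows "taylor_coeff (\<lambda>z. f z - g z) n = taylor_coeff f n - taylor_coeff g n"
  using taylor_coeff_lin[OF dirichlet_spaceD(1) dirichlet_spaceD(1), OF assms, of "-1" n] by simp

lemma dirichlet_diff: "f \<in> dirichlet_space \<Longrightarrow> g \<in> dirichlet_space \<Longrightarrow> (\<lambda>z. f z - g z) \<in> dirichlet_space"
  using dirichlet_lin[of f g "-1"] by simp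

text \<open>
  For completeness: the coefficients of a Cauchy sequence converge, and their limits are the
  coefficients of a function in the space, to which the sequence converges in norm.
\<close>
interpretation dirichlet: function_hilbert_space dirichlet_space dirichlet_inner
proof
  show "(\<lambda>x. 0) \<in> dirichlet_space" by (simp add: dirichlet_space_def set_integrable_def)
  show "(\<lambda>x. f x + c * g x) \<in> dirichlet_space" if "f \<in> dirichlet_space" "g \<in> dirichlet_space" for f g c
    by (rule dirichlet_lin[OF that])
  show "dirichlet_inner (\<lambda>x. f x + c * g x) h = dirichlet_inner f h + c * dirichlet_inner g h"
    if "f \<in> dirichlet_space" "g \<in> dirichlet_space" "h \<in> dirichlet_space" for f g h c
  proof (rule sums_unique2)
    show "(\<lambda>n. of_nat (n + 1) * (taylor_coeff (\<lambda>x. f x + c * g x) n * cnj (taylor_coeff h n))) sums dirichlet_inner (\<lambda>x. f x + c * g x) h"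
      by (intro dirichlet_inner_sums dirichlet_lin that)
    from sums_add[OF dirichlet_inner_sums[OF that(1,3)] sums_mult[OF dirichlet_inner_sums[OF that(2,3)], of c]]
    show "(\<lambda>n. of_nat (n + 1) * (taylor_coeff (\<lambda>x. f x + c * g x) n * cnj (taylor_coeff h n))) sums (dirichlet_inner f h + c * dirichlet_inner g h)"
      using that by (simp add: taylor_coeff_lin dirichlet_spaceD(1) algebra_simps)
  qed
  show "dirichlet_inner g f = cnj (dirichlet_inner f g)" if "f \<in> dirichlet_space" "g \<in> dirichlet_space" for f g
  proof (rule sums_unique2[OF dirichlet_inner_sums[OF that(2,1)]])
    have "(\<lambda>n. cnj (of_nat (n + 1) * (taylor_coeff f n * cnj (taylor_coeff g n)))) sums cnj (dirichlet_inner f g)"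
      unfolding sums_cnj by (rule dirichlet_inner_sums[OF that])
    thus "(\<lambda>n. of_nat (n + 1) * (taylor_coeff g n * cnj (taylor_coeff f n))) sums cnj (dirichlet_inner f g)"
      by (simp add: mult_ac)
  qed
  show "0 \<le> Re (dirichlet_inner f f)" if "f \<in> dirichlet_space" for f
    using dirichlet_spaceD(3)[OF that] by (simp add: dirichlet_inner_self[OF that] suminf_nonneg weighted_sq_nonneg)
  show "f = (\<lambda>x. 0)" if f: "f \<in> dirichlet_space" and "dirichlet_inner f f = 0" for f
  proof -
    have "(\<Sum>n. weighted_sq f n) = 0" using that dirichlet_inner_self[OF f] by simp
    hence "\<forall>n. weighted_sq f n = 0" using suminf_eq_zero_iff[OF dirichlet_spaceD(3)[OF f] weighted_sq_nonneg] by simp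
    hence z: "taylor_coeff f n = 0" for n by (auto simp: weighted_sq_def)
    have "f z = 0" for z
    proof (cases "cmod z < 1")
      case True
      from taylor_coeff_sums[OF dirichlet_spaceD(1)[OF f] this] show ?thesis by (simp add: z sums_iff)
    qed (use dirichlet_spaceD(2)[OF f] in auto)
    thus ?thesis by auto
  qed
  show "\<exists>g\<in>dirichlet_space. (\<lambda>k. sqrt (Re (dirichlet_inner (\<lambda>x. F k x - g x) (\<lambda>x. F k x - g x)))) \<longlonglongrightarrow> 0"
    if F: "\<And>k. F k \<in> dirichlet_space" and cau: "\<And>e. e > 0 \<Longrightarrow> \<exists>N. \<forall>m\<ge>N. \<forall>n\<ge>N.
       sqrt (Re (dirichlet_inner (\<lambda>x. F m x - F n x) (\<lambda>x. F m x - F n x))) < e" for F :: "nat \<Rightarrow> complex \<Rightarrow> complex"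
  proof -
    define a where "a k n = taylor_coeff (F k) n" for k n
    have w: "weighted_sq (\<lambda>x. F k x - F l x) = (\<lambda>n. real (n + 1) * (cmod (a k n - a l n))\<^sup>2)" for k l
      by (auto simp: weighted_sq_def a_def taylor_coeff_diff[OF F F])
    have sm: "summable (\<lambda>n. real (n + 1) * (cmod (a k n - a l n))\<^sup>2)" for k l
      using dirichlet_spaceD(3)[OF dirichlet_diff[OF F F]] unfolding w .
    have C: "\<exists>N. \<forall>k\<ge>N. \<forall>l\<ge>N. (\<Sum>n. real (n + 1) * (cmod (a k n - a l n))\<^sup>2) < e\<^sup>2" if e: "e > 0" for e
    proof -
      obtain N where N: "\<And>k l. k \<ge> N \<Longrightarrow> l \<ge> N \<Longrightarrow> sqrt (\<Sum>n. real (n + 1) * (cmod (a k n - a l n))\<^sup>2) < e"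
        using cau[OF e] unfolding dirichlet_inner_self[OF dirichlet_diff[OF F F]] w by auto
      show ?thesis
      proof (intro exI[of _ N] allI impI)
        fix k l assume "k \<ge> N" "l \<ge> N"
        from N[OF this] show "(\<Sum>n. real (n + 1) * (cmod (a k n - a l n))\<^sup>2) < e\<^sup>2"
          using e by (metis abs_of_pos real_sqrt_abs real_sqrt_less_iff)
      qed
    qed
    have "Cauchy (\<lambda>l. a l n)" for n
      unfolding Cauchy_def
    proof (intro allI impI)
      fix e :: real assume e: "e > 0"
      from C[OF e] obtain N where N: "\<And>k l. k \<ge> N \<Longrightarrow> l \<ge> N \<Longrightarrow> (\<Sum>n. real (n + 1) * (cmod (a k n - a l n))\<^sup>2) < e\<^sup>2" by blast
      show "\<exists>M. \<forall>m\<ge>M. \<forall>l\<ge>M. dist (a m n) (a l n) < e"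
      proof (intro exI[of _ N] allI impI)
        fix k l assume kl: "k \<ge> N" "l \<ge> N"
        have "(cmod (a k n - a l n))\<^sup>2 \<le> real (n + 1) * (cmod (a k n - a l n))\<^sup>2" by (simp add: algebra_simps)
        also have "\<dots> = (\<Sum>n\<in>{n}. real (n + 1) * (cmod (a k n - a l n))\<^sup>2)" by simp
        also have "\<dots> \<le> (\<Sum>n. real (n + 1) * (cmod (a k n - a l n))\<^sup>2)" by (rule sum_le_suminf[OF sm]) auto
        also have "\<dots> < e\<^sup>2" by (rule N[OF kl])
        finally show "dist (a k n) (a l n) < e" using e by (simp add: dist_norm power2_less_imp_less)
      qed
    qed
    hence conv: "convergent (\<lambda>l. a l n)" for n by (simp add: Cauchy_convergent_iff)
    define b where "b n = lim (\<lambda>l. a l n)" for n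
    have b: "(\<lambda>l. a l n) \<longlonglongrightarrow> b n" for n
      using conv[of n] unfolding b_def convergent_LIMSEQ_iff .
    have lim: "\<exists>N. \<forall>k\<ge>N. summable (\<lambda>n. real (n + 1) * (cmod (a k n - b n))\<^sup>2) \<and> (\<Sum>n. real (n + 1) * (cmod (a k n - b n))\<^sup>2) \<le> e\<^sup>2"
      if e: "e > 0" for e
    proof -
      from C[OF e] obtain N where N: "\<And>k l. k \<ge> N \<Longrightarrow> l \<ge> N \<Longrightarrow> (\<Sum>n. real (n + 1) * (cmod (a k n - a l n))\<^sup>2) < e\<^sup>2" by blast
      show ?thesis
      proof (intro exI[of _ N] allI impI)
        fix k assume k: "k \<ge> N"
        show "summable (\<lambda>n. real (n + 1) * (cmod (a k n - b n))\<^sup>2) \<and> (\<Sum>n. real (n + 1) * (cmod (a k n - b n))\<^sup>2) \<le> e\<^sup>2"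
          using weighted_sum_le_of_coeff_limit[where a=a and b=b and L=N and c="a k" and e="e\<^sup>2"] b sm N[OF k]
          by (simp add: less_imp_le)
      qed
    qed
    have bs: "summable (\<lambda>n. real (n + 1) * (cmod (b n))\<^sup>2)"
    proof -
      from lim[of 1] obtain k where "summable (\<lambda>n. real (n + 1) * (cmod (a k n - b n))\<^sup>2)" by auto
      moreover have "summable (\<lambda>n. real (n + 1) * (cmod (a k n))\<^sup>2)"
        using dirichlet_spaceD(3)[OF F[of k]] by (simp add: weighted_sq_def[abs_def] a_def)
      ultimately have "summable (\<lambda>n. real (n + 1) * (cmod (a k n + (-1) * (a k n - b n)))\<^sup>2)"
        by (intro weighted_sq_lin_summable)
      thus ?thesis by simp
    qed
    define g where "g = (\<lambda>z. if z \<in> unit_disc then \<Sum>n. b n * z ^ n else 0)"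
    have g: "g \<in> dirichlet_space" "\<And>n. taylor_coeff g n = b n"
      unfolding g_def using dirichlet_of_coeffs[OF bs] by auto
    have w': "weighted_sq (\<lambda>x. F k x - g x) = (\<lambda>n. real (n + 1) * (cmod (a k n - b n))\<^sup>2)" for k
      by (auto simp: weighted_sq_def a_def taylor_coeff_diff[OF F g(1)] g(2))
    show ?thesis
    proof (intro bexI[OF _ g(1)] LIMSEQ_I)
      fix e :: real assume e: "e > 0"
      from lim[of "e / 2"] e obtain N where N: "\<And>k. k \<ge> N \<Longrightarrow> (\<Sum>n. real (n + 1) * (cmod (a k n - b n))\<^sup>2) \<le> (e / 2)\<^sup>2" by auto
      show "\<exists>N. \<forall>k\<ge>N. norm (sqrt (Re (dirichlet_inner (\<lambda>x. F k x - g x) (\<lambda>x. F k x - g x))) - 0) < e"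
      proof (intro exI[of _ N] allI impI)
        fix k assume "k \<ge> N"
        from real_sqrt_le_mono[OF N[OF this]] e
        have "sqrt (\<Sum>n. real (n + 1) * (cmod (a k n - b n))\<^sup>2) \<le> e / 2" by simp
        moreover have "0 \<le> (\<Sum>n. real (n + 1) * (cmod (a k n - b n))\<^sup>2)"
          using dirichlet_spaceD(3)[OF dirichlet_diff[OF F g(1)]] unfolding w' by (intro suminf_nonneg) auto
        ultimately show "norm (sqrt (Re (dirichlet_inner (\<lambda>x. F k x - g x) (\<lambda>x. F k x - g x))) - 0) < e"
          using e unfolding dirichlet_inner_self[OF dirichlet_diff[OF F g(1)]] w' by simp
      qed
    qed
  qed
qed

lemma dirichlet_nrm_sq: "f \<in> dirichlet_space \<Longrightarrow> (dirichlet.nrm f)\<^sup>2 = (\<Sum>n. weighted_sq f n)"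
  by (simp add: dirichlet.nrm_sq dirichlet_inner_self)

lemma closed_dirichlet_subspace_iff: "closed_dirichlet_subspace M \<longleftrightarrow> dirichlet.closed_sub M"
  unfolding closed_dirichlet_subspace_def dirichlet.closed_sub_def dirichlet_norm_def dirichlet.nrm_def by simp

section \<open>The circle formula and the reproducing kernel\<close>

text \<open>
  Extension by \<open>0\<close>, which turns a formula for a function into an element of the
  Dirichlet space.
\<close>
definition on_disc :: "(complex \<Rightarrow> complex) \<Rightarrow> complex \<Rightarrow> complex" where
  "on_disc f z = (if z \<in> unit_disc then f z else 0)"

lemma on_disc_holomorphic: "f holomorphic_on unit_disc \<Longrightarrow> on_disc f holomorphic_on unit_disc"
  by (rule holomorphic_transform) (auto simp: on_disc_def)

lemma taylor_coeff_on_disc: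
  assumes "f holomorphic_on unit_disc"
  shows "taylor_coeff (on_disc f) n = taylor_coeff f n"
  by (rule taylor_coeff_eqI[of 1]) (use taylor_coeff_sums[OF assms] in \<open>auto simp: on_disc_def\<close>)

lemma summable_taylor_coeff:
  assumes h: "h holomorphic_on ball 0 R" and R: "R > 1"
  shows "summable (\<lambda>n. cmod (taylor_coeff h n))"
proof -
  obtain r where r: "1 < r" "r < R" using R dense by blast
  have "summable (\<lambda>n. taylor_coeff h n * of_real r ^ n)"
    using taylor_coeff_sums[OF h, of "of_real r"] r by (auto simp: sums_iff)
  from powser_insidea[OF this, of 1] show ?thesis using r by simp
qed

lemma taylor_coeff_z_times_deriv:
  assumes "h holomorphic_on unit_disc"
  shows "taylor_coeff (\<lambda>z. h z + z * deriv h z) n = of_nat (n + 1) * taylor_coeff h n"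
proof (rule taylor_coeff_eqI[of 1])
  fix z :: complex assume z: "cmod z < 1"
  have "(\<lambda>n. taylor_coeff (deriv h) n * z ^ n) sums deriv h z"
    by (rule taylor_coeff_sums[OF holomorphic_deriv[OF assms open_ball] z])
  from sums_mult[OF this, of z]
  have "(\<lambda>n. of_nat (Suc n) * taylor_coeff h (Suc n) * z ^ Suc n) sums (z * deriv h z)"
    unfolding taylor_coeff_deriv by (simp add: mult_ac)
  hence "(\<lambda>n. of_nat n * taylor_coeff h n * z ^ n) sums (z * deriv h z)"
    using sums_Suc_iff[of "\<lambda>n. of_nat n * taylor_coeff h n * z ^ n" "z * deriv h z"] by simp
  from sums_add[OF taylor_coeff_sums[OF assms z] this]
  show "(\<lambda>n. of_nat (n + 1) * taylor_coeff h n * z ^ n) sums (h z + z * deriv h z)"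
    by (simp add: algebra_simps)
qed simp

lemma summable_weighted_taylor_coeff:
  assumes h: "h holomorphic_on ball 0 R" and R: "R > 1"
  shows "summable (\<lambda>n. real (n + 1) * cmod (taylor_coeff h n))"
proof -
  have h1: "h holomorphic_on unit_disc" using h by (rule holomorphic_on_subset) (use R in auto)
  have "(\<lambda>z. h z + z * deriv h z) holomorphic_on ball 0 R"
    using h by (intro holomorphic_intros holomorphic_deriv) auto
  from summable_taylor_coeff[OF this R] show ?thesis
    unfolding taylor_coeff_z_times_deriv[OF h1] by (simp only: norm_mult norm_of_nat)
qed

lemma on_disc_in_dirichlet:
  assumes h: "h holomorphic_on ball 0 R" and R: "R > 1"
  shows "on_disc h \<in> dirichlet_space"
proof -
  have h1: "h holomorphic_on unit_disc" using h by (rule holomorphic_on_subset) (use R in auto)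
  note s = summable_weighted_taylor_coeff[OF h R]
  have "(\<lambda>n. real (n + 1) * cmod (taylor_coeff h n)) \<longlonglongrightarrow> 0" by (rule summable_LIMSEQ_zero[OF s])
  hence "\<forall>\<^sub>F n in sequentially. real (n + 1) * cmod (taylor_coeff h n) < 1" by (rule order_tendstoD) simp
  then obtain N where N: "\<And>n. n \<ge> N \<Longrightarrow> real (n + 1) * cmod (taylor_coeff h n) < 1" unfolding eventually_sequentially by blast
  have "summable (weighted_sq (on_disc h))"
  proof (rule summable_comparison_test'[where N=N, OF s])
    fix n assume n: "N \<le> n"
    have "cmod (taylor_coeff h n) \<le> real (n + 1) * cmod (taylor_coeff h n)" by (simp add: algebra_simps)
    hence "cmod (taylor_coeff h n) \<le> 1" using N[OF n] by linarith
    hence "(cmod (taylor_coeff h n))\<^sup>2 \<le> cmod (taylor_coeff h n)"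
      by (simp add: power2_eq_square mult_left_le_one_le)
    thus "norm (weighted_sq (on_disc h) n) \<le> real (n + 1) * cmod (taylor_coeff h n)"
      unfolding weighted_sq_def taylor_coeff_on_disc[OF h1] by (simp add: mult_left_mono)
  qed
  thus ?thesis unfolding dirichlet_space_iff using on_disc_holomorphic[OF h1] by (auto simp: on_disc_def)
qed

lemma taylor_coeff_sums_on_circle:
  assumes h: "h holomorphic_on ball 0 R" and R: "R > 1"
  shows "h (cis \<theta>) = (\<Sum>n. taylor_coeff h n * cis \<theta> ^ n)"
  using taylor_coeff_sums[OF h, of "cis \<theta>"] R by (simp add: sums_iff)

text \<open>
  The numbers \<open>(n + 1) a\<^sub>n\<close> are the coefficients of \<open>(z f)'\<close>. For
  functions holomorphic past the circle the inner product is therefore an \<open>L\<^sup>2\<close>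
  pairing on the circle, in which \<open>f\<close> enters with one derivative. This formula makes
  the inner product accessible to arguments on the fibres of \<open>\<phi>\<close> over boundary
  points.
\<close>
lemma dirichlet_inner_circle:
  assumes f: "f holomorphic_on ball 0 R" and g: "g holomorphic_on ball 0 R" and R: "R > 1"
  shows "((\<lambda>\<theta>. (f (cis \<theta>) + cis \<theta> * deriv f (cis \<theta>)) * cnj (g (cis \<theta>))) has_integral
           2 * pi * dirichlet_inner (on_disc f) (on_disc g)) {0..2 * pi}"
proof -
  have f1: "f holomorphic_on unit_disc" and g1: "g holomorphic_on unit_disc"
    using holomorphic_on_subset[OF f] holomorphic_on_subset[OF g] R by (simp_all add: subset_ball)
  define F where "F = (\<lambda>z. f z + z * deriv f z)"
  have F: "F holomorphic_on ball 0 R" unfolding F_def using f by (intro holomorphic_intros holomorphic_deriv) auto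
  have tF: "taylor_coeff F n = of_nat (n + 1) * taylor_coeff f n" for n
    unfolding F_def by (rule taylor_coeff_z_times_deriv[OF f1])
  have "(\<lambda>n. of_nat (n + 1) * (taylor_coeff f n * cnj (taylor_coeff g n))) sums dirichlet_inner (on_disc f) (on_disc g)"
    using dirichlet_inner_sums[OF on_disc_in_dirichlet[OF f R] on_disc_in_dirichlet[OF g R]]
    by (simp only: taylor_coeff_on_disc[OF f1] taylor_coeff_on_disc[OF g1])
  hence "dirichlet_inner (on_disc f) (on_disc g) = (\<Sum>n. taylor_coeff F n * cnj (taylor_coeff g n))"
    unfolding tF by (simp add: sums_iff mult.assoc)
  moreover have "F (cis \<theta>) * cnj (g (cis \<theta>)) = (\<Sum>n. taylor_coeff F n * cis \<theta> ^ n) * cnj (\<Sum>n. taylor_coeff g n * cis \<theta> ^ n)" for \<theta>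
    by (simp only: taylor_coeff_sums_on_circle[OF F R] taylor_coeff_sums_on_circle[OF g R])
  ultimately show ?thesis
    using circle_parseval(1)[OF summable_taylor_coeff[OF F R] summable_taylor_coeff[OF g R]]
    unfolding F_def by simp
qed

text \<open>
  The reproducing kernel \<open>- log (1 - cnj w z) / (cnj w z)\<close>. As a power series it
  visibly converges for \<open>\<bar>z\<bar> < 1 / \<bar>w\<bar>\<close>, hence past the circle.
\<close>
definition dkernel :: "complex \<Rightarrow> complex \<Rightarrow> complex" where
  "dkernel w z = (\<Sum>n. (cnj w * z) ^ n / of_nat (n + 1))"

lemma dkernel_sums:
  assumes "cmod w * cmod z < 1"
  shows "(\<lambda>n. (cnj w ^ n / of_nat (n + 1)) * z ^ n) sums dkernel w z"
proof -
  have "summable (\<lambda>n. (cnj w * z) ^ n / of_nat (n + 1))"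
  proof (rule summable_comparison_test'[where N=0])
    show "summable (\<lambda>n. (cmod w * cmod z) ^ n)" using assms by (intro summable_geometric) simp
    fix n
    have "(cmod w * cmod z) ^ n / real (n + 1) \<le> (cmod w * cmod z) ^ n / 1"
      by (intro divide_left_mono) auto
    thus "norm ((cnj w * z) ^ n / of_nat (n + 1)) \<le> (cmod w * cmod z) ^ n"
      by (simp add: norm_divide norm_power norm_mult del: of_nat_Suc of_nat_add)
  qed
  thus ?thesis unfolding dkernel_def by (simp add: summable_sums power_mult_distrib)
qed

lemma dkernel_holomorphic:
  assumes "r * cmod w \<le> 1" "r > 0"
  shows "dkernel w holomorphic_on ball 0 r"
proof (rule power_series_holomorphic)
  fix z :: complex assume z: "z \<in> ball 0 r"
  have "cmod w * cmod z < 1"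
  proof (cases "w = 0")
    case False
    hence "cmod w * cmod z < cmod w * r" using z by simp
    thus ?thesis using assms by (simp add: mult.commute)
  qed simp
  from dkernel_sums[OF this] show "(\<lambda>n. (cnj w ^ n / of_nat (n + 1)) * (z - 0) ^ n) sums dkernel w z" by simp
qed

lemma dkernel_extends:
  assumes "cmod w < 1"
  shows "\<exists>R>1. dkernel w holomorphic_on ball 0 R"
proof -
  define R where "R = 2 / (1 + cmod w)"
  have "R > 1" using assms by (simp add: R_def add_pos_nonneg)
  moreover have "R * cmod w \<le> 1" using assms by (simp add: R_def divide_le_eq add_pos_nonneg)
  ultimately show ?thesis using dkernel_holomorphic by auto
qed

lemma dkernel_in: "cmod w < 1 \<Longrightarrow> on_disc (dkernel w) \<in> dirichlet_space"
  using dkernel_extends on_disc_in_dirichlet by blast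

lemma dkernel_reproduces:
  assumes f: "f \<in> dirichlet_space" and w: "cmod w < 1"
  shows "dirichlet_inner f (on_disc (dkernel w)) = f w"
proof (rule sums_unique2)
  have "dkernel w holomorphic_on unit_disc" using w by (intro dkernel_holomorphic) auto
  hence "taylor_coeff (on_disc (dkernel w)) n = taylor_coeff (dkernel w) n" for n by (rule taylor_coeff_on_disc)
  also have "taylor_coeff (dkernel w) n = cnj w ^ n / of_nat (n + 1)" for n
  proof (rule taylor_coeff_eqI[of 1])
    fix z :: complex assume z: "cmod z < 1"
    have "cmod w * cmod z \<le> cmod w * 1" using z by (intro mult_left_mono) auto
    thus "(\<lambda>n. (cnj w ^ n / of_nat (n + 1)) * z ^ n) sums dkernel w z" using w by (intro dkernel_sums) simp
  qed simp
  finally have t: "taylor_coeff (on_disc (dkernel w)) n = cnj w ^ n / of_nat (n + 1)" for n .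
  have e: "of_nat (n + 1) * (taylor_coeff f n * cnj (cnj w ^ n / of_nat (n + 1))) = taylor_coeff f n * w ^ n" for n
    by (simp add: field_simps del: of_nat_Suc of_nat_add)
  show "(\<lambda>n. taylor_coeff f n * w ^ n) sums dirichlet_inner f (on_disc (dkernel w))"
    using dirichlet_inner_sums[OF f dkernel_in[OF w]] unfolding t e .
  show "(\<lambda>n. taylor_coeff f n * w ^ n) sums f w"
    by (rule taylor_coeff_sums[OF dirichlet_spaceD(1)[OF f] w])
qed

section \<open>Multiplication and division in the Dirichlet space\<close>

lemma nn_integral_disc_le:
  assumes "h \<in> dirichlet_space"
  shows "(\<integral>\<^sup>+ z. ennreal ((cmod (h z))\<^sup>2) * indicator unit_disc z \<partial>lborel) \<le> ennreal (pi * (dirichlet.nrm h)\<^sup>2)"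
    and "(\<integral>\<^sup>+ z. ennreal ((cmod (deriv h z))\<^sup>2) * indicator unit_disc z \<partial>lborel) \<le> ennreal (pi * (dirichlet.nrm h)\<^sup>2)"
proof -
  note h = dirichlet_spaceD[OF assms]
  have *: "(\<Sum>n. ennreal (pi * weighted_sq h n)) = ennreal (pi * (dirichlet.nrm h)\<^sup>2)"
    using summable_mult[OF h(3), of pi] suminf_mult[OF h(3), of pi]
    by (subst suminf_ennreal2) (auto simp: weighted_sq_nonneg dirichlet_nrm_sq[OF assms])
  have "(cmod (taylor_coeff h n))\<^sup>2 / real (n + 1) \<le> weighted_sq h n" for n
  proof -
    have "(cmod (taylor_coeff h n))\<^sup>2 / real (n + 1) \<le> (cmod (taylor_coeff h n))\<^sup>2 / 1" by (intro divide_left_mono) auto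
    also have "\<dots> \<le> weighted_sq h n" by (simp add: weighted_sq_def algebra_simps)
    finally show ?thesis .
  qed
  hence "pi * (cmod (taylor_coeff h n))\<^sup>2 / real (n + 1) \<le> pi * weighted_sq h n" for n
    using mult_left_mono[of "(cmod (taylor_coeff h n))\<^sup>2 / real (n + 1)" "weighted_sq h n" pi] by simp
  thus "(\<integral>\<^sup>+ z. ennreal ((cmod (h z))\<^sup>2) * indicator unit_disc z \<partial>lborel) \<le> ennreal (pi * (dirichlet.nrm h)\<^sup>2)"
    unfolding nn_integral_disc_taylor[OF h(1)] *[symmetric] by (intro suminf_le ennreal_leI) auto
  show "(\<integral>\<^sup>+ z. ennreal ((cmod (deriv h z))\<^sup>2) * indicator unit_disc z \<partial>lborel) \<le> ennreal (pi * (dirichlet.nrm h)\<^sup>2)"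
    unfolding nn_integral_deriv_taylor[OF h(1)] *[symmetric]
    by (intro suminf_le ennreal_leI) (auto simp: weighted_sq_def intro!: mult_left_mono mult_right_mono)
qed

lemma disc_sq_measurable:
  assumes "h holomorphic_on unit_disc"
  shows "(\<lambda>z. ennreal ((cmod (h z))\<^sup>2) * indicator unit_disc z) \<in> borel_measurable lborel"
proof -
  define G where "G z = indicator unit_disc z *\<^sub>R h z" for z
  have [measurable]: "G \<in> borel_measurable lborel" using disc_measurable[OF assms] by (simp only: G_def[abs_def])
  have "(\<lambda>z. ennreal ((cmod (h z))\<^sup>2) * indicator unit_disc z) = (\<lambda>z. ennreal ((cmod (G z))\<^sup>2))"
    by (auto simp: G_def indicator_def fun_eq_iff)
  thus ?thesis by simp
qed

text \<open>
  Multiplication and division are controlled by pointwise bounds on the derivative. The constant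
  \<open>K\<close> serves bounds that are only known to come from a compact part of the disc.
\<close>
lemma dirichlet_dominated:
  assumes f: "f holomorphic_on unit_disc" "\<And>z. z \<notin> unit_disc \<Longrightarrow> f z = 0" and h: "h \<in> dirichlet_space"
    and KB: "0 \<le> K" "0 \<le> B"
    and le: "\<And>z. z \<in> unit_disc \<Longrightarrow> (cmod (deriv f z))\<^sup>2 \<le> K + B * ((cmod (h z))\<^sup>2 + (cmod (deriv h z))\<^sup>2)"
  shows "f \<in> dirichlet_space" "(dirichlet.nrm f)\<^sup>2 \<le> (cmod (f 0))\<^sup>2 + 2 * (K + 2 * B * (dirichlet.nrm h)\<^sup>2)"
proof -
  note hD = dirichlet_spaceD[OF h]
  define q where "q = (dirichlet.nrm h)\<^sup>2"
  have q: "q \<ge> 0" by (simp add: q_def)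
  have hd: "deriv h holomorphic_on unit_disc" by (intro holomorphic_deriv hD) auto
  define E where "E g z = ennreal ((cmod (g z))\<^sup>2) * indicator unit_disc z" for g z
  have [measurable]: "E h \<in> borel_measurable lborel" "E (deriv h) \<in> borel_measurable lborel"
    using disc_sq_measurable[OF hD(1)] disc_sq_measurable[OF hd] by (simp_all only: E_def[abs_def])
  have [measurable]: "(\<lambda>z::complex. indicator unit_disc z :: ennreal) \<in> borel_measurable lborel"
    by (intro borel_measurable_indicator) auto
  have "(\<integral>\<^sup>+ z. ennreal ((cmod (deriv f z))\<^sup>2) * indicator unit_disc z \<partial>lborel)
     \<le> (\<integral>\<^sup>+ z. ennreal K * indicator unit_disc z + ennreal B * (E h z + E (deriv h) z) \<partial>lborel)"
  proof (rule nn_integral_mono, goal_cases)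
    case (1 z)
    show ?case
    proof (cases "z \<in> unit_disc")
      case True
      have "ennreal ((cmod (deriv f z))\<^sup>2) \<le> ennreal (K + B * ((cmod (h z))\<^sup>2 + (cmod (deriv h z))\<^sup>2))"
        by (rule ennreal_leI[OF le[OF True]])
      also have "\<dots> = ennreal K + ennreal B * (ennreal ((cmod (h z))\<^sup>2) + ennreal ((cmod (deriv h z))\<^sup>2))"
        using KB by (simp add: ennreal_plus[symmetric] ennreal_mult[symmetric] del: ennreal_plus)
      finally show ?thesis using True by (simp add: E_def)
    qed simp
  qed
  also have "\<dots> = ennreal K * (\<integral>\<^sup>+ z. indicator unit_disc z \<partial>(lborel :: complex measure)) + ennreal B * ((\<integral>\<^sup>+ z. E h z \<partial>lborel) + (\<integral>\<^sup>+ z. E (deriv h) z \<partial>lborel))"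
    by (simp add: nn_integral_add nn_integral_cmult)
  also have "(\<integral>\<^sup>+ z. indicator unit_disc z \<partial>(lborel :: complex measure)) = ennreal pi"
    using nn_integral_disc_norm_power[of 0] by simp
  also have "ennreal K * ennreal pi + ennreal B * ((\<integral>\<^sup>+ z. E h z \<partial>lborel) + (\<integral>\<^sup>+ z. E (deriv h) z \<partial>lborel))
      \<le> ennreal K * ennreal pi + ennreal B * (ennreal (pi * q) + ennreal (pi * q))"
    unfolding E_def q_def by (intro add_mono mult_left_mono nn_integral_disc_le[OF h] order_refl) auto
  also have "\<dots> = ennreal (pi * (K + 2 * B * q))"
    using KB q by (simp add: ennreal_plus[symmetric] ennreal_mult[symmetric] algebra_simps del: ennreal_plus)
  finally have bound: "(\<Sum>n. ennreal (pi * (real n * (cmod (taylor_coeff f n))\<^sup>2))) \<le> ennreal (pi * (K + 2 * B * q))"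
    unfolding nn_integral_deriv_taylor[OF f(1)] .
  have s: "summable (\<lambda>n. pi * (real n * (cmod (taylor_coeff f n))\<^sup>2))"
    using bound by (intro summable_suminf_not_top) (auto simp: top_unique)
  hence fD: "f \<in> dirichlet_space" using f summable_weighted_iff dirichlet_space_iff by auto
  thus "f \<in> dirichlet_space" .
  have s2: "summable (\<lambda>n. real n * (cmod (taylor_coeff f n))\<^sup>2)" using s by (subst (asm) summable_cmult_iff) simp
  have "0 \<le> pi * (K + 2 * B * q)" using KB q by simp
  hence "(\<Sum>n. pi * (real n * (cmod (taylor_coeff f n))\<^sup>2)) \<le> pi * (K + 2 * B * q)"
    using bound s by (subst (asm) suminf_ennreal2) (auto simp: ennreal_le_iff)
  hence b2: "(\<Sum>n. real n * (cmod (taylor_coeff f n))\<^sup>2) \<le> K + 2 * B * q"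
    by (subst (asm) suminf_mult[OF s2]) simp
  have s3: "summable (\<lambda>n. real (Suc n) * (cmod (taylor_coeff f (Suc n)))\<^sup>2)"
    using s2 by (subst summable_Suc_iff)
  have sw: "summable (\<lambda>n. weighted_sq f (Suc n))"
    using dirichlet_spaceD(3)[OF fD] by (subst summable_Suc_iff)
  have "(dirichlet.nrm f)\<^sup>2 = weighted_sq f 0 + (\<Sum>n. weighted_sq f (Suc n))"
    using suminf_split_head[OF dirichlet_spaceD(3)[OF fD]] by (simp add: dirichlet_nrm_sq[OF fD])
  also have "(\<Sum>n. weighted_sq f (Suc n)) \<le> (\<Sum>n. 2 * (real (Suc n) * (cmod (taylor_coeff f (Suc n)))\<^sup>2))"
  proof (rule suminf_le[OF _ sw summable_mult[OF s3]])
    fix n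
    have "real (Suc n + 1) * (cmod (taylor_coeff f (Suc n)))\<^sup>2 \<le> (2 * real (Suc n)) * (cmod (taylor_coeff f (Suc n)))\<^sup>2"
      by (intro mult_right_mono) auto
    thus "weighted_sq f (Suc n) \<le> 2 * (real (Suc n) * (cmod (taylor_coeff f (Suc n)))\<^sup>2)"
      by (simp add: weighted_sq_def algebra_simps)
  qed
  also have "\<dots> = 2 * (\<Sum>n. real (Suc n) * (cmod (taylor_coeff f (Suc n)))\<^sup>2)" by (rule suminf_mult[OF s3])
  also have "(\<Sum>n. real (Suc n) * (cmod (taylor_coeff f (Suc n)))\<^sup>2) = (\<Sum>n. real n * (cmod (taylor_coeff f n))\<^sup>2)"
    using suminf_split_head[OF s2] by simp
  finally show "(dirichlet.nrm f)\<^sup>2 \<le> (cmod (f 0))\<^sup>2 + 2 * (K + 2 * B * (dirichlet.nrm h)\<^sup>2)"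
    using b2 by (simp add: q_def weighted_sq_def taylor_coeff_0)
qed

lemma cmod_add_sq_le: "(cmod (a + b))\<^sup>2 \<le> 2 * (cmod a)\<^sup>2 + 2 * (cmod b)\<^sup>2"
proof -
  have "(cmod (a + b))\<^sup>2 \<le> (cmod a + cmod b)\<^sup>2" by (intro power_mono norm_triangle_ineq) auto
  also have "\<dots> \<le> 2 * (cmod a)\<^sup>2 + 2 * (cmod b)\<^sup>2"
    using sum_squares_bound[of "cmod a" "cmod b"] by (simp add: power2_sum)
  finally show ?thesis .
qed

lemma dirichlet_multiplier:
  assumes psi: "\<psi> holomorphic_on ball 0 R" and R: "R > 1"
  shows "\<exists>C\<ge>0. \<forall>f\<in>dirichlet_space. mult_op \<psi> f \<in> dirichlet_space \<and> dirichlet.nrm (mult_op \<psi> f) \<le> C * dirichlet.nrm f"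
proof -
  have sub: "cball 0 1 \<subseteq> ball (0::complex) R" using R by auto
  have "compact (\<psi> ` cball 0 1)" "compact (deriv \<psi> ` cball 0 1)"
    using psi by (auto intro!: compact_continuous_image holomorphic_on_imp_continuous_on
        intro: holomorphic_on_subset[OF _ sub] holomorphic_on_subset[OF holomorphic_deriv[OF _ open_ball] sub])
  then obtain C1 C2 where C1: "\<And>z. z \<in> cball 0 1 \<Longrightarrow> cmod (\<psi> z) \<le> C1" and C2: "\<And>z. z \<in> cball 0 1 \<Longrightarrow> cmod (deriv \<psi> z) \<le> C2"
    by (metis bounded_iff compact_imp_bounded imageI)
  define B where "B = max C1 C2"
  have B: "cmod (\<psi> z) \<le> B" "cmod (deriv \<psi> z) \<le> B" if "z \<in> unit_disc" for z
    using C1[of z] C2[of z] that by (auto simp: B_def)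
  have B0: "B \<ge> 0" using order_trans[OF norm_ge_zero B(1)[of 0]] by simp
  have psi1: "\<psi> holomorphic_on unit_disc" using psi by (rule holomorphic_on_subset) (use R in auto)
  have main: "mult_op \<psi> f \<in> dirichlet_space \<and> dirichlet.nrm (mult_op \<psi> f) \<le> 3 * B * dirichlet.nrm f"
    if f: "f \<in> dirichlet_space" for f
  proof -
    note fD = dirichlet_spaceD[OF f]
    have hol: "mult_op \<psi> f holomorphic_on unit_disc" unfolding mult_op_def by (intro holomorphic_intros fD psi1)
    have le: "(cmod (deriv (mult_op \<psi> f) z))\<^sup>2 \<le> 0 + (2 * B\<^sup>2) * ((cmod (f z))\<^sup>2 + (cmod (deriv f z))\<^sup>2)" if z: "z \<in> unit_disc" for z
    proof -
      have "\<psi> field_differentiable at z" "f field_differentiable at z"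
        using z psi1 fD(1) holomorphic_on_imp_differentiable_at[OF _ open_ball] by blast+
      hence "deriv (mult_op \<psi> f) z = \<psi> z * deriv f z + deriv \<psi> z * f z" unfolding mult_op_def by simp
      hence "(cmod (deriv (mult_op \<psi> f) z))\<^sup>2 \<le> 2 * (cmod (\<psi> z))\<^sup>2 * (cmod (deriv f z))\<^sup>2 + 2 * (cmod (deriv \<psi> z))\<^sup>2 * (cmod (f z))\<^sup>2"
        using cmod_add_sq_le[of "\<psi> z * deriv f z" "deriv \<psi> z * f z"] by (simp add: norm_mult power_mult_distrib)
      also have "\<dots> \<le> 2 * B\<^sup>2 * (cmod (deriv f z))\<^sup>2 + 2 * B\<^sup>2 * (cmod (f z))\<^sup>2"
        using B[OF z] B0 by (intro add_mono mult_right_mono mult_left_mono power_mono) auto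
      finally show ?thesis by (simp add: algebra_simps)
    qed
    have out: "mult_op \<psi> f z = 0" if "z \<notin> unit_disc" for z using fD(2)[OF that] by (simp add: mult_op_def)
    note dom = dirichlet_dominated[OF hol out f _ _ le]
    have "(cmod (f 0))\<^sup>2 \<le> (dirichlet.nrm f)\<^sup>2"
      using sum_le_suminf[OF fD(3), of "{0}"] weighted_sq_nonneg
      by (simp add: dirichlet_nrm_sq[OF f] weighted_sq_def[of _ 0] taylor_coeff_0)
    hence "(cmod (mult_op \<psi> f 0))\<^sup>2 \<le> B\<^sup>2 * (dirichlet.nrm f)\<^sup>2"
      unfolding mult_op_def norm_mult power_mult_distrib using B(1)[of 0] B0
      by (intro mult_mono) (auto intro: power_mono)
    hence "(dirichlet.nrm (mult_op \<psi> f))\<^sup>2 \<le> (3 * B * dirichlet.nrm f)\<^sup>2"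
      using dom(2) B0 by (simp add: power_mult_distrib)
    hence "dirichlet.nrm (mult_op \<psi> f) \<le> 3 * B * dirichlet.nrm f"
      by (rule power2_le_imp_le) (intro mult_nonneg_nonneg B0 dirichlet.nrm_nonneg[OF f], simp)
    moreover have "mult_op \<psi> f \<in> dirichlet_space" by (rule dom(1)) (use B0 in auto)
    ultimately show ?thesis by (rule conjI[rotated])
  qed
  show ?thesis
  proof (intro exI[of _ "3 * B"] conjI ballI)
    fix f assume "f \<in> dirichlet_space"
    from main[OF this] show "mult_op \<psi> f \<in> dirichlet_space" "dirichlet.nrm (mult_op \<psi> f) \<le> 3 * B * dirichlet.nrm f"
      by blast+
  qed (use B0 in simp)
qed

lemma mult_op_in: "\<psi> holomorphic_on ball 0 R \<Longrightarrow> R > 1 \<Longrightarrow> f \<in> dirichlet_space \<Longrightarrow> mult_op \<psi> f \<in> dirichlet_space"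
  using dirichlet_multiplier by blast

text \<open>
  The multiplication operator is bounded, so that the Riesz theorem supplies the element described
  in \<open>dirichlet_adjoint\<close>; it is unique because the inner product is definite.
\<close>
lemma dirichlet_adjoint:
  assumes psi: "\<psi> holomorphic_on ball 0 R" and R: "R > 1" and g: "g \<in> dirichlet_space"
  shows "dirichlet_adjoint (mult_op \<psi>) g \<in> dirichlet_space"
    and "f \<in> dirichlet_space \<Longrightarrow> dirichlet_inner (mult_op \<psi> f) g = dirichlet_inner f (dirichlet_adjoint (mult_op \<psi>) g)"
proof -
  obtain C where C: "C \<ge> 0" "\<And>f. f \<in> dirichlet_space \<Longrightarrow> mult_op \<psi> f \<in> dirichlet_space"
     "\<And>f. f \<in> dirichlet_space \<Longrightarrow> dirichlet.nrm (mult_op \<psi> f) \<le> C * dirichlet.nrm f"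
    using dirichlet_multiplier[OF psi R] by blast
  have "\<exists>h\<in>dirichlet_space. \<forall>f\<in>dirichlet_space. dirichlet_inner (mult_op \<psi> f) g = dirichlet_inner f h"
  proof (rule dirichlet.riesz)
    show "dirichlet_inner (mult_op \<psi> (\<lambda>x. f x + c * k x)) g = dirichlet_inner (mult_op \<psi> f) g + c * dirichlet_inner (mult_op \<psi> k) g"
      if "f \<in> dirichlet_space" "k \<in> dirichlet_space" for f k c
    proof -
      have "mult_op \<psi> (\<lambda>x. f x + c * k x) = (\<lambda>x. mult_op \<psi> f x + c * mult_op \<psi> k x)"
        by (auto simp: mult_op_def algebra_simps)
      thus ?thesis using dirichlet.ip_lin[OF C(2)[OF that(1)] C(2)[OF that(2)] g, of c] by simp
    qed
    show "cmod (dirichlet_inner (mult_op \<psi> f) g) \<le> (C * dirichlet.nrm g) * dirichlet.nrm f" if f: "f \<in> dirichlet_space" for f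
    proof -
      have "cmod (dirichlet_inner (mult_op \<psi> f) g) \<le> dirichlet.nrm (mult_op \<psi> f) * dirichlet.nrm g"
        by (rule dirichlet.cauchy_schwarz[OF C(2)[OF f] g])
      also have "\<dots> \<le> (C * dirichlet.nrm f) * dirichlet.nrm g"
        by (intro mult_right_mono C(3) f dirichlet.nrm_nonneg g)
      finally show ?thesis by (simp add: mult_ac)
    qed
  qed
  then obtain h where h: "h \<in> dirichlet_space" "\<forall>f\<in>dirichlet_space. dirichlet_inner (mult_op \<psi> f) g = dirichlet_inner f h" by blast
  have "dirichlet_adjoint (mult_op \<psi>) g = h"
    unfolding dirichlet_adjoint_def
  proof (rule the_equality)
    fix k assume k: "k \<in> dirichlet_space \<and> (\<forall>f\<in>dirichlet_space. dirichlet_inner (mult_op \<psi> f) g = dirichlet_inner f k)"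
    define d where "d = (\<lambda>x. k x - h x)"
    have d: "d \<in> dirichlet_space" unfolding d_def using k h by (intro dirichlet.diff) auto
    hence "dirichlet_inner d d = dirichlet_inner d k - dirichlet_inner d h"
      using k h unfolding d_def by (intro dirichlet.ip_diff_right) auto
    also have "\<dots> = 0" using k h d by simp
    finally have "d = (\<lambda>x. 0)" using dirichlet.ip_definite d by blast
    thus "k = h" by (auto simp: d_def fun_eq_iff)
  qed (use h in auto)
  thus "dirichlet_adjoint (mult_op \<psi>) g \<in> dirichlet_space"
    "f \<in> dirichlet_space \<Longrightarrow> dirichlet_inner (mult_op \<psi> f) g = dirichlet_inner f (dirichlet_adjoint (mult_op \<psi>) g)"
    using h by auto
qed

text \<open>
  Away from \<open>w\<close> the factor \<open>z - w\<close> is bounded below by some \<open>d >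
  0\<close>, and \<open>g'\<close> is expressed through the product \<open>(z - w) g\<close> and
  its derivative; on a compact disc around \<open>0\<close> that contains \<open>w\<close> in its
  interior, \<open>g'\<close> is bounded.
\<close>
lemma dirichlet_divide_linear:
  assumes g: "g holomorphic_on unit_disc" "\<And>z. z \<notin> unit_disc \<Longrightarrow> g z = 0" and w: "cmod w < 1"
    and f: "(\<lambda>z. (z - w) * g z) \<in> dirichlet_space"
  shows "g \<in> dirichlet_space"
proof -
  define q where "q = (\<lambda>z. (z - w) * g z)"
  obtain r where r: "cmod w < r" "r < 1" using w dense by blast
  define d where "d = r - cmod w"
  have d: "d > 0" "d \<le> 1" using r unfolding d_def by (auto intro: order_trans[OF _ less_imp_le[OF r(2)]])
  have gd: "deriv g holomorphic_on unit_disc" by (intro holomorphic_deriv g) auto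
  have "compact (deriv g ` cball 0 r)"
    using gd r by (intro compact_continuous_image holomorphic_on_imp_continuous_on) (auto intro: holomorphic_on_subset)
  then obtain C where C: "\<And>z. z \<in> cball 0 r \<Longrightarrow> cmod (deriv g z) \<le> C" by (metis bounded_iff compact_imp_bounded imageI)
  have le: "(cmod (deriv g z))\<^sup>2 \<le> C\<^sup>2 + (2 / d ^ 4) * ((cmod (q z))\<^sup>2 + (cmod (deriv q z))\<^sup>2)" if z: "z \<in> unit_disc" for z
  proof (cases "cmod z \<le> r")
    case True
    hence "(cmod (deriv g z))\<^sup>2 \<le> C\<^sup>2" using C[of z] by (intro power_mono) auto
    moreover have "0 \<le> (2 / d ^ 4) * ((cmod (q z))\<^sup>2 + (cmod (deriv q z))\<^sup>2)" using d by simp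
    ultimately show ?thesis by linarith
  next
    case False
    have zw: "d \<le> cmod (z - w)" using norm_triangle_ineq2[of z w] False unfolding d_def by linarith
    hence zw0: "z - w \<noteq> 0" using d by auto
    have "g field_differentiable at z" using z g(1) holomorphic_on_imp_differentiable_at[OF _ open_ball] by blast
    hence "(q has_field_derivative (z - w) * deriv g z + g z) (at z)" unfolding q_def
      by (auto intro!: derivative_eq_intros simp: DERIV_deriv_iff_field_differentiable)
    hence "deriv q z = (z - w) * deriv g z + g z" by (rule DERIV_imp_deriv)
    moreover have "q z / (z - w)\<^sup>2 = g z / (z - w)" using zw0 by (simp add: q_def power2_eq_square)
    ultimately have e: "deriv g z = deriv q z / (z - w) + - (q z / (z - w)\<^sup>2)"
      using zw0 by (simp add: add_divide_distrib)
    have 1: "(cmod (deriv q z / (z - w)))\<^sup>2 \<le> (cmod (deriv q z))\<^sup>2 / d ^ 4"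
    proof -
      have "d ^ 4 \<le> d\<^sup>2" using d by (intro power_decreasing) auto
      also have "d\<^sup>2 \<le> (cmod (z - w))\<^sup>2" using zw d by (intro power_mono) auto
      finally show ?thesis unfolding norm_divide power_divide using d by (intro frac_le) auto
    qed
    have 2: "(cmod (- (q z / (z - w)\<^sup>2)))\<^sup>2 \<le> (cmod (q z))\<^sup>2 / d ^ 4"
    proof -
      have "d ^ 4 \<le> (cmod (z - w)) ^ 4" using zw d by (intro power_mono) auto
      moreover have "(cmod (- (q z / (z - w)\<^sup>2)))\<^sup>2 = (cmod (q z))\<^sup>2 / (cmod (z - w)) ^ 4"
        by (simp add: norm_divide power_divide norm_power power_mult[symmetric])
      ultimately show ?thesis using d by (simp only:) (intro frac_le, auto)
    qed
    have "(cmod (deriv g z))\<^sup>2 \<le> 2 * ((cmod (deriv q z))\<^sup>2 / d ^ 4) + 2 * ((cmod (q z))\<^sup>2 / d ^ 4)"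
      unfolding e using cmod_add_sq_le[of "deriv q z / (z - w)" "- (q z / (z - w)\<^sup>2)"] 1 2 by linarith
    also have "\<dots> = (2 / d ^ 4) * ((cmod (q z))\<^sup>2 + (cmod (deriv q z))\<^sup>2)" by (simp add: add_divide_distrib distrib_left)
    finally show ?thesis using zero_le_power2[of C] by linarith
  qed
  show ?thesis
    by (rule dirichlet_dominated(1)[OF g f[folded q_def] _ _ le]) (use d in auto)
qed

lemma holomorphic_factor_root:
  assumes "f holomorphic_on S" "open S" "a \<in> S" "f a = 0"
  shows "\<exists>g. g holomorphic_on S \<and> (\<forall>z\<in>S. f z = (z - a) * g z)"
proof (intro exI conjI ballI)
  define g where "g = (\<lambda>z. if z = a then deriv f a else (f z - f a) / (z - a))"
  show "g holomorphic_on S" unfolding g_def by (rule pole_lemma_open[OF assms(1,2)])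
  show "f z = (z - a) * g z" if "z \<in> S" for z using assms(4) by (auto simp: g_def)
qed

lemma holomorphic_factor_roots:
  assumes "f holomorphic_on S" "open S" "finite A" "A \<subseteq> S" "\<And>a. a \<in> A \<Longrightarrow> f a = 0"
  shows "\<exists>g. g holomorphic_on S \<and> (\<forall>z\<in>S. f z = (\<Prod>a\<in>A. z - a) * g z)"
  using assms(3,4,5)
proof (induction A rule: finite_induct)
  case empty
  thus ?case using assms(1) by auto
next
  case (insert b A)
  then obtain g where g: "g holomorphic_on S" "\<And>z. z \<in> S \<Longrightarrow> f z = (\<Prod>a\<in>A. z - a) * g z" by auto
  have "(\<Prod>a\<in>A. b - a) \<noteq> 0" using insert.hyps by auto
  hence "g b = 0" using g(2)[of b] insert.prems by auto
  then obtain k where k: "k holomorphic_on S" "\<And>z. z \<in> S \<Longrightarrow> g z = (z - b) * k z"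
    using holomorphic_factor_root[OF g(1) assms(2), of b] insert.prems by auto
  show ?case using insert.hyps g k by (intro exI[of _ k]) (auto simp: mult_ac)
qed

section \<open>Finite Blaschke products on the circle\<close>

text \<open>
  The class of functions to which the circle formula applies. It contains \<open>\<phi>\<close>
  and the reproducing kernels and is closed under the ring operations.
\<close>
definition holo_past :: "(complex \<Rightarrow> complex) \<Rightarrow> bool" where
  "holo_past f \<longleftrightarrow> (\<exists>R>1. f holomorphic_on ball 0 R)"

lemma holo_pastI: "f holomorphic_on ball 0 R \<Longrightarrow> R > 1 \<Longrightarrow> holo_past f"
  unfolding holo_past_def by blast

lemma holo_past_common:
  assumes "holo_past f" "holo_past g"
  obtains R where "R > 1" "f holomorphic_on ball 0 R" "g holomorphic_on ball 0 R"
proof -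
  obtain R1 R2 where R: "R1 > 1" "f holomorphic_on ball 0 R1" "R2 > 1" "g holomorphic_on ball 0 R2"
    using assms unfolding holo_past_def by blast
  show ?thesis
    by (rule that[of "min R1 R2"]) (use R in \<open>auto intro: holomorphic_on_subset subset_ball\<close>)
qed

lemma holo_past_const: "holo_past (\<lambda>z. c)"
  by (rule holo_pastI[of _ 2]) auto

lemma holo_past_id: "holo_past (\<lambda>z. z)"
  by (rule holo_pastI[of _ 2]) auto

lemma holo_past_add: "holo_past f \<Longrightarrow> holo_past g \<Longrightarrow> holo_past (\<lambda>z. f z + g z)"
  by (erule (1) holo_past_common) (auto intro!: holo_pastI holomorphic_intros)

lemma holo_past_diff: "holo_past f \<Longrightarrow> holo_past g \<Longrightarrow> holo_past (\<lambda>z. f z - g z)"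
  by (erule (1) holo_past_common) (auto intro!: holo_pastI holomorphic_intros)

lemma holo_past_mult: "holo_past f \<Longrightarrow> holo_past g \<Longrightarrow> holo_past (\<lambda>z. f z * g z)"
  by (erule (1) holo_past_common) (auto intro!: holo_pastI holomorphic_intros)

lemma holo_past_power: "holo_past f \<Longrightarrow> holo_past (\<lambda>z. f z ^ k)"
  by (induction k) (auto intro: holo_past_const holo_past_mult)

lemma holo_past_sum: "(\<And>i. i \<in> A \<Longrightarrow> holo_past (f i)) \<Longrightarrow> holo_past (\<lambda>z. \<Sum>i\<in>A. f i z)"
  by (induction A rule: infinite_finite_induct) (auto intro: holo_past_const holo_past_add)

lemma holo_past_prod: "(\<And>i. i \<in> A \<Longrightarrow> holo_past (f i)) \<Longrightarrow> holo_past (\<lambda>z. \<Prod>i\<in>A. f i z)"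
  by (induction A rule: infinite_finite_induct) (auto intro: holo_past_const holo_past_mult)

lemma coeff_prod_linear:
  fixes u v :: "nat \<Rightarrow> complex"
  shows "degree (\<Prod>i<n. [:u i, v i:]) \<le> n \<and> coeff (\<Prod>i<n. [:u i, v i:]) n = (\<Prod>i<n. v i)"
proof (induction n)
  case (Suc n)
  define p where "p = (\<Prod>i<n. [:u i, v i:])"
  have p: "degree p \<le> n" "coeff p n = (\<Prod>i<n. v i)" using Suc by (auto simp: p_def)
  have "degree (p * [:u n, v n:]) \<le> degree p + degree [:u n, v n:]" by (rule degree_mult_le)
  hence "degree (p * [:u n, v n:]) \<le> Suc n" using p(1) by (auto split: if_splits)
  moreover have "coeff (p * [:u n, v n:]) (Suc n) = coeff p n * v n"
    using p(1) by (simp add: coeff_eq_0)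
  ultimately show ?case using p(2) by (simp add: p_def)
qed simp

lemma poly_factor_roots:
  fixes p :: "complex poly"
  assumes "finite A" "\<And>z. z \<in> A \<Longrightarrow> poly p z = 0"
  shows "\<exists>q. p = (\<Prod>z\<in>A. [:-z, 1:]) * q"
  using assms
proof (induction A rule: finite_induct)
  case (insert b A)
  then obtain q where q: "p = (\<Prod>z\<in>A. [:-z, 1:]) * q" by auto
  have "poly (\<Prod>z\<in>A. [:-z, 1:]) b \<noteq> 0" using insert.hyps by (auto simp: poly_prod)
  hence "poly q b = 0" using insert.prems[of b] q by auto
  then obtain k where k: "q = [:-b, 1:] * k" by (auto simp only: poly_eq_0_iff_dvd dvd_def)
  show ?case unfolding q k prod.insert[OF insert.hyps] by (intro exI[of _ k]) (simp only: mult_ac)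
qed auto

text \<open>
  On the circle numerator and denominator of the factor are \<open>- cis \<theta> * p\<close> and
  \<open>cnj p\<close> with \<open>p = 1 - a cis (- \<theta>)\<close>. Since \<open>p\<close> lies
  in the right half plane, twice the imaginary part of its principal logarithm is a smooth
  argument of \<open>p / cnj p\<close>.
\<close>
lemma blaschke_factor_circle:
  assumes "cmod a < 1"
  shows "blaschke_factor a (cis \<theta>) = blaschke_factor a 1 * cis (\<theta> + 2 * (Im (Ln (1 - a * cis (-\<theta>))) - Im (Ln (1 - a))))"
proof -
  have *: "blaschke_factor a (cis t) = - cis (t + 2 * Im (Ln (1 - a * cis (-t))))" for t
  proof -
    define p where "p = 1 - a * cis (-t)"
    have "cmod (a * cis (-t)) < 1" using assms by (simp add: norm_mult)
    hence p0: "p \<noteq> 0" unfolding p_def by (metis norm_one less_irrefl right_minus_eq)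
    have 1: "a - cis t = - cis t * p" unfolding p_def by (simp add: algebra_simps cis_mult)
    have 2: "1 - cnj a * cis t = cnj p" unfolding p_def by (simp add: cis_cnj)
    have "exp (cnj (Ln p)) = cnj p" using exp_cnj[of "Ln p"] p0 by simp
    hence "p / cnj p = exp (Ln p) / exp (cnj (Ln p))" using p0 by simp
    also have "\<dots> = exp (Ln p - cnj (Ln p))" by (simp add: exp_diff)
    also have "Ln p - cnj (Ln p) = \<i> * of_real (2 * Im (Ln p))" by (simp add: complex_eq_iff)
    finally have "p / cnj p = cis (2 * Im (Ln p))" by (simp add: cis_conv_exp)
    hence "- cis t * (p / cnj p) = - cis (t + 2 * Im (Ln p))" by (simp only: cis_mult mult_minus_left)
    thus ?thesis unfolding blaschke_factor_def 1 2 p_def[symmetric] by (simp only: times_divide_eq_right)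
  qed
  have "cis 0 = 1" by simp
  hence "blaschke_factor a 1 = - cis (2 * Im (Ln (1 - a)))" using *[of 0] by simp
  thus ?thesis unfolding * by (simp add: cis_mult algebra_simps)
qed

text \<open>
  The left-hand side is the Poisson kernel \<open>(1 - \<bar>q\<bar>\<^sup>2) / \<bar>1 -
  q\<bar>\<^sup>2\<close>.
\<close>
lemma Re_half_plane_pos:
  fixes q :: complex assumes "cmod q < 1"
  shows "1 + 2 * Re (q / (1 - q)) > 0"
proof -
  have q1: "1 - q \<noteq> 0" using assms by auto
  have "1 + 2 * Re x = Re (1 + 2 * x)" for x by simp
  hence "1 + 2 * Re (q / (1 - q)) = Re (1 + 2 * (q / (1 - q)))" .
  also have "1 + 2 * (q / (1 - q)) = (1 + q) / (1 - q)" using q1 by (simp add: field_simps)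
  also have "(1 + q) / (1 - q) = (1 + q) * cnj (1 - q) / of_real ((cmod (1 - q))\<^sup>2)"
    using q1 by (subst complex_div_cnj) simp
  also have "Re \<dots> = Re ((1 + q) * cnj (1 - q)) / (cmod (1 - q))\<^sup>2" by (simp only: Re_divide_of_real)
  also have "Re ((1 + q) * cnj (1 - q)) = 1 - (cmod q)\<^sup>2"
    unfolding cmod_power2 by (simp add: algebra_simps power2_eq_square)
  also have "\<dots> / (cmod (1 - q))\<^sup>2 > 0" using assms q1 by (simp add: power_less_one_iff abs_square_less_1)
  finally show ?thesis .
qed

lemma cis_neq_within_period:
  assumes "cis x = cis y" "x < y" "y < x + 2 * pi"
  shows False
proof -
  have "cis (y - x) = cis y * cnj (cis x)" by (simp add: cis_cnj cis_mult)
  also have "\<dots> = 1" using assms(1) by (simp add: cis_cnj cis_mult)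
  finally have "cos (y - x) = 1" by (simp add: complex_eq_iff)
  then obtain k :: int where k: "y - x = of_int k * 2 * pi" using cos_one_2pi_int by blast
  have e: "of_int k * (2 * pi) = y - x" using k by simp
  have "0 < of_int k * (2 * pi)" "of_int k * (2 * pi) < 1 * (2 * pi)" unfolding e using assms by auto
  hence "0 < (of_int k :: real)" "(of_int k :: real) < 1" by (auto simp: zero_less_mult_iff)
  thus False by simp
qed

lemma blaschke_identity:
  "(cmod (1 - cnj a * z))\<^sup>2 - (cmod (a - z))\<^sup>2 = (1 - (cmod a)\<^sup>2) * (1 - (cmod z)\<^sup>2)"
  unfolding cmod_power2 by (simp add: algebra_simps power2_eq_square)

locale finite_blaschke =
  fixes n :: nat and c :: complex and a :: "nat \<Rightarrow> complex"
  assumes n: "n \<ge> 1" and c: "cmod c = 1" and a: "\<And>i. i < n \<Longrightarrow> cmod (a i) < 1"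
begin

definition phi :: "complex \<Rightarrow> complex" where
  "phi z = c * (\<Prod>i<n. blaschke_factor (a i) z)"

lemma holo_past_phi: "holo_past phi"
proof -
  have "holo_past (blaschke_factor (a i))" if i: "i < n" for i
  proof (rule holo_pastI)
    define R where "R = 2 / (1 + cmod (a i))"
    show "R > 1" using a[OF i] by (simp add: R_def add_pos_nonneg)
    have R: "R * cmod (a i) \<le> 1" using a[OF i] by (simp add: R_def divide_le_eq add_pos_nonneg)
    have "1 - cnj (a i) * z \<noteq> 0" if z: "z \<in> ball 0 R" for z
    proof (cases "a i = 0")
      case False
      hence "cmod (a i) * cmod z < cmod (a i) * R" using z by simp
      hence "cmod (cnj (a i) * z) < 1" using R by (simp add: norm_mult mult.commute)
      thus ?thesis by (metis norm_one less_irrefl right_minus_eq)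
    qed simp
    thus "blaschke_factor (a i) holomorphic_on ball 0 R" unfolding blaschke_factor_def
      by (intro holomorphic_intros) auto
  qed
  thus ?thesis unfolding phi_def by (intro holo_past_mult holo_past_const holo_past_prod) auto
qed

definition kappa :: complex where "kappa = phi 1"

text \<open>
  A continuous argument of \<open>\<phi>\<close> along the circle, normalized to vanish at
  \<open>0\<close>; the constant \<open>kappa\<close> absorbs the initial value. It increases by
  \<open>2 \<pi> n\<close> in each turn.
\<close>
definition alpha :: "real \<Rightarrow> real" where
  "alpha \<theta> = (\<Sum>i<n. \<theta> + 2 * (Im (Ln (1 - a i * cis (-\<theta>))) - Im (Ln (1 - a i))))"

definition alpha' :: "real \<Rightarrow> real" where
  "alpha' \<theta> = (\<Sum>i<n. 1 + 2 * Re (a i * cis (-\<theta>) / (1 - a i * cis (-\<theta>))))"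

lemma phi_cis: "phi (cis \<theta>) = kappa * cis (alpha \<theta>)"
proof -
  have e: "cis (\<Sum>i<m. x i) = (\<Prod>i<m. cis (x i))" for x :: "nat \<Rightarrow> real" and m
    by (induction m) (auto simp: cis_mult[symmetric])
  have "(\<Prod>i<n. blaschke_factor (a i) (cis \<theta>)) = (\<Prod>i<n. blaschke_factor (a i) 1 *
      cis (\<theta> + 2 * (Im (Ln (1 - a i * cis (-\<theta>))) - Im (Ln (1 - a i)))))"
    by (intro prod.cong refl blaschke_factor_circle a) simp
  thus ?thesis unfolding phi_def kappa_def alpha_def e by (simp only: prod.distrib mult.assoc)
qed

lemma kappa_norm: "cmod kappa = 1"
proof -
  have "cmod (blaschke_factor (a i) 1) = 1" if "i < n" for i
  proof -
    have "1 - a i \<noteq> 0" using a[OF that] by auto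
    moreover have "cmod (1 - cnj (a i)) = cmod (1 - a i)" by (metis complex_cnj_diff complex_cnj_one complex_mod_cnj)
    ultimately show ?thesis by (simp add: blaschke_factor_def norm_divide norm_minus_commute)
  qed
  thus ?thesis by (simp add: kappa_def phi_def norm_mult c prod_norm[symmetric])
qed

lemma alpha_0: "alpha 0 = 0"
  by (simp add: alpha_def)

lemma alpha_period: "alpha (\<theta> + 2 * pi) = alpha \<theta> + 2 * pi * n"
proof -
  have "cis (- (\<theta> + 2 * pi)) = cis (-\<theta>) * cnj (cis (2 * pi))" by (simp only: cis_cnj cis_mult) simp
  hence "cis (- (\<theta> + 2 * pi)) = cis (-\<theta>)" by simp
  thus ?thesis unfolding alpha_def by (simp add: sum.distrib sum_subtractf algebra_simps)
qed

lemma alpha_deriv: "(alpha has_real_derivative alpha' \<theta>) (at \<theta>)"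
proof -
  have d: "((\<lambda>\<theta>. Im (Ln (1 - a i * cis (-\<theta>)))) has_real_derivative Re (a i * cis (-\<theta>) / (1 - a i * cis (-\<theta>)))) (at \<theta>)"
    if i: "i < n" for i
  proof -
    define q where "q = a i * cis (-\<theta>)"
    have q: "cmod q < 1" using a[OF i] by (simp add: q_def norm_mult)
    have "Re (1 - q) > 0" using complex_Re_le_cmod[of q] q by simp
    hence np: "1 - q \<notin> \<real>\<^sub>\<le>\<^sub>0" by (auto simp: complex_nonpos_Reals_iff)
    have "((\<lambda>\<theta>. 1 - a i * cis (-\<theta>)) has_vector_derivative \<i> * q) (at \<theta>)"
      unfolding cis_conv_exp q_def
      by (auto intro!: derivative_eq_intros has_vector_derivative_real_field simp: scaleR_conv_of_real)
    from field_vector_diff_chain_at[OF this, of Ln "1 / (1 - q)"]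
    have "((\<lambda>\<theta>. Ln (1 - a i * cis (-\<theta>))) has_vector_derivative \<i> * (q / (1 - q))) (at \<theta>)"
      using has_field_derivative_Ln[OF np] by (simp add: o_def q_def inverse_eq_divide)
    from bounded_linear.has_vector_derivative[OF bounded_linear_Im this]
    show ?thesis unfolding has_real_derivative_iff_has_vector_derivative Im_i_times q_def .
  qed
  have "((\<lambda>\<theta>. \<theta> + 2 * (Im (Ln (1 - a i * cis (-\<theta>))) - Im (Ln (1 - a i)))) has_real_derivative
      1 + 2 * (Re (a i * cis (-\<theta>) / (1 - a i * cis (-\<theta>))) - 0)) (at \<theta>)" if "i < n" for i
    by (intro DERIV_add DERIV_ident DERIV_cmult DERIV_diff d DERIV_const that)
  thus ?thesis unfolding alpha_def[abs_def] alpha'_def by (intro DERIV_sum) simp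
qed

lemma alpha'_pos: "alpha' \<theta> > 0"
  unfolding alpha'_def using n a by (intro sum_pos Re_half_plane_pos) (auto simp: norm_mult lessThan_empty_iff)

lemma alpha'_cont: "continuous_on UNIV alpha'"
proof -
  have "1 - a i * cis (-x) \<noteq> 0" if "i < n" for i x
  proof -
    have "cmod (a i * cis (-x)) < 1" using a[OF that] by (simp add: norm_mult)
    thus ?thesis by (metis norm_one less_irrefl right_minus_eq)
  qed
  thus ?thesis unfolding alpha'_def[abs_def] by (intro continuous_intros) auto
qed

lemma alpha_strict_mono: "x < y \<Longrightarrow> alpha x < alpha y"
  by (rule DERIV_pos_imp_increasing) (use alpha_deriv alpha'_pos in blast)+

lemma alpha_isCont: "isCont alpha x"
  using alpha_deriv by (rule DERIV_isCont)

lemma alpha_periods: "alpha (2 * pi * real k) = 2 * pi * n * real k" "alpha (- (2 * pi * real k)) = - (2 * pi * n * real k)"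
proof -
  show "alpha (2 * pi * real k) = 2 * pi * n * real k"
  proof (induction k)
    case (Suc k)
    have "2 * pi * real (Suc k) = 2 * pi * real k + 2 * pi" by (simp add: algebra_simps)
    thus ?case using Suc alpha_period[of "2 * pi * real k"] by (simp add: algebra_simps)
  qed (simp add: alpha_0)
  show "alpha (- (2 * pi * real k)) = - (2 * pi * n * real k)"
  proof (induction k)
    case (Suc k)
    have "- (2 * pi * real (Suc k)) + 2 * pi = - (2 * pi * real k)" by (simp add: algebra_simps)
    thus ?case using Suc alpha_period[of "- (2 * pi * real (Suc k))"] by (simp add: algebra_simps)
  qed (simp add: alpha_0)
qed

lemma alpha_surj: "\<exists>x. alpha x = y"
proof -
  obtain k :: nat where k: "\<bar>y\<bar> \<le> real k" using real_arch_simple by blast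
  have "1 * real k \<le> (2 * pi * n) * real k"
  proof (rule mult_right_mono)
    have "1 \<le> 2 * pi * 1" using pi_gt3 by simp
    also have "\<dots> \<le> 2 * pi * real n" using n by (intro mult_left_mono) auto
    finally show "1 \<le> 2 * pi * real n" .
  qed simp
  hence "alpha (- (2 * pi * real k)) \<le> y" "y \<le> alpha (2 * pi * real k)"
    unfolding alpha_periods using k by auto
  thus ?thesis using IVT[of alpha "- (2 * pi * real k)" y "2 * pi * real k"] alpha_isCont by auto
qed

text \<open>
  The inverse of \<open>alpha\<close>. The curve \<open>gam = cis \<circ> beta\<close> runs along
  the circle in such a way that \<open>\<phi>\<close> moves with unit speed, \<open>\<phi> (gam
  \<tau>) = kappa * cis \<tau>\<close>; the \<open>n\<close> points \<open>gam (\<tau> + 2 \<pi>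
  m)\<close> form the fibre over that value, and \<open>\<tau> \<mapsto> \<tau> + 2 \<pi>\<close>
  permutes them cyclically.
\<close>
definition beta :: "real \<Rightarrow> real" where "beta \<tau> = (SOME x. alpha x = \<tau>)"

lemma alpha_beta: "alpha (beta \<tau>) = \<tau>"
  unfolding beta_def using someI_ex[OF alpha_surj] .

lemma alpha_inj: "alpha x = alpha y \<Longrightarrow> x = y"
  using alpha_strict_mono[of x y] alpha_strict_mono[of y x] by (cases x y rule: linorder_cases) auto

lemma beta_alpha: "beta (alpha x) = x"
  using alpha_inj alpha_beta by blast

lemma beta_0: "beta 0 = 0"
  using beta_alpha[of 0] alpha_0 by simp

lemma beta_period: "beta (\<tau> + 2 * pi * n) = beta \<tau> + 2 * pi"
  using beta_alpha[of "beta \<tau> + 2 * pi"] unfolding alpha_period alpha_beta .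

lemma beta_strict_mono: "x < y \<Longrightarrow> beta x < beta y"
  using alpha_strict_mono[of "beta y" "beta x"] alpha_beta by (metis less_asym linorder_less_linear)

definition beta' :: "real \<Rightarrow> real" where "beta' \<tau> = inverse (alpha' (beta \<tau>))"

lemma beta_isCont: "isCont beta \<tau>"
  using isCont_inverse_function2[of "beta \<tau> - 1" "beta \<tau>" "beta \<tau> + 1" beta alpha] alpha_beta beta_alpha alpha_isCont
  by auto

lemma beta_deriv: "(beta has_real_derivative beta' \<tau>) (at \<tau>)"
  unfolding beta'_def
  by (rule DERIV_inverse_function[where f=alpha and a="\<tau> - 1" and b="\<tau> + 1"])
     (use alpha_deriv alpha'_pos beta_isCont alpha_beta in \<open>auto simp: less_imp_neq[symmetric]\<close>)

lemma beta'_cont: "continuous_on UNIV beta'"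
proof -
  have "continuous_on UNIV beta" using beta_isCont by (simp add: continuous_on_eq_continuous_at)
  from continuous_on_compose2[OF alpha'_cont this]
  show ?thesis unfolding beta'_def[abs_def] using alpha'_pos by (intro continuous_on_inverse) (auto simp: less_imp_neq[symmetric])
qed

definition gam :: "real \<Rightarrow> complex" where "gam \<tau> = cis (beta \<tau>)"

lemma phi_gam: "phi (gam \<tau>) = kappa * cis \<tau>"
  by (simp add: gam_def phi_cis alpha_beta)

lemma gam_norm: "cmod (gam \<tau>) = 1"
  by (simp add: gam_def)

lemma gam_period: "gam (\<tau> + 2 * pi * n) = gam \<tau>"
  by (simp add: gam_def beta_period complex_eq_iff)

lemma gam_deriv: "(gam has_vector_derivative \<i> * beta' \<tau> * gam \<tau>) (at \<tau>)"
proof -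
  have "(cis has_vector_derivative \<i> * cis x) (at x)" for x
    unfolding cis_conv_exp[abs_def]
    by (auto intro!: derivative_eq_intros has_vector_derivative_real_field)
  from vector_diff_chain_at[OF beta_deriv[unfolded has_real_derivative_iff_has_vector_derivative] this]
  show ?thesis by (simp add: o_def gam_def[abs_def] scaleR_conv_of_real mult_ac)
qed

lemma gam_shift_inj: "inj_on (\<lambda>m. gam (\<tau> + 2 * pi * real m)) {..<n}"
proof -
  have *: False if "i < j" "j < n" "gam (\<tau> + 2 * pi * real i) = gam (\<tau> + 2 * pi * real j)" for i j
  proof (rule cis_neq_within_period)
    show "cis (beta (\<tau> + 2 * pi * real i)) = cis (beta (\<tau> + 2 * pi * real j))" using that(3) by (simp add: gam_def)
    show "beta (\<tau> + 2 * pi * real i) < beta (\<tau> + 2 * pi * real j)" using that by (intro beta_strict_mono) simp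
    have "2 * pi * real j < 2 * pi * (real i + real n)" using that by simp
    hence "beta (\<tau> + 2 * pi * real j) < beta (\<tau> + 2 * pi * real i + 2 * pi * n)"
      by (intro beta_strict_mono) (simp add: algebra_simps)
    thus "beta (\<tau> + 2 * pi * real j) < beta (\<tau> + 2 * pi * real i) + 2 * pi" unfolding beta_period .
  qed
  show ?thesis
  proof (rule inj_onI)
    fix i j assume "i \<in> {..<n}" "j \<in> {..<n}" "gam (\<tau> + 2 * pi * real i) = gam (\<tau> + 2 * pi * real j)"
    thus "i = j" using *[of i j] *[of j i] by (cases i j rule: linorder_cases) auto
  qed
qed

lemma phi_gam_shift: "phi (gam (\<tau> + 2 * pi * real m)) = kappa * cis \<tau>"
proof -
  have "cis (\<tau> + 2 * pi * real m) = cis \<tau>" by (simp add: cis_mult[symmetric] cis_multiple_2pi[of "real m"])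
  thus ?thesis by (simp add: phi_gam)
qed

text \<open>
  \<open>\<phi> = num / den\<close>, and the roots of \<open>fib \<mu>\<close> are the points with
  \<open>\<phi> = \<mu>\<close>.
\<close>
definition num :: "complex poly" where "num = smult c (\<Prod>i<n. [:a i, -1:])"
definition den :: "complex poly" where "den = (\<Prod>i<n. [:1, - cnj (a i):])"
definition fib :: "complex \<Rightarrow> complex poly" where "fib \<mu> = num - smult \<mu> den"

lemma phi_eq: "phi z = poly num z / poly den z"
  by (simp add: phi_def num_def den_def blaschke_factor_def poly_prod prod_dividef mult.commute)

text \<open>
  The leading coefficients of \<open>num\<close> and \<open>\<mu> den\<close> cannot cancel: the
  first has modulus \<open>1\<close>, the second is bounded by the product of the
  \<open>\<bar>a\<^sub>i\<bar>\<close>, which is less than \<open>1\<close> since \<open>n \<ge>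
  1\<close>.
\<close>
lemma fib_degree:
  assumes "cmod \<mu> \<le> 1"
  shows "degree (fib \<mu>) = n" "fib \<mu> \<noteq> 0"
proof -
  have d: "degree (fib \<mu>) \<le> n" unfolding fib_def num_def den_def
    using coeff_prod_linear[where n=n and u=a and v="\<lambda>_. -1"] coeff_prod_linear[where n=n and u="\<lambda>_. 1" and v="\<lambda>i. - cnj (a i)"]
    by (intro degree_diff_le order_trans[OF degree_smult_le]) auto
  have co: "coeff (fib \<mu>) n = c * (-1) ^ n - \<mu> * (\<Prod>i<n. - cnj (a i))"
    unfolding fib_def num_def den_def
    using coeff_prod_linear[where n=n and u=a and v="\<lambda>_. -1"] coeff_prod_linear[where n=n and u="\<lambda>_. 1" and v="\<lambda>i. - cnj (a i)"] by simp
  have "cmod (\<Prod>i<m. - cnj (a i)) < 1" if "0 < m" "m \<le> n" for m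
    using that
  proof (induction m)
    case (Suc m)
    have am: "cmod (a m) < 1" using a Suc by auto
    have "cmod (\<Prod>i<m. - cnj (a i)) \<le> 1"
      using Suc by (cases "m = 0") auto
    hence "cmod (\<Prod>i<m. - cnj (a i)) * cmod (a m) \<le> 1 * cmod (a m)" by (intro mult_right_mono) auto
    thus ?case using am by (simp add: norm_mult)
  qed simp
  hence "cmod (\<Prod>i<n. - cnj (a i)) < 1" using n by auto
  moreover have "cmod \<mu> * cmod (\<Prod>i<n. - cnj (a i)) \<le> 1 * cmod (\<Prod>i<n. - cnj (a i))"
    using assms by (intro mult_right_mono) auto
  ultimately have "cmod (\<mu> * (\<Prod>i<n. - cnj (a i))) < 1" by (simp add: norm_mult)
  moreover have "cmod (c * (-1) ^ n) = 1" by (simp add: norm_mult norm_power c)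
  ultimately have "coeff (fib \<mu>) n \<noteq> 0" unfolding co by auto
  thus "degree (fib \<mu>) = n" "fib \<mu> \<noteq> 0" using d le_degree by (auto intro: antisym)
qed

lemma den_nonzero:
  assumes "cmod z \<le> 1" shows "poly den z \<noteq> 0"
proof -
  have "1 - cnj (a i) * z \<noteq> 0" if "i < n" for i
  proof -
    have "cmod (cnj (a i) * z) \<le> cmod (a i) * 1" using assms by (simp add: norm_mult mult_left_le)
    hence "cmod (cnj (a i) * z) < 1" using a[OF that] by linarith
    thus ?thesis by (metis norm_one less_irrefl right_minus_eq)
  qed
  thus ?thesis by (auto simp: den_def poly_prod mult.commute)
qed

lemma den_num_coprime: "poly num z = 0 \<Longrightarrow> poly den z \<noteq> 0"
proof -
  assume "poly num z = 0"
  then obtain i where "i < n" "z = a i" using c by (auto simp: num_def poly_prod)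
  thus ?thesis using a by (intro den_nonzero) (simp add: less_imp_le)
qed

lemma phi_disc: assumes "cmod z < 1" shows "cmod (phi z) < 1"
proof -
  have "cmod (blaschke_factor (a i) z) < 1" if i: "i < n" for i
  proof -
    have e: "(cmod (1 - cnj (a i) * z))\<^sup>2 - (cmod (a i - z))\<^sup>2 = (1 - (cmod (a i))\<^sup>2) * (1 - (cmod z)\<^sup>2)"
      by (rule blaschke_identity)
    have "0 < (1 - (cmod (a i))\<^sup>2) * (1 - (cmod z)\<^sup>2)"
      using a[OF i] assms by (intro mult_pos_pos) (auto simp: abs_square_less_1)
    hence "(cmod (a i - z))\<^sup>2 < (cmod (1 - cnj (a i) * z))\<^sup>2" using e by linarith
    hence "cmod (a i - z) < cmod (1 - cnj (a i) * z)" by (rule power2_less_imp_less) simp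
    thus ?thesis by (simp add: blaschke_factor_def norm_divide divide_less_eq)
  qed
  hence "(\<Prod>i<n. cmod (blaschke_factor (a i) z)) < (\<Prod>i<n. 1)" 
    using n by (intro prod_mono_strict[of 0]) (auto simp: less_imp_le)
  thus ?thesis by (simp add: phi_def norm_mult c prod_norm)
qed

lemma fib_root_disc:
  assumes mu: "cmod \<mu> < 1" and z: "poly (fib \<mu>) z = 0"
  shows "cmod z < 1" "phi z = \<mu>"
proof -
  have e: "poly num z = \<mu> * poly den z" using z by (simp add: fib_def)
  have d0: "poly den z \<noteq> 0" using e den_num_coprime[of z] by auto
  show "phi z = \<mu>" using e d0 by (simp add: phi_eq)
  show "cmod z < 1"
  proof (rule ccontr)
    assume z1: "\<not> cmod z < 1"
    have "cmod (1 - cnj (a i) * z) \<le> cmod (a i - z)" if i: "i < n" for i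
    proof -
      have e: "(cmod (1 - cnj (a i) * z))\<^sup>2 - (cmod (a i - z))\<^sup>2 = (1 - (cmod (a i))\<^sup>2) * (1 - (cmod z)\<^sup>2)"
        by (rule blaschke_identity)
      have "(1 - (cmod (a i))\<^sup>2) * (1 - (cmod z)\<^sup>2) \<le> 0"
        using a[OF i] z1 by (intro mult_nonneg_nonpos) (auto simp: abs_square_le_1 one_le_power)
      hence "(cmod (1 - cnj (a i) * z))\<^sup>2 \<le> (cmod (a i - z))\<^sup>2" using e by linarith
      thus ?thesis by (rule power2_le_imp_le) simp
    qed
    hence "(\<Prod>i<n. cmod (1 - cnj (a i) * z)) \<le> (\<Prod>i<n. cmod (a i - z))" by (intro prod_mono) auto
    hence "cmod (poly den z) \<le> cmod (poly num z)"
      by (simp add: den_def num_def poly_prod prod_norm[symmetric] norm_mult c mult.commute)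
    also have "\<dots> = cmod \<mu> * cmod (poly den z)" by (simp add: e norm_mult)
    finally have "1 \<le> cmod \<mu>" using d0 by simp
    thus False using mu by simp
  qed
qed

lemma fib_factor:
  assumes mu: "cmod \<mu> \<le> 1" and A: "finite A" "card A = n" "\<And>z. z \<in> A \<Longrightarrow> cmod z \<le> 1 \<and> phi z = \<mu>"
  obtains k where "k \<noteq> 0" "\<And>z. poly (fib \<mu>) z = k * (\<Prod>w\<in>A. z - w)"
proof -
  have "poly (fib \<mu>) z = 0" if "z \<in> A" for z
    using A(3)[OF that] den_nonzero[of z] by (auto simp: phi_eq fib_def field_simps)
  then obtain q where q: "fib \<mu> = (\<Prod>z\<in>A. [:-z, 1:]) * q" using poly_factor_roots[OF A(1)] by metis
  have q0: "q \<noteq> 0" using q fib_degree(2)[OF mu] by auto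
  have "degree (\<Prod>z\<in>A. [:-z, 1:]) = n"
    by (subst degree_prod_eq_sum_degree) (auto simp: A(2))
  moreover have "degree (fib \<mu>) = degree (\<Prod>z\<in>A. [:-z, 1:]) + degree q"
    unfolding q using q0 A(1) by (intro degree_mult_eq) auto
  ultimately have "degree q = 0" using fib_degree(1)[OF mu] by simp
  then obtain k where k: "q = [:k:]" by (rule degree_eq_zeroE)
  show ?thesis
  proof (rule that[of k])
    show "k \<noteq> 0" using k q0 by auto
    show "poly (fib \<mu>) z = k * (\<Prod>w\<in>A. z - w)" for z
      unfolding q k by (simp add: poly_prod)
  qed
qed


text \<open>
  Otherwise \<open>\<phi>\<close> is constant, first on the disc and then past the circle, whereas
  its values at \<open>gam 0\<close> and \<open>gam \<pi>\<close> are opposite.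
\<close>
lemma wronskian_nonzero: "pderiv num * den - num * pderiv den \<noteq> 0"
proof
  assume W: "pderiv num * den - num * pderiv den = 0"
  obtain R where R: "R > 1" "phi holomorphic_on ball 0 R" using holo_past_phi unfolding holo_past_def by blast
  have c0: "phi z = phi 0" if "z \<in> unit_disc" for z
  proof (rule has_field_derivative_zero_constant[of unit_disc, THEN exE])
    show "convex unit_disc" by simp
    fix z assume z: "z \<in> unit_disc"
    have d: "poly den z \<noteq> 0" using z by (intro den_nonzero) auto
    have "(phi has_field_derivative ((poly (pderiv num) z * poly den z - poly num z * poly (pderiv den) z) / (poly den z * poly den z))) (at z)"
      unfolding phi_eq[abs_def] using d by (auto intro!: derivative_eq_intros poly_DERIV)
    moreover have "poly (pderiv num) z * poly den z - poly num z * poly (pderiv den) z = 0"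
      using arg_cong[OF W, of "\<lambda>p. poly p z"] by simp
    ultimately show "(phi has_field_derivative 0) (at z within unit_disc)"
      by (simp add: has_field_derivative_at_within)
  next
    fix k assume "\<forall>z\<in>unit_disc. phi z = k"
    thus "phi z = phi 0" using that by simp
  qed
  define u where "u z = phi z - phi 0" for z
  have inner: "u z = 0" if "z \<in> unit_disc" for z unfolding u_def using c0[OF that] by (simp only: diff_self)
  have uh: "u holomorphic_on ball 0 R" unfolding u_def using R(2) by (intro holomorphic_intros)
  have const: "u z = 0" if z: "z \<in> ball 0 R" for z
    by (rule analytic_continuation_open[where s="unit_disc" and s'="ball 0 R" and f=u and g="\<lambda>_. 0"])
       (use inner R z uh in \<open>auto simp: subset_ball\<close>)
  have "phi (gam 0) = phi (gam pi)"
  proof -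
    have "u (gam 0) = 0" "u (gam pi) = 0"
      by (rule const, use gam_norm R(1) in simp)+
    thus ?thesis unfolding u_def by (simp only: right_minus_eq)
  qed
  thus False using kappa_norm by (auto simp: phi_gam)
qed

text \<open>
  A fibre in the disc has fewer than \<open>n\<close> points only over a critical value, and
  \<open>\<phi>\<close> has finitely many critical points. The exceptional set \<open>B\<close>
  consists of all points that share their value with a critical point.
\<close>
lemma generic_fibre:
  "\<exists>B. finite B \<and> (\<forall>w. cmod w < 1 \<and> w \<notin> B \<longrightarrow> (\<exists>A. finite A \<and> card A = n \<and> (\<forall>z\<in>A. cmod z < 1 \<and> phi z = phi w) \<and> w \<in> A))"
proof -
  define W where "W = pderiv num * den - num * pderiv den"
  define Z where "Z = {z. poly W z = 0 \<and> cmod (phi z) < 1}"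
  have finZ: "finite Z" unfolding Z_def
    by (rule finite_subset[OF _ poly_roots_finite[of W]]) (use wronskian_nonzero in \<open>auto simp: W_def\<close>)
  define B where "B = (\<Union>z\<in>Z. {w. poly (fib (phi z)) w = 0})"
  have "finite B" unfolding B_def using finZ
    by (intro finite_UN_I poly_roots_finite fib_degree(2)) (auto simp: Z_def)
  moreover have "\<exists>A. finite A \<and> card A = n \<and> (\<forall>z\<in>A. cmod z < 1 \<and> phi z = phi w) \<and> w \<in> A"
    if w: "cmod w < 1" "w \<notin> B" for w
  proof -
    define l where "l = phi w"
    have l: "cmod l < 1" unfolding l_def by (rule phi_disc[OF w(1)])
    define A where "A = {z. poly (fib l) z = 0}"
    have A: "cmod z < 1" "phi z = l" if "z \<in> A" for z
      using fib_root_disc[OF l] that by (auto simp: A_def)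
    have wA: "w \<in> A" using den_nonzero[of w] w(1) by (simp add: A_def fib_def l_def phi_eq)
    have "rsquarefree (fib l)"
      unfolding rsquarefree_roots
    proof (intro allI notI)
      fix z assume z: "poly (fib l) z = 0 \<and> poly (pderiv (fib l)) z = 0"
      have e: "poly num z = l * poly den z" "poly (pderiv num) z = l * poly (pderiv den) z"
        using z by (auto simp: fib_def pderiv_diff pderiv_smult)
      hence "poly W z = 0" by (simp add: W_def)
      moreover have "phi z = l" by (rule fib_root_disc(2)[OF l]) (use z in simp)
      ultimately have "z \<in> Z" using l by (simp add: Z_def)
      hence "w \<in> B" using wA \<open>phi z = l\<close> by (auto simp: B_def A_def)
      thus False using w by simp
    qed
    from complex_poly_decompose_rsquarefree[OF this]
    have f: "smult (lead_coeff (fib l)) (\<Prod>z\<in>A. [:-z, 1:]) = fib l" by (simp add: A_def)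
    have fb: "fib l \<noteq> 0" "degree (fib l) = n" using fib_degree[of l] l by auto
    have finA: "finite A" unfolding A_def by (rule poly_roots_finite[OF fb(1)])
    have "degree (smult (lead_coeff (fib l)) (\<Prod>z\<in>A. [:-z, 1:])) = card A"
      using fb(1) by (simp add: degree_prod_eq_sum_degree)
    hence "card A = n" unfolding f using fb(2) by simp
    thus ?thesis using finA A wA unfolding l_def by blast
  qed
  ultimately show ?thesis by blast
qed

lemma divide_by_fibre:
  assumes mu: "cmod \<mu> \<le> 1" and A: "finite A" "card A = n" "\<And>z. z \<in> A \<Longrightarrow> cmod z \<le> 1 \<and> phi z = \<mu>"
    and f: "f holomorphic_on S" "open S" "A \<subseteq> S" "\<And>z. z \<in> A \<Longrightarrow> f z = 0" and S: "\<And>z. z \<in> S \<Longrightarrow> poly den z \<noteq> 0"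
  shows "\<exists>g. g holomorphic_on S \<and> (\<forall>z\<in>S. f z = (phi z - \<mu>) * g z)"
proof -
  obtain k where k: "k \<noteq> 0" "\<And>z. poly (fib \<mu>) z = k * (\<Prod>w\<in>A. z - w)" using fib_factor[OF mu A] by metis
  obtain h where h: "h holomorphic_on S" "\<And>z. z \<in> S \<Longrightarrow> f z = (\<Prod>w\<in>A. z - w) * h z"
    using holomorphic_factor_roots[OF f(1,2) A(1) f(3,4)] by blast
  show ?thesis
  proof (intro exI[of _ "\<lambda>z. poly den z * h z / k"] conjI ballI)
    show "(\<lambda>z. poly den z * h z / k) holomorphic_on S" by (intro holomorphic_intros h(1) k(1))
    fix z assume z: "z \<in> S"
    have "phi z - \<mu> = poly (fib \<mu>) z / poly den z" using S[OF z] by (simp add: phi_eq fib_def field_simps)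
    thus "f z = (phi z - \<mu>) * (poly den z * h z / k)" using h(2)[OF z] k S[OF z] by simp
  qed
qed

lemma den_nonzero_past: "\<exists>R>1. \<forall>z\<in>ball 0 R. poly den z \<noteq> 0"
proof -
  define M where "M = Max (insert (1/2) ((\<lambda>i. cmod (a i)) ` {..<n}))"
  have M1: "cmod (a i) \<le> M" if "i < n" for i unfolding M_def using that by (intro Max_ge) auto
  have M2: "1/2 \<le> M" unfolding M_def by (intro Max_ge) auto
  have M3: "M < 1" unfolding M_def using a by (subst Max_less_iff) auto
  have nz: "1 - cnj (a i) * z \<noteq> 0" if "i < n" "cmod z < 1 / M" for i z
  proof -
    have "cmod (cnj (a i) * z) \<le> M * cmod z" using M1[OF that(1)] by (simp add: norm_mult mult_right_mono)
    also have "\<dots> < 1" using that(2) M2 by (simp add: field_simps)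
    finally have "cmod (cnj (a i) * z) < 1" .
    thus ?thesis by auto
  qed
  show ?thesis
  proof (intro exI[of _ "1 / M"] conjI ballI)
    show "1 < 1 / M" using M2 M3 by simp
    fix z assume "z \<in> ball (0::complex) (1 / M)"
    hence "cmod z < 1 / M" by simp
    thus "poly den z \<noteq> 0" using nz by (auto simp: den_def poly_prod mult.commute)
  qed
qed

end

section \<open>Linear systems that depend on a parameter\<close>

text \<open>
  Elimination of one unknown with the help of the last equation. The unknowns are indexed by a
  set, so that the pivot can simply be removed.
\<close>
lemma homogeneous_system_nontrivial:
  fixes A :: "nat \<Rightarrow> nat \<Rightarrow> complex"
  assumes "finite J" "card J > n"
  shows "\<exists>v. (\<exists>j\<in>J. v j \<noteq> 0) \<and> (\<forall>i<n. (\<Sum>j\<in>J. A i j * v j) = 0)"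
  using assms
proof (induction n arbitrary: A J)
  case 0
  hence "J \<noteq> {}" by auto
  thus ?case by (intro exI[of _ "\<lambda>_. 1"]) auto
next
  case (Suc n)
  show ?case
  proof (cases "\<forall>j\<in>J. A n j = 0")
    case True
    obtain v where v: "\<exists>j\<in>J. v j \<noteq> 0" "\<forall>i<n. (\<Sum>j\<in>J. A i j * v j) = 0" using Suc.IH[of J A] Suc.prems by auto
    show ?thesis using v True by (intro exI[of _ v]) (auto simp: less_Suc_eq)
  next
    case False
    then obtain k where k: "k \<in> J" "A n k \<noteq> 0" by blast
    define J' where "J' = J - {k}"
    have J': "finite J'" "card J' > n" using Suc.prems k by (auto simp: J'_def)
    have JJ: "sum f J = f k + sum f J'" for f :: "nat \<Rightarrow> complex"
      unfolding J'_def using Suc.prems(1) k(1) by (rule sum.remove)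
    obtain v where v: "\<exists>j\<in>J'. v j \<noteq> 0" "\<forall>i<n. (\<Sum>j\<in>J'. (A i j - A i k * (A n j / A n k)) * v j) = 0"
      using Suc.IH[OF J', of "\<lambda>i j. A i j - A i k * (A n j / A n k)"] by auto
    define s where "s = (\<Sum>j\<in>J'. A n j * v j) / A n k"
    define w where "w = v(k := - s)"
    have wJ: "(\<Sum>j\<in>J'. A i j * w j) = (\<Sum>j\<in>J'. A i j * v j)" for i
      by (rule sum.cong) (auto simp: w_def J'_def)
    have total: "(\<Sum>j\<in>J. A i j * w j) = (\<Sum>j\<in>J'. A i j * v j) - A i k * s" for i
      unfolding JJ wJ by (simp add: w_def)
    have "(\<Sum>j\<in>J. A i j * w j) = 0" if "i < Suc n" for i
    proof (cases "i = n")
      case True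
      thus ?thesis unfolding total using k by (simp add: s_def)
    next
      case False
      hence "(\<Sum>j\<in>J'. (A i j - A i k * (A n j / A n k)) * v j) = 0" using v(2) that by auto
      moreover have "(\<Sum>j\<in>J'. (A i j - A i k * (A n j / A n k)) * v j) = (\<Sum>j\<in>J'. A i j * v j) - A i k * s"
        unfolding s_def sum_divide_distrib sum_distrib_left sum_subtractf[symmetric]
        by (rule sum.cong) (auto simp: algebra_simps)
      ultimately show ?thesis unfolding total by simp
    qed
    moreover have "\<exists>j\<in>J. w j \<noteq> 0" using v(1) by (auto simp: w_def J'_def)
    ultimately show ?thesis by blast
  qed
qed

text \<open>
  The \<open>n\<close> columns together with \<open>e\<close> are dependent, and by injectivity
  \<open>e\<close> takes part in the relation.
\<close>
lemma injective_system_solvable: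
  fixes A :: "nat \<Rightarrow> nat \<Rightarrow> complex"
  assumes inj: "\<And>v. (\<And>i. i < n \<Longrightarrow> (\<Sum>j<n. A i j * v j) = 0) \<Longrightarrow> (\<And>j. j < n \<Longrightarrow> v j = 0)"
  shows "\<exists>v. \<forall>i<n. (\<Sum>j<n. A i j * v j) = e i"
proof -
  define A' where "A' i j = (if j < n then A i j else e i)" for i j
  obtain v where v: "\<exists>j\<in>{..<Suc n}. v j \<noteq> 0" "\<forall>i<n. (\<Sum>j\<in>{..<Suc n}. A' i j * v j) = 0"
    using homogeneous_system_nontrivial[of "{..<Suc n}" n A'] by auto
  have s: "(\<Sum>j<n. A i j * v j) + e i * v n = 0" if "i < n" for i
    using v(2) that by (simp add: A'_def)
  have vn: "v n \<noteq> 0"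
  proof
    assume "v n = 0"
    hence "\<And>j. j < n \<Longrightarrow> v j = 0" using s inj by simp
    thus False using v(1) \<open>v n = 0\<close> by (auto simp: less_Suc_eq)
  qed
  show ?thesis
  proof (intro exI[of _ "\<lambda>j. - v j / v n"] allI impI)
    fix i assume "i < n"
    have "(\<Sum>j<n. A i j * (- v j / v n)) = - (\<Sum>j<n. A i j * v j) / v n"
      by (simp add: sum_divide_distrib sum_negf)
    also have "\<dots> = e i" using s[OF \<open>i < n\<close>] vn by (simp add: field_simps add_eq_0_iff)
    finally show "(\<Sum>j<n. A i j * (- v j / v n)) = e i" .
  qed
qed

text \<open>
  If \<open>p\<close> were differentiable, differentiating \<open>p U = V\<close> and subtracting
  \<open>p U' = V'\<close> would give \<open>(dp/dt) U = 0\<close>, hence \<open>dp/dt =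
  0\<close>. Without this assumption, \<open>(p(t) - p(s)) U(t) = V(t) - p(s) U(t)\<close> still
  is \<open>o(t - s)\<close>, because its right-hand side vanishes at \<open>s\<close> together
  with its derivative; and \<open>U(t)\<close> is nearly inverted by the inverse \<open>B\<close>
  of \<open>U(s)\<close>.
\<close>
lemma solution_of_moving_system_constant:
  fixes U U' :: "real \<Rightarrow> nat \<Rightarrow> nat \<Rightarrow> complex" and V V' :: "real \<Rightarrow> nat \<Rightarrow> complex"
  assumes inv: "\<And>\<tau>. \<exists>B. \<forall>m<n. \<forall>k<n. (\<Sum>i<n. U \<tau> m i * B i k) = (if m = k then 1 else 0)"
    and dU: "\<And>\<tau> m i. ((\<lambda>t. U t m i) has_vector_derivative U' \<tau> m i) (at \<tau>)"
    and dV: "\<And>\<tau> i. ((\<lambda>t. V t i) has_vector_derivative V' \<tau> i) (at \<tau>)"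
    and p: "\<And>\<tau> i. i < n \<Longrightarrow> (\<Sum>m<n. p \<tau> m * U \<tau> m i) = V \<tau> i"
    and p': "\<And>\<tau> i. i < n \<Longrightarrow> (\<Sum>m<n. p \<tau> m * U' \<tau> m i) = V' \<tau> i"
    and k: "k < n"
  shows "p \<tau> k = p \<sigma> k"
proof -
  have "((\<lambda>t. p t k) has_vector_derivative 0) (at s)" for s
  proof -
    obtain B where B: "\<And>m k. m < n \<Longrightarrow> k < n \<Longrightarrow> (\<Sum>i<n. U s m i * B i k) = (if m = k then 1 else 0)"
      using inv by metis
    define e where "e t m = p t m - p s m" for t m
    define F where "F t i = V t i - (\<Sum>m<n. p s m * U t m i)" for t i
    have eF: "(\<Sum>m<n. e t m * U t m i) = F t i" if "i < n" for t i
      unfolding e_def F_def using p[OF that, of t] by (simp add: left_diff_distrib sum_subtractf)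
    have Fs: "F s i = 0" if "i < n" for i unfolding F_def using p[OF that] by simp
    have dF: "((\<lambda>t. F t i) has_vector_derivative 0) (at s)" if "i < n" for i
    proof -
      have "((\<lambda>t. F t i) has_vector_derivative (V' s i - (\<Sum>m<n. p s m * U' s m i))) (at s)"
        unfolding F_def by (intro derivative_intros dV dU has_vector_derivative_mult_right)
      thus ?thesis using p'[OF that] by simp
    qed
    have Flim: "((\<lambda>t. cmod (F t i) / \<bar>t - s\<bar>) \<longlongrightarrow> 0) (at s)" if "i < n" for i
      using dF[OF that] Fs[OF that] unfolding has_vector_derivative_def has_derivative_iff_norm by simp
    define D where "D t m k = (\<Sum>i<n. U t m i * B i k) - (if m = k then 1 else 0)" for t m k
    have Uc: "((\<lambda>t. U t m i) \<longlongrightarrow> U s m i) (at s)" for m i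
      using has_vector_derivative_continuous[OF dU] unfolding continuous_at by simp
    have Dlim: "((\<lambda>t. \<Sum>m<n. \<Sum>k<n. cmod (D t m k)) \<longlongrightarrow> 0) (at s)"
    proof -
      have "((\<lambda>t. \<Sum>m<n. \<Sum>k<n. cmod (D t m k)) \<longlongrightarrow> (\<Sum>m<n. \<Sum>k<n. cmod (D s m k))) (at s)"
        unfolding D_def by (intro tendsto_intros Uc)
      moreover have "(\<Sum>m<n. \<Sum>k<n. cmod (D s m k)) = 0" using B by (intro sum.neutral ballI) (simp add: D_def)
      ultimately show ?thesis by simp
    qed
    define N where "N t = (\<Sum>m<n. cmod (e t m))" for t
    define G where "G t = (\<Sum>k<n. \<Sum>i<n. cmod (F t i) * cmod (B i k))" for t
    have bound: "N t \<le> G t + N t * (\<Sum>m<n. \<Sum>k<n. cmod (D t m k))" for t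
    proof -
      have ek: "e t k = (\<Sum>i<n. F t i * B i k) - (\<Sum>m<n. e t m * D t m k)" if "k < n" for k
      proof -
        have "(\<Sum>m<n. e t m * D t m k) = (\<Sum>m<n. e t m * (\<Sum>i<n. U t m i * B i k)) - (\<Sum>m<n. e t m * (if m = k then 1 else 0))"
          unfolding D_def by (simp add: right_diff_distrib sum_subtractf)
        also have "(\<Sum>m<n. e t m * (if m = k then 1 else 0)) = e t k" using that by (simp add: if_distrib cong: if_cong)
        also have "(\<Sum>m<n. e t m * (\<Sum>i<n. U t m i * B i k)) = (\<Sum>i<n. (\<Sum>m<n. e t m * U t m i) * B i k)"
          unfolding sum_distrib_left sum_distrib_right by (subst sum.swap) (simp add: mult.assoc)
        also have "\<dots> = (\<Sum>i<n. F t i * B i k)" using eF by (intro sum.cong) auto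
        finally show ?thesis by simp
      qed
      have "cmod (e t k) \<le> (\<Sum>i<n. cmod (F t i) * cmod (B i k)) + (\<Sum>m<n. cmod (e t m) * cmod (D t m k))" if "k < n" for k
      proof -
        have "cmod (e t k) \<le> cmod (\<Sum>i<n. F t i * B i k) + cmod (\<Sum>m<n. e t m * D t m k)"
          unfolding ek[OF that] by (rule norm_triangle_ineq4)
        also have "\<dots> \<le> (\<Sum>i<n. cmod (F t i * B i k)) + (\<Sum>m<n. cmod (e t m * D t m k))"
          by (intro add_mono norm_sum)
        finally show ?thesis by (simp add: norm_mult)
      qed
      hence "N t \<le> (\<Sum>k<n. (\<Sum>i<n. cmod (F t i) * cmod (B i k)) + (\<Sum>m<n. cmod (e t m) * cmod (D t m k)))"
        unfolding N_def by (intro sum_mono) auto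
      also have "\<dots> = G t + (\<Sum>m<n. cmod (e t m) * (\<Sum>k<n. cmod (D t m k)))"
        unfolding G_def sum.distrib sum_distrib_left by (subst (3) sum.swap) simp
      also have "(\<Sum>m<n. cmod (e t m) * (\<Sum>k<n. cmod (D t m k))) \<le> (\<Sum>m<n. cmod (e t m) * (\<Sum>m<n. \<Sum>k<n. cmod (D t m k)))"
        by (intro sum_mono mult_left_mono member_le_sum[where f="\<lambda>m. \<Sum>k<n. cmod (D t m k)"]) (auto intro: sum_nonneg)
      also have "\<dots> = N t * (\<Sum>m<n. \<Sum>k<n. cmod (D t m k))" unfolding N_def by (simp add: sum_distrib_right)
      finally show ?thesis by simp
    qed
    have ev: "\<forall>\<^sub>F t in at s. N t \<le> 2 * G t"
    proof -
      have "\<forall>\<^sub>F t in at s. (\<Sum>m<n. \<Sum>k<n. cmod (D t m k)) < 1 / 2" using Dlim by (rule order_tendstoD) simp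
      thus ?thesis
      proof (rule eventually_mono)
        fix t assume "(\<Sum>m<n. \<Sum>k<n. cmod (D t m k)) < 1 / 2"
        moreover have "N t \<ge> 0" unfolding N_def by (intro sum_nonneg) auto
        ultimately have "N t * (\<Sum>m<n. \<Sum>k<n. cmod (D t m k)) \<le> N t * (1 / 2)" by (intro mult_left_mono) auto
        thus "N t \<le> 2 * G t" using bound[of t] by linarith
      qed
    qed
    have "((\<lambda>t. cmod (p t k - p s k) / \<bar>t - s\<bar>) \<longlongrightarrow> 0) (at s)"
    proof (rule Lim_null_comparison)
      show "\<forall>\<^sub>F t in at s. norm (cmod (p t k - p s k) / \<bar>t - s\<bar>) \<le> 2 * (\<Sum>k<n. \<Sum>i<n. (cmod (F t i) / \<bar>t - s\<bar>) * cmod (B i k))"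
        using ev
      proof (rule eventually_mono)
        fix t assume t: "N t \<le> 2 * G t"
        have "cmod (p t k - p s k) \<le> N t" unfolding N_def e_def[symmetric] using k by (intro member_le_sum[where f="\<lambda>m. cmod (e t m)"]) auto
        hence "cmod (p t k - p s k) / \<bar>t - s\<bar> \<le> 2 * G t / \<bar>t - s\<bar>" using t by (intro divide_right_mono) auto
        also have "\<dots> = 2 * (\<Sum>k<n. \<Sum>i<n. (cmod (F t i) / \<bar>t - s\<bar>) * cmod (B i k))"
          unfolding G_def by (simp add: sum_divide_distrib sum_distrib_left)
        finally show "norm (cmod (p t k - p s k) / \<bar>t - s\<bar>) \<le> 2 * (\<Sum>k<n. \<Sum>i<n. (cmod (F t i) / \<bar>t - s\<bar>) * cmod (B i k))" by simp
      qed
      have "((\<lambda>t. 2 * (\<Sum>k<n. \<Sum>i<n. (cmod (F t i) / \<bar>t - s\<bar>) * cmod (B i k))) \<longlongrightarrow> 2 * (\<Sum>k<n. \<Sum>i<n. 0 * cmod (B i k))) (at s)"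
        by (intro tendsto_intros Flim) auto
      thus "((\<lambda>t. 2 * (\<Sum>k<n. \<Sum>i<n. (cmod (F t i) / \<bar>t - s\<bar>) * cmod (B i k))) \<longlongrightarrow> 0) (at s)" by simp
    qed
    thus ?thesis unfolding has_vector_derivative_def has_derivative_iff_norm by simp
  qed
  hence D: "((\<lambda>t. p t k) has_vector_derivative 0) (at s within UNIV)" for s by simp
  obtain c where c: "\<And>t. t \<in> UNIV \<Longrightarrow> p t k = c"
    by (rule has_vector_derivative_zero_constant[of UNIV "\<lambda>t. p t k"]) (use D in \<open>simp, blast+\<close>)
  show ?thesis using c[of \<tau>] c[of \<sigma>] by simp
qed

section \<open>Uniqueness of Fourier coefficients\<close>

lemma cos_le_cos_outside:
  assumes "0 \<le> d" "d \<le> pi" "d \<le> \<bar>x\<bar>" "\<bar>x\<bar> \<le> 2 * pi - d"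
  shows "cos x \<le> cos d"
proof (cases "\<bar>x\<bar> \<le> pi")
  case True
  thus ?thesis using cos_monotone_0_pi_le[of d "\<bar>x\<bar>"] assms by simp
next
  case False
  have "cos (2 * pi - \<bar>x\<bar>) \<le> cos d" using False assms by (intro cos_monotone_0_pi_le) auto
  thus ?thesis by (simp add: cos_diff)
qed

text \<open>
  If \<open>h\<close> does not vanish at an interior point \<open>t0\<close>, integrate it against
  high powers of the trigonometric polynomial \<open>q = 1 + cos (t - t0) - cos d\<close>: these
  stay bounded by \<open>1\<close> at distance at least \<open>d\<close> from \<open>t0\<close>
  and grow exponentially near \<open>t0\<close>, which is incompatible with all integrals being
  \<open>0\<close>.
\<close>
lemma fourier_uniqueness:
  fixes h :: "real \<Rightarrow> complex"
  assumes cont: "continuous_on {0..2 * pi} h"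
    and int: "\<And>k l. ((\<lambda>\<tau>. h \<tau> * cis \<tau> ^ k * cnj (cis \<tau>) ^ l) has_integral 0) {0..2 * pi}"
    and \<tau>: "\<tau> \<in> {0..2 * pi}"
  shows "h \<tau> = 0"
proof -
  have inner: "h t0 = 0" if t0: "t0 \<in> {0<..<2 * pi}" for t0
  proof (rule ccontr)
    assume nz: "h t0 \<noteq> 0"
    define g where "g t = Re (cnj (h t0) * h t)" for t
    have gc: "continuous_on {0..2 * pi} g" unfolding g_def by (intro continuous_intros cont)
    define b where "b = g t0"
    have b: "b > 0" unfolding b_def g_def using nz by (simp add: complex_norm_square[symmetric] mult.commute[of "cnj _"] zero_less_power2)
    have "isCont g t0" using gc t0 by (simp add: continuous_on_interior)
    then obtain d0 where d0: "d0 > 0" "\<And>t. \<bar>t - t0\<bar> < d0 \<Longrightarrow> \<bar>g t - g t0\<bar> < b / 2"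
      unfolding continuous_at_eps_delta dist_real_def using b by (metis half_gt_zero)
    define d where "d = min (min (d0 / 2) 1) (min (t0 / 2) ((2 * pi - t0) / 2))"
    have dle: "d \<le> d0 / 2" "d \<le> 1" "d \<le> t0 / 2" "d \<le> (2 * pi - t0) / 2"
      unfolding d_def by linarith+
    have d0': "d > 0" using d0 t0 unfolding d_def by auto
    have d: "d > 0" "d \<le> 1" "d < d0" "d < t0" "d < 2 * pi - t0" using d0' dle by auto
    have dpi: "d < pi / 2" using d pi_gt3 by simp
    have gd: "g t \<ge> b / 2" if "\<bar>t - t0\<bar> \<le> d" for t
      using d0(2)[of t] that d unfolding b_def[symmetric] by (auto simp: abs_if split: if_splits)
    define q where "q t = 1 + cos (t - t0) - cos d" for t
    have qe: "complex_of_real (q t) = of_real (1 - cos d) + cis (-t0) / 2 * cis t + cis t0 / 2 * cnj (cis t)" for t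
      by (simp add: q_def complex_eq_iff cos_diff field_simps)
    have hN: "((\<lambda>\<tau>. h \<tau> * of_real (q \<tau>) ^ N * cis \<tau> ^ k * cnj (cis \<tau>) ^ l) has_integral 0) {0..2 * pi}" for N k l
    proof (induction N arbitrary: k l)
      case 0
      show ?case using int[of k l] by (simp only: power_0 mult_1_right)
    next
      case (Suc N)
      have "((\<lambda>\<tau>. of_real (1 - cos d) * (h \<tau> * of_real (q \<tau>) ^ N * cis \<tau> ^ k * cnj (cis \<tau>) ^ l)
          + cis (-t0) / 2 * (h \<tau> * of_real (q \<tau>) ^ N * cis \<tau> ^ Suc k * cnj (cis \<tau>) ^ l)
          + cis t0 / 2 * (h \<tau> * of_real (q \<tau>) ^ N * cis \<tau> ^ k * cnj (cis \<tau>) ^ Suc l)) has_integral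
          (of_real (1 - cos d) * 0 + cis (-t0) / 2 * 0 + cis t0 / 2 * 0)) {0..2 * pi}"
        by (intro has_integral_add has_integral_mult_right Suc)
      also have "(\<lambda>\<tau>. of_real (1 - cos d) * (h \<tau> * of_real (q \<tau>) ^ N * cis \<tau> ^ k * cnj (cis \<tau>) ^ l)
          + cis (-t0) / 2 * (h \<tau> * of_real (q \<tau>) ^ N * cis \<tau> ^ Suc k * cnj (cis \<tau>) ^ l)
          + cis t0 / 2 * (h \<tau> * of_real (q \<tau>) ^ N * cis \<tau> ^ k * cnj (cis \<tau>) ^ Suc l))
          = (\<lambda>\<tau>. h \<tau> * of_real (q \<tau>) ^ Suc N * cis \<tau> ^ k * cnj (cis \<tau>) ^ l)"
        unfolding power_Suc qe by (simp add: fun_eq_iff algebra_simps)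
      finally show ?case by simp
    qed
    have gq: "((\<lambda>\<tau>. g \<tau> * q \<tau> ^ N) has_integral 0) {0..2 * pi}" for N
    proof -
      have "((\<lambda>\<tau>. cnj (h t0) * (h \<tau> * of_real (q \<tau>) ^ N)) has_integral cnj (h t0) * 0) {0..2 * pi}"
        using has_integral_mult_right[OF hN[of N 0 0], of "cnj (h t0)"] by (simp only: power_0 mult_1_right)
      from has_integral_linear[OF this bounded_linear_Re]
      have "((\<lambda>\<tau>. Re ((cnj (h t0) * h \<tau>) * of_real (q \<tau> ^ N))) has_integral 0) {0..2 * pi}"
        by (simp only: o_def mult.assoc of_real_power mult_zero_right zero_complex.simps)
      moreover have "Re (w * of_real x) = Re w * x" for w x by simp
      ultimately show ?thesis unfolding g_def by (simp only:)
    qed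
    obtain G where G': "\<forall>x\<in>g ` {0..2 * pi}. norm x \<le> G"
      using compact_imp_bounded[OF compact_continuous_image[OF gc compact_Icc]] unfolding bounded_iff by blast
    have G: "\<bar>g t\<bar> \<le> G" if "t \<in> {0..2 * pi}" for t using G' that by (metis imageI real_norm_def)
    have G0: "G \<ge> 0" using G[of 0] by auto
    \<comment> \<open>The lower bound for \<open>q\<close> at distance at most \<open>d / 2\<close> from \<open>t0\<close>.\<close>
    define r where "r = 1 + cos (d / 2) - cos d"
    have r: "r > 1" unfolding r_def using cos_monotone_0_pi[of "d/2" d] d dpi by auto
    define J where "J = {t0 - d / 2..t0 + d / 2}"
    have low: "(if t \<in> J then b / 2 * r ^ N else 0) - G \<le> g t * q t ^ N" if t: "t \<in> {0..2 * pi}" for t N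
    proof (cases "\<bar>t - t0\<bar> \<le> d")
      case True
      have c: "cos (t - t0) \<ge> cos d"
        using cos_monotone_0_pi_le[of "\<bar>t - t0\<bar>" d] True d dpi by (simp add: cos_abs_real)
      hence q1: "q t \<ge> 1" by (simp add: q_def)
      show ?thesis
      proof (cases "t \<in> J")
        case True
        hence "\<bar>t - t0\<bar> \<le> d / 2" unfolding J_def atLeastAtMost_iff by linarith
        hence "cos (t - t0) \<ge> cos (d / 2)"
          using cos_monotone_0_pi_le[of "\<bar>t - t0\<bar>" "d/2"] d dpi by (simp add: cos_abs_real)
        hence "r ^ N \<le> q t ^ N" using r by (intro power_mono) (auto simp: q_def r_def)
        hence "b / 2 * r ^ N \<le> g t * q t ^ N" using gd[OF \<open>\<bar>t - t0\<bar> \<le> d\<close>] b r q1 by (intro mult_mono) auto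
        thus ?thesis using True G0 by simp
      next
        case False
        have "0 \<le> g t * q t ^ N" using gd[OF \<open>\<bar>t - t0\<bar> \<le> d\<close>] b q1 by (intro mult_nonneg_nonneg) auto
        thus ?thesis using False G0 by simp
      qed
    next
      case False
      have "\<bar>t - t0\<bar> \<le> 2 * pi - d" using t d by (auto simp: abs_if)
      hence "cos (t - t0) \<le> cos d" using False d dpi by (intro cos_le_cos_outside) auto
      moreover have "- 1 \<le> cos (t - t0)" by simp
      moreover have "cos d \<le> 1" by simp
      ultimately have "\<bar>q t\<bar> \<le> 1" unfolding q_def by linarith
      hence "\<bar>q t ^ N\<bar> \<le> 1" by (simp add: power_abs power_le_one)
      hence "\<bar>g t * q t ^ N\<bar> \<le> G * 1" unfolding abs_mult using G[OF t] G0 by (intro mult_mono) auto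
      moreover have "t \<notin> J" using False d unfolding J_def atLeastAtMost_iff by linarith
      ultimately show ?thesis by simp
    qed
    have ineq: "d * (b / 2 * r ^ N) - 2 * pi * G \<le> 0" for N
    proof (rule has_integral_le[OF _ gq[of N] low])
      have sub: "J \<subseteq> {0..2 * pi}" using d unfolding J_def by auto
      have "((\<lambda>t. b / 2 * r ^ N) has_integral measure lborel J *\<^sub>R (b / 2 * r ^ N)) J"
        unfolding J_def by (rule has_integral_const_real)
      hence "((\<lambda>t. if t \<in> J then b / 2 * r ^ N else 0) has_integral d * (b / 2 * r ^ N)) {0..2 * pi}"
        using sub d by (subst has_integral_restrict) (auto simp: J_def)
      moreover have "((\<lambda>t. G) has_integral measure lborel {0..2 * pi} *\<^sub>R G) {0..2 * pi}"
        by (rule has_integral_const_real)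
      ultimately show "((\<lambda>t. (if t \<in> J then b / 2 * r ^ N else 0) - G) has_integral d * (b / 2 * r ^ N) - 2 * pi * G) {0..2 * pi}"
        by (intro has_integral_diff) simp_all
    qed
    obtain N where "2 * pi * G / (d * (b / 2)) < r ^ N" using real_arch_pow[OF r] by blast
    hence "2 * pi * G < d * (b / 2 * r ^ N)" using d b by (simp add: field_simps)
    thus False using ineq[of N] by simp
  qed
  have "closure {0<..<2 * pi} = {0..2 * pi}" by (simp add: closure_greaterThanLessThan)
  thus ?thesis
    using continuous_constant_on_closure[of "{0<..<2 * pi}" h 0] cont inner \<tau> by auto
qed

section \<open>The inner product as an integral over fibres\<close>

lemma periodic_reduce:
  fixes h :: "real \<Rightarrow> 'a"
  assumes per: "\<And>\<tau>. h (\<tau> + 2 * pi) = h \<tau>"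
  obtains s where "s \<in> {0..2 * pi}" "h \<tau> = h s"
proof -
  have n: "h (\<tau> + 2 * pi * real k) = h \<tau>" for \<tau> k
  proof (induction k)
    case (Suc k)
    have "h (\<tau> + 2 * pi * real (Suc k)) = h ((\<tau> + 2 * pi * real k) + 2 * pi)" by (simp add: algebra_simps)
    thus ?case using per Suc by simp
  qed simp
  define m where "m = \<lfloor>\<tau> / (2 * pi)\<rfloor>"
  define s where "s = \<tau> - 2 * pi * of_int m"
  have "of_int m \<le> \<tau> / (2 * pi)" "\<tau> / (2 * pi) < of_int m + 1" unfolding m_def by linarith+
  hence "s \<in> {0..2 * pi}" unfolding s_def by (auto simp: field_simps)
  moreover have "h \<tau> = h s"
  proof (cases "m \<ge> 0")
    case True
    hence "\<tau> = s + 2 * pi * real (nat m)" by (simp add: s_def)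
    thus ?thesis using n by metis
  next
    case False
    hence "s = \<tau> + 2 * pi * real (nat (- m))" by (simp add: s_def)
    thus ?thesis using n by metis
  qed
  ultimately show ?thesis using that by blast
qed

text \<open>
  Since \<open>Re x \<le> (A + B) / 2\<close>, the point \<open>x\<close> is not farther from
  \<open>B\<close> than from \<open>A\<close>; the factor \<open>l\<close> of modulus less than
  \<open>1\<close> then forces both distances to be \<open>0\<close>.
\<close>
lemma equal_distance_imp:
  fixes A B :: real and x l :: complex
  assumes AB: "B \<le> A" "0 \<le> B" and x: "(cmod x)\<^sup>2 \<le> A * B" and l: "cmod l < 1" and e: "of_real A - x = l * (cnj x - of_real B)"
  shows "A = B"
proof -
  have 1: "cmod (cnj x - of_real B) = cmod (x - of_real B)"
    by (metis complex_cnj_complex_of_real complex_cnj_diff complex_mod_cnj)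
  have "Re x \<le> (A + B) / 2"
  proof -
    have "(Re x)\<^sup>2 \<le> (cmod x)\<^sup>2" by (simp add: cmod_power2)
    also have "\<dots> \<le> ((A + B) / 2)\<^sup>2" using x zero_le_power2[of "A - B"] by (simp add: power2_eq_square field_simps)
    finally show ?thesis by (rule power2_le_imp_le) (use AB in simp)
  qed
  hence "0 \<le> (A - B) * (A + B - 2 * Re x)" using AB by (intro mult_nonneg_nonneg) auto
  hence "(cmod (x - of_real B))\<^sup>2 \<le> (cmod (of_real A - x))\<^sup>2"
    unfolding cmod_power2 by (simp add: power2_eq_square algebra_simps)
  hence "cmod (x - of_real B) \<le> cmod (of_real A - x)" by (rule power2_le_imp_le) simp
  also have "\<dots> = cmod l * cmod (x - of_real B)" unfolding e norm_mult 1 ..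
  finally have "(1 - cmod l) * cmod (x - of_real B) \<le> 0" by (simp add: algebra_simps)
  hence "x = of_real B" using l by (simp add: mult_le_0_iff)
  hence "of_real A = (of_real B :: complex)" using e by simp
  thus ?thesis by (simp only: of_real_eq_iff)
qed

lemma on_disc_mult_op: "on_disc (\<lambda>z. \<psi> z * f z) = mult_op \<psi> (on_disc f)"
  by (auto simp: on_disc_def mult_op_def)

lemma on_disc_dirichlet: "holo_past f \<Longrightarrow> on_disc f \<in> dirichlet_space"
  unfolding holo_past_def using on_disc_in_dirichlet by blast

lemma holo_past_dkernel: "cmod w < 1 \<Longrightarrow> holo_past (dkernel w)"
  unfolding holo_past_def by (rule dkernel_extends)

lemma mult_op_dirichlet: "holo_past \<psi> \<Longrightarrow> f \<in> dirichlet_space \<Longrightarrow> mult_op \<psi> f \<in> dirichlet_space"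
  unfolding holo_past_def using mult_op_in by blast

lemma dirichlet_divide_roots:
  assumes "finite A" "\<And>w. w \<in> A \<Longrightarrow> cmod w < 1" "s \<in> dirichlet_space" "\<And>w. w \<in> A \<Longrightarrow> s w = 0"
  shows "\<exists>h\<in>dirichlet_space. \<forall>z. s z = (\<Prod>w\<in>A. z - w) * h z"
  using assms(1,2,4)
proof (induction A rule: finite_induct)
  case empty
  thus ?case using assms(3) by auto
next
  case (insert b A)
  then obtain h where h: "h \<in> dirichlet_space" "\<And>z. s z = (\<Prod>w\<in>A. z - w) * h z" by auto
  have "(\<Prod>w\<in>A. b - w) \<noteq> 0" using insert.hyps by auto
  hence hb: "h b = 0" using h(2)[of b] insert.prems(2)[of b] by auto
  have b: "b \<in> unit_disc" using insert.prems(1)[of b] by simp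
  obtain k where k: "k holomorphic_on unit_disc" "\<And>z. z \<in> unit_disc \<Longrightarrow> h z = (z - b) * k z"
    using holomorphic_factor_root[OF dirichlet_spaceD(1)[OF h(1)] open_ball b hb] by blast
  have e: "(\<lambda>z. (z - b) * on_disc k z) = h"
    using k(2) dirichlet_spaceD(2)[OF h(1)] by (auto simp: on_disc_def fun_eq_iff)
  have "on_disc k \<in> dirichlet_space"
    by (rule dirichlet_divide_linear[OF on_disc_holomorphic[OF k(1)], of b]) (use b h(1) e in \<open>auto simp: on_disc_def\<close>)
  moreover have "s z = (\<Prod>w\<in>insert b A. z - w) * on_disc k z" for z
    using h(2)[of z] fun_cong[OF e, of z] insert.hyps by (simp add: mult_ac)
  ultimately show ?case by blast
qed

context finite_blaschke
begin

text \<open>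
  The boundary values of \<open>z f\<close>, the function that is differentiated in the circle
  formula, along \<open>gam\<close>. The values \<open>tr f (\<tau> + 2 \<pi> m)\<close> for
  \<open>m < n\<close> form the vector of \<open>f\<close> over the fibre at
  \<open>\<tau>\<close>.
\<close>
definition tr :: "(complex \<Rightarrow> complex) \<Rightarrow> real \<Rightarrow> complex" where
  "tr f \<tau> = gam \<tau> * f (gam \<tau>)"

definition tr' :: "(complex \<Rightarrow> complex) \<Rightarrow> real \<Rightarrow> complex" where
  "tr' f \<tau> = (f (gam \<tau>) + gam \<tau> * deriv f (gam \<tau>)) * (\<i> * beta' \<tau> * gam \<tau>)"

lemma tr_deriv:
  assumes "holo_past f"
  shows "(tr f has_vector_derivative tr' f \<tau>) (at \<tau>)"
proof -
  obtain R where R: "R > 1" "f holomorphic_on ball 0 R" using assms unfolding holo_past_def by blast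
  have "f field_differentiable at (gam \<tau>)"
    using holomorphic_on_imp_differentiable_at[OF R(2) open_ball] R(1) gam_norm by simp
  hence "((\<lambda>z. z * f z) has_field_derivative (f (gam \<tau>) + gam \<tau> * deriv f (gam \<tau>))) (at (gam \<tau>))"
    by (auto intro!: derivative_eq_intros simp: DERIV_deriv_iff_field_differentiable)
  from field_vector_diff_chain_at[OF gam_deriv this] show ?thesis
    by (simp add: o_def tr_def[abs_def] tr'_def mult_ac)
qed

lemma gam_cont: "continuous_on S gam"
  using gam_deriv by (intro continuous_at_imp_continuous_on ballI has_vector_derivative_continuous) blast

lemma tr_cont: "holo_past f \<Longrightarrow> continuous_on S (tr f)"
  using tr_deriv by (intro continuous_at_imp_continuous_on ballI has_vector_derivative_continuous) blast

lemma tr'_cont: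
  assumes "holo_past f" shows "continuous_on S (tr' f)"
proof -
  obtain R where R: "R > 1" "f holomorphic_on ball 0 R" using assms unfolding holo_past_def by blast
  have im: "gam ` S \<subseteq> ball 0 R" using gam_norm R(1) by auto
  have "continuous_on (ball 0 R) f" "continuous_on (ball 0 R) (deriv f)"
    using R(2) by (auto intro: holomorphic_on_imp_continuous_on holomorphic_deriv)
  from continuous_on_compose2[OF this(1) gam_cont im] continuous_on_compose2[OF this(2) gam_cont im]
  show ?thesis unfolding tr'_def[abs_def]
    by (intro continuous_intros gam_cont continuous_on_subset[OF beta'_cont]) auto
qed

lemma tr_phi_power: "tr (\<lambda>z. phi z ^ k * f z) \<tau> = (kappa * cis \<tau>) ^ k * tr f \<tau>"
  by (simp add: tr_def phi_gam)

lemma tr'_phi_power: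
  assumes "holo_past f"
  shows "tr' (\<lambda>z. phi z ^ k * f z) \<tau> = (kappa * cis \<tau>) ^ k * (\<i> * of_nat k * tr f \<tau> + tr' f \<tau>)"
proof -
  have h: "holo_past (\<lambda>z. phi z ^ k * f z)" by (intro holo_past_mult holo_past_power holo_past_phi assms)
  have 1: "((\<lambda>\<tau>. (kappa * cis \<tau>) ^ k) has_vector_derivative \<i> * of_nat k * (kappa * cis \<tau>) ^ k) (at \<tau>)"
  proof -
    have e: "(kappa * cis t) ^ k = kappa ^ k * exp (\<i> * (of_nat k * of_real t))" for t
      unfolding power_mult_distrib cis_conv_exp by (simp add: exp_of_nat_mult[symmetric] mult_ac)
    show ?thesis unfolding e
      by (auto intro!: derivative_eq_intros has_vector_derivative_real_field)
  qed
  have "((\<lambda>\<tau>. (kappa * cis \<tau>) ^ k * tr f \<tau>) has_vector_derivative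
      (kappa * cis \<tau>) ^ k * tr' f \<tau> + \<i> * of_nat k * (kappa * cis \<tau>) ^ k * tr f \<tau>) (at \<tau>)"
    by (rule has_vector_derivative_mult[OF 1 tr_deriv[OF assms]])
  hence "(tr (\<lambda>z. phi z ^ k * f z) has_vector_derivative
      (kappa * cis \<tau>) ^ k * tr' f \<tau> + \<i> * of_nat k * (kappa * cis \<tau>) ^ k * tr f \<tau>) (at \<tau>)"
    unfolding tr_phi_power[abs_def] .
  from vector_derivative_unique_at[OF tr_deriv[OF h] this] show ?thesis by (simp add: algebra_simps)
qed

abbreviation sh :: "real \<Rightarrow> nat \<Rightarrow> real" where "sh \<tau> m \<equiv> \<tau> + 2 * pi * real m"

text \<open>
  Substitution \<open>\<theta> = beta \<tau>\<close>, with the interval of length \<open>2 \<pi>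
  n\<close> for \<open>\<tau>\<close> folded into \<open>n\<close> intervals of length \<open>2
  \<pi>\<close>. In terms of an antiderivative \<open>K\<close> of \<open>k\<close> the sum over
  \<open>m\<close> telescopes.
\<close>
lemma fibre_integral:
  fixes k :: "real \<Rightarrow> complex"
  assumes int: "(k has_integral I) {0..2 * pi}" and cont: "continuous_on {0..2 * pi} k"
  shows "((\<lambda>\<tau>. \<Sum>m<n. beta' (sh \<tau> m) *\<^sub>R k (beta (sh \<tau> m))) has_integral I) {0..2 * pi}"
proof -
  obtain K where K: "\<And>x. x \<in> {0..2 * pi} \<Longrightarrow> (K has_vector_derivative k x) (at x within {0..2 * pi})"
    using antiderivative_continuous[OF cont] by metis
  have "(k has_integral K (2 * pi) - K 0) {0..2 * pi}"
    by (rule fundamental_theorem_of_calculus) (use K in auto)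
  hence I: "I = K (2 * pi) - K 0" using int has_integral_unique by blast
  have rng: "beta (sh \<tau> m) \<in> {0..2 * pi}" if \<tau>: "\<tau> \<in> {0..2 * pi}" and m: "m < n" for \<tau> m
  proof -
    have mono: "x \<le> y \<Longrightarrow> beta x \<le> beta y" for x y using beta_strict_mono[of x y] by (cases "x = y") auto
    have "\<tau> + 2 * pi * real m \<le> 0 + 2 * pi * real n"
    proof -
      have "2 * pi * real (Suc m) \<le> 2 * pi * real n" using m by (intro mult_left_mono) auto
      thus ?thesis using \<tau> by (simp add: algebra_simps)
    qed
    from mono[OF this] have "beta (sh \<tau> m) \<le> 2 * pi" unfolding beta_period beta_0 by simp
    moreover have "0 \<le> beta (sh \<tau> m)" using mono[of 0 "sh \<tau> m"] \<tau> beta_0 by simp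
    ultimately show ?thesis by simp
  qed
  have each: "((\<lambda>\<tau>. beta' (sh \<tau> m) *\<^sub>R k (beta (sh \<tau> m))) has_integral K (beta (sh (2 * pi) m)) - K (beta (sh 0 m))) {0..2 * pi}"
    if m: "m < n" for m
  proof (rule fundamental_theorem_of_calculus)
    fix x assume x: "x \<in> {0..2 * pi}"
    have 1: "((\<lambda>\<tau>. beta (sh \<tau> m)) has_vector_derivative beta' (sh x m)) (at x within {0..2 * pi})"
    proof -
      have "((\<lambda>\<tau>. beta (sh \<tau> m)) has_real_derivative beta' (sh x m) * 1) (at x)"
        by (rule DERIV_chain2[OF beta_deriv]) (auto intro!: derivative_eq_intros)
      thus ?thesis by (simp add: has_real_derivative_iff_has_vector_derivative has_vector_derivative_at_within)
    qed
    have 2: "(K has_vector_derivative k (beta (sh x m))) (at (beta (sh x m)) within (\<lambda>\<tau>. beta (sh \<tau> m)) ` {0..2 * pi})"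
      by (rule has_vector_derivative_within_subset[OF K[OF rng[OF x m]]]) (use rng m in auto)
    from vector_diff_chain_within[OF 1 2]
    show "((\<lambda>\<tau>. K (beta (sh \<tau> m))) has_vector_derivative beta' (sh x m) *\<^sub>R k (beta (sh x m))) (at x within {0..2 * pi})"
      by (simp add: o_def)
  qed simp
  have "((\<lambda>\<tau>. \<Sum>m<n. beta' (sh \<tau> m) *\<^sub>R k (beta (sh \<tau> m))) has_integral (\<Sum>m<n. K (beta (sh (2 * pi) m)) - K (beta (sh 0 m)))) {0..2 * pi}"
    by (intro has_integral_sum each) auto
  also have "(\<Sum>m<n. K (beta (sh (2 * pi) m)) - K (beta (sh 0 m))) = (\<Sum>m<n. K (beta (sh 0 (Suc m))) - K (beta (sh 0 m)))"
    by (rule sum.cong) (auto simp: algebra_simps)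
  also have "\<dots> = K (beta (sh 0 n)) - K (beta (sh 0 0))" by (rule sum_lessThan_telescope)
  also have "\<dots> = I" unfolding I beta_period beta_0 by (simp add: beta_0)
  finally show ?thesis .
qed

lemma inner_eq_fibre_integral:
  assumes f: "holo_past f" and g: "holo_past g"
  shows "((\<lambda>\<tau>. \<Sum>m<n. tr' f (sh \<tau> m) * cnj (tr g (sh \<tau> m))) has_integral
           2 * pi * \<i> * dirichlet_inner (on_disc f) (on_disc g)) {0..2 * pi}"
proof -
  obtain R where R: "R > 1" "f holomorphic_on ball 0 R" "g holomorphic_on ball 0 R" using holo_past_common[OF f g] .
  define k where "k \<theta> = (f (cis \<theta>) + cis \<theta> * deriv f (cis \<theta>)) * cnj (g (cis \<theta>))" for \<theta>
  have im: "cis ` S \<subseteq> ball 0 R" for S using R(1) by auto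
  have c: "continuous_on (ball 0 R) f" "continuous_on (ball 0 R) (deriv f)" "continuous_on (ball 0 R) g"
    using R by (auto intro: holomorphic_on_imp_continuous_on holomorphic_deriv)
  have kc: "continuous_on {0..2 * pi} k"
    unfolding k_def by (intro continuous_intros continuous_on_compose2[OF c(1) _ im] continuous_on_compose2[OF c(2) _ im]
        continuous_on_compose2[OF c(3) _ im])
  have "(k has_integral 2 * pi * dirichlet_inner (on_disc f) (on_disc g)) {0..2 * pi}"
    unfolding k_def by (rule dirichlet_inner_circle[OF R(2,3,1)])
  from has_integral_mult_right[OF fibre_integral[OF this kc], of \<i>]
  have "((\<lambda>\<tau>. \<i> * (\<Sum>m<n. beta' (sh \<tau> m) *\<^sub>R k (beta (sh \<tau> m)))) has_integral
           2 * pi * \<i> * dirichlet_inner (on_disc f) (on_disc g)) {0..2 * pi}"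
    by (simp add: mult_ac)
  also have "(\<lambda>\<tau>. \<i> * (\<Sum>m<n. beta' (sh \<tau> m) *\<^sub>R k (beta (sh \<tau> m)))) = (\<lambda>\<tau>. \<Sum>m<n. tr' f (sh \<tau> m) * cnj (tr g (sh \<tau> m)))"
  proof
    fix \<tau>
    have "\<i> * (beta' t *\<^sub>R k (beta t)) = tr' f t * cnj (tr g t)" for t
    proof -
      have "gam t * cnj (gam t) = 1" by (simp add: complex_norm_square[symmetric] gam_norm)
      hence "tr' f t * cnj (tr g t) = (f (gam t) + gam t * deriv f (gam t)) * (\<i> * beta' t) * cnj (g (gam t))"
        unfolding tr'_def tr_def by (simp add: mult_ac)
      thus ?thesis by (simp add: k_def gam_def[symmetric] scaleR_conv_of_real mult_ac)
    qed
    thus "\<i> * (\<Sum>m<n. beta' (sh \<tau> m) *\<^sub>R k (beta (sh \<tau> m))) = (\<Sum>m<n. tr' f (sh \<tau> m) * cnj (tr g (sh \<tau> m)))"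
      by (simp add: sum_distrib_left)
  qed
  finally show ?thesis .
qed

text \<open>
  The inner products in \<open>\<complex>\<^sup>n\<close> of the fibre vectors of \<open>f\<close>
  and \<open>g\<close>, and of the derivative of the first with the second.
\<close>
definition S0 :: "(complex \<Rightarrow> complex) \<Rightarrow> (complex \<Rightarrow> complex) \<Rightarrow> real \<Rightarrow> complex" where
  "S0 f g \<tau> = (\<Sum>m<n. tr f (sh \<tau> m) * cnj (tr g (sh \<tau> m)))"

definition S1 :: "(complex \<Rightarrow> complex) \<Rightarrow> (complex \<Rightarrow> complex) \<Rightarrow> real \<Rightarrow> complex" where
  "S1 f g \<tau> = (\<Sum>m<n. tr' f (sh \<tau> m) * cnj (tr g (sh \<tau> m)))"

lemma sum_shift_periodic:
  fixes q :: "real \<Rightarrow> complex"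
  assumes "\<And>t. q (t + 2 * pi * n) = q t"
  shows "(\<Sum>m<n. q (sh (\<tau> + 2 * pi) m)) = (\<Sum>m<n. q (sh \<tau> m))"
proof -
  have "(\<Sum>m<n. q (sh (\<tau> + 2 * pi) m)) = (\<Sum>m<n. q (sh \<tau> (Suc m)))"
    by (rule sum.cong) (auto simp: algebra_simps)
  also have "\<dots> = (\<Sum>m<Suc n. q (sh \<tau> m)) - q (sh \<tau> 0)" by (simp add: sum.lessThan_Suc_shift del: sum.lessThan_Suc)
  also have "\<dots> = (\<Sum>m<n. q (sh \<tau> m))" using assms[of \<tau>] by simp
  finally show ?thesis .
qed

lemma beta'_period: "beta' (t + 2 * pi * n) = beta' t"
proof -
  have "cis (- (beta t + 2 * pi)) = cis (- beta t) * cnj (cis (2 * pi))" by (simp only: cis_cnj cis_mult) simp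
  hence "cis (- (beta t + 2 * pi)) = cis (- beta t)" by simp
  thus ?thesis unfolding beta'_def beta_period alpha'_def by simp
qed

lemma tr_period: "tr f (t + 2 * pi * n) = tr f t" "tr' f (t + 2 * pi * n) = tr' f t"
  by (simp_all add: tr_def tr'_def gam_period beta'_period)

lemma S_period: "S0 f g (\<tau> + 2 * pi) = S0 f g \<tau>" "S1 f g (\<tau> + 2 * pi) = S1 f g \<tau>"
  unfolding S0_def S1_def
  by (rule sum_shift_periodic[where q="\<lambda>t. tr f t * cnj (tr g t)"] sum_shift_periodic[where q="\<lambda>t. tr' f t * cnj (tr g t)"];
      simp add: tr_period)+

lemma sh_cont: "continuous_on UNIV (\<lambda>\<tau>. sh \<tau> m)"
  by (intro continuous_intros)

lemma S_cont:
  assumes f: "holo_past f" and g: "holo_past g"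
  shows "continuous_on UNIV (S0 f g)" "continuous_on UNIV (S1 f g)"
  unfolding S0_def[abs_def] S1_def[abs_def]
  by (intro continuous_intros continuous_on_compose2[OF tr_cont[OF f, of UNIV] sh_cont]
      continuous_on_compose2[OF tr_cont[OF g, of UNIV] sh_cont] continuous_on_compose2[OF tr'_cont[OF f, of UNIV] sh_cont]; simp)+

text \<open>
  On a whole fibre \<open>\<phi>\<close> has the same value \<open>kappa * cis \<tau>\<close>, so
  that its powers come out of the fibre sums; differentiating \<open>\<phi>\<^sup>k\<close>
  contributes the term with \<open>\<i> k\<close>.
\<close>
lemma inner_phi_powers:
  assumes f: "holo_past f" and g: "holo_past g"
  shows "((\<lambda>\<tau>. (kappa * cis \<tau>) ^ k * cnj (kappa * cis \<tau>) ^ l * (\<i> * of_nat k * S0 f g \<tau> + S1 f g \<tau>)) has_integral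
    2 * pi * \<i> * dirichlet_inner (on_disc (\<lambda>z. phi z ^ k * f z)) (on_disc (\<lambda>z. phi z ^ l * g z))) {0..2 * pi}"
proof -
  have cp: "cis (sh \<tau> m) = cis \<tau>" for \<tau> m
    by (simp add: cis_mult[symmetric] cis_multiple_2pi[of "real m"])
  have "tr' (\<lambda>z. phi z ^ k * f z) (sh \<tau> m) * cnj (tr (\<lambda>z. phi z ^ l * g z) (sh \<tau> m)) =
     (kappa * cis \<tau>) ^ k * cnj (kappa * cis \<tau>) ^ l * (\<i> * of_nat k * (tr f (sh \<tau> m) * cnj (tr g (sh \<tau> m))) + tr' f (sh \<tau> m) * cnj (tr g (sh \<tau> m)))" for \<tau> m
    unfolding tr'_phi_power[OF f] tr_phi_power cp by (simp only: complex_cnj_mult complex_cnj_power) (simp only: algebra_simps)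
  hence e: "(\<Sum>m<n. tr' (\<lambda>z. phi z ^ k * f z) (sh \<tau> m) * cnj (tr (\<lambda>z. phi z ^ l * g z) (sh \<tau> m))) =
     (kappa * cis \<tau>) ^ k * cnj (kappa * cis \<tau>) ^ l * (\<i> * of_nat k * S0 f g \<tau> + S1 f g \<tau>)" for \<tau>
    unfolding S0_def S1_def by (simp only: sum_distrib_left sum.distrib distrib_left)
  have "holo_past (\<lambda>z. phi z ^ k * f z)" "holo_past (\<lambda>z. phi z ^ l * g z)"
    by (intro holo_past_mult holo_past_power holo_past_phi f g)+
  from inner_eq_fibre_integral[OF this] show ?thesis unfolding e .
qed

lemma kappa_nz: "kappa \<noteq> 0" using kappa_norm by auto

text \<open>
  Raising both exponents by \<open>1\<close> changes the integrand of the previous lemma only by a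
  multiple of \<open>S0\<close>. Hence all Fourier coefficients of \<open>S0\<close> vanish, and
  then those of \<open>S1\<close>. Global orthogonality of all products with powers of
  \<open>\<phi>\<close> thus becomes orthogonality in every fibre, also for the derivative.
\<close>
lemma fibrewise_orthogonal:
  assumes f: "holo_past f" and g: "holo_past g"
    and orth: "\<And>k l. dirichlet_inner (on_disc (\<lambda>z. phi z ^ k * f z)) (on_disc (\<lambda>z. phi z ^ l * g z)) = 0"
  shows "S0 f g \<tau> = 0" "S1 f g \<tau> = 0"
proof -
  have I: "((\<lambda>\<tau>. cis \<tau> ^ k * cnj (cis \<tau>) ^ l * (\<i> * of_nat k * S0 f g \<tau> + S1 f g \<tau>)) has_integral 0) {0..2 * pi}" for k l
  proof -
    have "((\<lambda>\<tau>. inverse (kappa ^ k * cnj kappa ^ l) * ((kappa * cis \<tau>) ^ k * cnj (kappa * cis \<tau>) ^ l * (\<i> * of_nat k * S0 f g \<tau> + S1 f g \<tau>))) has_integral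
       inverse (kappa ^ k * cnj kappa ^ l) * 0) {0..2 * pi}"
      using has_integral_mult_right[OF inner_phi_powers[OF f g, of k l], of "inverse (kappa ^ k * cnj kappa ^ l)"]
      by (simp only: orth mult_zero_right)
    moreover have "inverse (kappa ^ k * cnj kappa ^ l) * ((kappa * cis \<tau>) ^ k * cnj (kappa * cis \<tau>) ^ l * X) = cis \<tau> ^ k * cnj (cis \<tau>) ^ l * X" for \<tau> X
      using kappa_nz by (simp only: complex_cnj_mult power_mult_distrib) (simp add: field_simps del: cis_cnj)
    ultimately show ?thesis by (simp only: mult_zero_right)
  qed
  have cc: "cis \<tau> * cnj (cis \<tau>) = 1" for \<tau> by (simp add: cis_cnj cis_mult)
  have I0: "((\<lambda>\<tau>. S0 f g \<tau> * cis \<tau> ^ k * cnj (cis \<tau>) ^ l) has_integral 0) {0..2 * pi}" for k l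
  proof -
    have "((\<lambda>\<tau>. (-\<i>) * (cis \<tau> ^ Suc k * cnj (cis \<tau>) ^ Suc l * (\<i> * of_nat (Suc k) * S0 f g \<tau> + S1 f g \<tau>)
         - cis \<tau> ^ k * cnj (cis \<tau>) ^ l * (\<i> * of_nat k * S0 f g \<tau> + S1 f g \<tau>))) has_integral (-\<i>) * (0 - 0)) {0..2 * pi}"
      by (intro has_integral_mult_right has_integral_diff I)
    moreover have "(-\<i>) * (cis \<tau> ^ Suc k * cnj (cis \<tau>) ^ Suc l * (\<i> * of_nat (Suc k) * S0 f g \<tau> + S1 f g \<tau>)
         - cis \<tau> ^ k * cnj (cis \<tau>) ^ l * (\<i> * of_nat k * S0 f g \<tau> + S1 f g \<tau>)) = S0 f g \<tau> * cis \<tau> ^ k * cnj (cis \<tau>) ^ l" for \<tau>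
    proof -
      have "cis \<tau> ^ Suc k * cnj (cis \<tau>) ^ Suc l = (cis \<tau> * cnj (cis \<tau>)) * (cis \<tau> ^ k * cnj (cis \<tau>) ^ l)"
        by (simp only: power_Suc mult_ac)
      also have "\<dots> = cis \<tau> ^ k * cnj (cis \<tau>) ^ l" unfolding cc by simp
      finally have e: "cis \<tau> ^ Suc k * cnj (cis \<tau>) ^ Suc l = cis \<tau> ^ k * cnj (cis \<tau>) ^ l" .
      show ?thesis unfolding e by (simp add: algebra_simps del: cis_cnj)
    qed
    ultimately show ?thesis by (simp only: diff_self mult_zero_right)
  qed
  have Z0: "S0 f g s = 0" if "s \<in> {0..2 * pi}" for s
    by (rule fourier_uniqueness[OF continuous_on_subset[OF S_cont(1)[OF f g]] I0 that]) simp
  have S0z: "S0 f g t = 0" for t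
    by (rule periodic_reduce[of "S0 f g" t, OF S_period(1)]) (simp add: Z0)
  have I1: "((\<lambda>\<tau>. S1 f g \<tau> * cis \<tau> ^ k * cnj (cis \<tau>) ^ l) has_integral 0) {0..2 * pi}" for k l
    using I[of k l] unfolding S0z mult_zero_right add_0 by (simp only: mult_ac)
  have Z1: "S1 f g s = 0" if "s \<in> {0..2 * pi}" for s
    by (rule fourier_uniqueness[OF continuous_on_subset[OF S_cont(2)[OF f g]] I1 that]) simp
  show "S0 f g \<tau> = 0" by (rule S0z)
  show "S1 f g \<tau> = 0"
    by (rule periodic_reduce[of "S1 f g" \<tau>, OF S_period(2)]) (simp add: Z1)
qed

lemma S0_self: "S0 h h \<tau> = of_real (\<Sum>m<n. (cmod (tr h (sh \<tau> m)))\<^sup>2)"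
  unfolding S0_def by (simp only: complex_norm_square of_real_sum)

lemma tr_eq_0_imp:
  assumes h: "holo_past h" and z: "\<And>\<tau>. tr h \<tau> = 0"
  shows "on_disc h = (\<lambda>z. 0)"
proof -
  have "((\<lambda>\<tau>. \<Sum>m<n. tr' h (sh \<tau> m) * cnj (tr h (sh \<tau> m))) has_integral
           2 * pi * \<i> * dirichlet_inner (on_disc h) (on_disc h)) {0..2 * pi}"
    by (rule inner_eq_fibre_integral[OF h h])
  hence "((\<lambda>\<tau>::real. 0) has_integral 2 * pi * \<i> * dirichlet_inner (on_disc h) (on_disc h)) {0..2 * pi}"
    unfolding z by simp
  hence "2 * pi * \<i> * dirichlet_inner (on_disc h) (on_disc h) = 0" by (rule has_integral_unique) simp
  hence "dirichlet_inner (on_disc h) (on_disc h) = 0" by simp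
  thus ?thesis using dirichlet.ip_definite on_disc_dirichlet[OF h] by blast
qed

text \<open>
  \<open>\<parallel>\<phi> h\<parallel>\<^sup>2 - \<parallel>h\<parallel>\<^sup>2\<close> is the
  mean of the squared length of the fibre vectors of \<open>h\<close>.
\<close>
lemma phi_expands:
  assumes h: "holo_past h"
  defines "A \<equiv> (dirichlet.nrm (on_disc (\<lambda>z. phi z * h z)))\<^sup>2" and "B \<equiv> (dirichlet.nrm (on_disc h))\<^sup>2"
  shows "B \<le> A" "A = B \<Longrightarrow> on_disc h = (\<lambda>z. 0)"
proof -
  have hp: "holo_past (\<lambda>z. phi z * h z)" by (intro holo_past_mult holo_past_phi h)
  have dA: "dirichlet_inner (on_disc (\<lambda>z. phi z * h z)) (on_disc (\<lambda>z. phi z * h z)) = of_real A"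
    unfolding A_def by (rule dirichlet.ip_self[OF on_disc_dirichlet[OF hp]])
  have dB: "dirichlet_inner (on_disc h) (on_disc h) = of_real B"
    unfolding B_def by (rule dirichlet.ip_self[OF on_disc_dirichlet[OF h]])
  have kc: "kappa * cis \<tau> * cnj (kappa * cis \<tau>) = 1" for \<tau>
    by (simp only: complex_norm_square[symmetric] norm_mult kappa_norm norm_cis) simp
  \<comment> \<open>The formula for \<open>k = l = 1\<close> minus the formula for \<open>k = l = 0\<close>.\<close>
  have "((\<lambda>\<tau>. (kappa * cis \<tau>) ^ 1 * cnj (kappa * cis \<tau>) ^ 1 * (\<i> * of_nat 1 * S0 h h \<tau> + S1 h h \<tau>)
       - (kappa * cis \<tau>) ^ 0 * cnj (kappa * cis \<tau>) ^ 0 * (\<i> * of_nat 0 * S0 h h \<tau> + S1 h h \<tau>)) has_integral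
       2 * pi * \<i> * of_real A - 2 * pi * \<i> * of_real B) {0..2 * pi}"
    using has_integral_diff[OF inner_phi_powers[OF h h, of 1 1] inner_phi_powers[OF h h, of 0 0]]
    by (simp only: power_one_right power_0 mult_1 dA dB)
  hence "((\<lambda>\<tau>. \<i> * S0 h h \<tau>) has_integral 2 * pi * \<i> * of_real A - 2 * pi * \<i> * of_real B) {0..2 * pi}"
    by (simp only: power_one_right power_0 kc mult_1 of_nat_0 of_nat_1 mult_zero_right mult_zero_left mult_1_right add_0 add_diff_cancel)
  from has_integral_mult_right[OF this, of "-\<i>"]
  have "((\<lambda>\<tau>. S0 h h \<tau>) has_integral of_real (2 * pi * (A - B))) {0..2 * pi}"
    by (simp add: algebra_simps)
  from has_integral_linear[OF this bounded_linear_Re]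
  have I: "((\<lambda>\<tau>. Re (S0 h h \<tau>)) has_integral 2 * pi * (A - B)) {0..2 * pi}" by (simp add: o_def)
  have nn: "0 \<le> Re (S0 h h \<tau>)" for \<tau> unfolding S0_self by (simp add: sum_nonneg)
  have "0 \<le> 2 * pi * (A - B)" by (rule has_integral_nonneg[OF I]) (rule nn)
  moreover have "\<not> pi \<le> 0" using pi_gt_zero by linarith
  ultimately show "B \<le> A" by (simp add: zero_le_mult_iff)
  assume "A = B"
  hence "((\<lambda>\<tau>. Re (S0 h h \<tau>)) has_integral 0) {0..2 * pi}" using I by simp
  moreover have c: "continuous_on {0..2 * pi} (\<lambda>\<tau>. Re (S0 h h \<tau>))"
    by (intro continuous_intros continuous_on_subset[OF S_cont(1)[OF h h]]) simp
  ultimately have Zs: "Re (S0 h h s) = 0" if "s \<in> {0..2 * pi}" for s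
    using has_integral_0_cbox_imp_0[of 0 "2 * pi" "\<lambda>\<tau>. Re (S0 h h \<tau>)" s] nn that by (simp add: not_le)
  have Z: "Re (S0 h h t) = 0" for t
    by (rule periodic_reduce[of "S0 h h" t, OF S_period(1)]) (simp add: Zs)
  have "tr h t = 0" for t
  proof -
    have "(\<Sum>m<n. (cmod (tr h (sh t m)))\<^sup>2) = 0" using Z[of t] unfolding S0_self by simp
    hence "\<forall>m\<in>{..<n}. (cmod (tr h (sh t m)))\<^sup>2 = 0" by (subst (asm) sum_nonneg_eq_0_iff) auto
    from bspec[OF this, of 0] n have "(cmod (tr h (sh t 0)))\<^sup>2 = 0" by simp
    thus ?thesis by simp
  qed
  thus "on_disc h = (\<lambda>z. 0)" by (rule tr_eq_0_imp[OF h])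
qed

end

section \<open>Projections onto reducing subspaces act on fibres by constants\<close>

context finite_blaschke
begin

definition reduces :: "(complex \<Rightarrow> complex) set \<Rightarrow> bool" where
  "reduces M \<longleftrightarrow> dirichlet.closed_sub M \<and> (\<forall>f\<in>M. mult_op phi f \<in> M) \<and> (\<forall>f\<in>M. dirichlet_adjoint (mult_op phi) f \<in> M)"

lemma reducesD:
  assumes "reduces M"
  shows "dirichlet.closed_sub M" "f \<in> M \<Longrightarrow> mult_op phi f \<in> M" "f \<in> M \<Longrightarrow> f \<in> dirichlet_space"
  using assms unfolding reduces_def by (auto dest: dirichlet.closed_subD)

lemma orthogonal_invariant:
  assumes M: "reduces M" and g: "g \<in> dirichlet_space" "\<And>y. y \<in> M \<Longrightarrow> dirichlet_inner g y = 0" and y: "y \<in> M"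
  shows "dirichlet_inner (mult_op phi g) y = 0"
proof -
  obtain R where R: "R > 1" "phi holomorphic_on ball 0 R" using holo_past_phi unfolding holo_past_def by blast
  have "dirichlet_inner (mult_op phi g) y = dirichlet_inner g (dirichlet_adjoint (mult_op phi) y)"
    by (rule dirichlet_adjoint(2)[OF R(2,1) reducesD(3)[OF M y] g(1)])
  also have "\<dots> = 0" using M y unfolding reduces_def by (intro g(2)) blast
  finally show ?thesis .
qed

lemma mult_phi_in: "f \<in> dirichlet_space \<Longrightarrow> mult_op phi f \<in> dirichlet_space"
  by (rule mult_op_dirichlet[OF holo_past_phi])

lemma proj_mult_phi:
  assumes M: "reduces M" and f: "f \<in> dirichlet_space"
  shows "dirichlet.proj M (mult_op phi f) = mult_op phi (dirichlet.proj M f)"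
proof (rule dirichlet.proj_unique[OF reducesD(1)[OF M] mult_phi_in[OF f]])
  note P = dirichlet.proj_in[OF reducesD(1)[OF M] f]
  show "mult_op phi (dirichlet.proj M f) \<in> M" by (rule reducesD(2)[OF M P])
  fix y assume y: "y \<in> M"
  have e: "(\<lambda>x. mult_op phi f x - mult_op phi (dirichlet.proj M f) x) = mult_op phi (\<lambda>x. f x - dirichlet.proj M f x)"
    by (auto simp: mult_op_def algebra_simps)
  show "dirichlet_inner (\<lambda>x. mult_op phi f x - mult_op phi (dirichlet.proj M f) x) y = 0"
    unfolding e
    by (rule orthogonal_invariant[OF M _ _ y])
       (use dirichlet.diff[OF f reducesD(3)[OF M P]] dirichlet.proj_orth[OF reducesD(1)[OF M] f] in auto)
qed

lemma reducing_orthogonal_fibres: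
  assumes M: "reduces M" and f: "holo_past f" "on_disc f \<in> M"
    and g: "holo_past g" "\<And>y. y \<in> M \<Longrightarrow> dirichlet_inner (on_disc g) y = 0"
  shows "S0 f g \<tau> = 0" "S1 f g \<tau> = 0" "S0 g f \<tau> = 0" "S1 g f \<tau> = 0"
proof -
  have fM: "on_disc (\<lambda>z. phi z ^ k * f z) \<in> M" for k
  proof (induction k)
    case (Suc k)
    have "on_disc (\<lambda>z. phi z ^ Suc k * f z) = mult_op phi (on_disc (\<lambda>z. phi z ^ k * f z))"
      unfolding on_disc_mult_op[symmetric] by (simp add: mult.assoc)
    thus ?case using reducesD(2)[OF M Suc] by simp
  qed (use f in simp)
  have gM: "on_disc (\<lambda>z. phi z ^ k * g z) \<in> dirichlet_space \<and> (\<forall>y\<in>M. dirichlet_inner (on_disc (\<lambda>z. phi z ^ k * g z)) y = 0)" for k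
  proof (induction k)
    case (Suc k)
    have "on_disc (\<lambda>z. phi z ^ Suc k * g z) = mult_op phi (on_disc (\<lambda>z. phi z ^ k * g z))"
      unfolding on_disc_mult_op[symmetric] by (simp add: mult.assoc)
    thus ?case using Suc orthogonal_invariant[OF M] mult_phi_in by auto
  qed (use g on_disc_dirichlet in auto)
  have 1: "dirichlet_inner (on_disc (\<lambda>z. phi z ^ l * g z)) (on_disc (\<lambda>z. phi z ^ k * f z)) = 0" for k l
    using gM[of l] fM[of k] by blast
  have 2: "dirichlet_inner (on_disc (\<lambda>z. phi z ^ k * f z)) (on_disc (\<lambda>z. phi z ^ l * g z)) = 0" for k l
    using dirichlet.ip_cnj[of "on_disc (\<lambda>z. phi z ^ l * g z)" "on_disc (\<lambda>z. phi z ^ k * f z)"] gM[of l] reducesD(3)[OF M fM[of k]] 1[of l k] by simp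
  show "S0 f g \<tau> = 0" "S1 f g \<tau> = 0" by (rule fibrewise_orthogonal[OF f(1) g(1) 2])+
  show "S0 g f \<tau> = 0" "S1 g f \<tau> = 0" by (rule fibrewise_orthogonal[OF g(1) f(1) 1])+
qed

end

text \<open>
  The kernels at the \<open>n\<close> points of a generic fibre \<open>\<phi> = l\<close> in the
  disc. The values \<open>w i\<close> for \<open>i \<ge> n\<close> are arbitrary points of the
  disc.
\<close>
locale fibre_kernels = finite_blaschke +
  fixes w :: "nat \<Rightarrow> complex" and l :: complex
  assumes w: "\<And>i. cmod (w i) < 1" and w_inj: "inj_on w {..<n}" and w_phi: "\<And>i. i < n \<Longrightarrow> phi (w i) = l"
begin

text \<open>
  The combinations of these kernels are exactly the functions annihilated by the adjoint of
  multiplication by \<open>\<phi> - l\<close>.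
\<close>
definition X :: "(nat \<Rightarrow> complex) \<Rightarrow> complex \<Rightarrow> complex" where
  "X v z = (\<Sum>i<n. v i * dkernel (w i) z)"

lemma holo_past_X: "holo_past (X v)"
  unfolding X_def[abs_def] by (intro holo_past_sum holo_past_mult holo_past_const holo_past_dkernel w)

lemma X_in: "on_disc (X v) \<in> dirichlet_space"
  by (rule on_disc_dirichlet[OF holo_past_X])

lemma on_disc_X: "on_disc (X v) = (\<lambda>z. \<Sum>i<n. v i * on_disc (dkernel (w i)) z)"
  by (auto simp: on_disc_def X_def)

lemma inner_X:
  assumes f: "f \<in> dirichlet_space"
  shows "dirichlet_inner f (on_disc (X v)) = (\<Sum>i<n. cnj (v i) * f (w i))"
  unfolding on_disc_X using dirichlet.ip_sum_right[of "{..<n}" "\<lambda>i. on_disc (dkernel (w i))" f v] f w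
  by (simp add: dkernel_in dkernel_reproduces)

lemma X_lin: "X (\<lambda>i. u i - v i) z = X u z - X v z"
  by (simp add: X_def left_diff_distrib sum_subtractf)

lemma on_disc_X_diff: "on_disc (X (\<lambda>i. u i - v i)) = (\<lambda>z. on_disc (X u) z - on_disc (X v) z)"
  by (auto simp: on_disc_def X_lin)

text \<open>
  Test against the Lagrange polynomial that vanishes at all nodes except \<open>w i\<close>.
\<close>
lemma X_zero_imp:
  assumes z: "on_disc (X v) = (\<lambda>z. 0)" and i: "i < n"
  shows "v i = 0"
proof -
  define q where "q z = (\<Prod>j\<in>{..<n} - {i}. z - w j)" for z
  have q: "holo_past q" unfolding q_def[abs_def] by (intro holo_past_prod holo_past_diff holo_past_id holo_past_const)
  have qw: "on_disc q (w j) = (if j = i then q (w i) else 0)" if "j < n" for j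
    using w[of j] that by (auto simp: on_disc_def q_def)
  have "0 = dirichlet_inner (on_disc q) (on_disc (X v))"
    unfolding z using dirichlet.ip_zero_right[OF on_disc_dirichlet[OF q]] by simp
  also have "\<dots> = (\<Sum>j<n. cnj (v j) * on_disc q (w j))" by (rule inner_X[OF on_disc_dirichlet[OF q]])
  also have "\<dots> = (\<Sum>j<n. if j = i then cnj (v i) * q (w i) else 0)" using qw by (intro sum.cong) auto
  also have "\<dots> = cnj (v i) * q (w i)" using i by simp
  finally have "cnj (v i) * q (w i) = 0" by simp
  moreover have "q (w i) \<noteq> 0" unfolding q_def using w_inj i by (auto simp: inj_on_def)
  ultimately show ?thesis by simp
qed

lemma X_eqI:
  assumes "on_disc (X u) = on_disc (X v)" shows "X u = X v"
proof -
  have "on_disc (X (\<lambda>i. u i - v i)) = (\<lambda>z. 0)" unfolding on_disc_X_diff assms by simp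
  from X_zero_imp[OF this] have "\<And>i. i < n \<Longrightarrow> u i = v i" by simp
  thus ?thesis by (auto simp: X_def fun_eq_iff)
qed

text \<open>
  A combination of the kernels that vanishes at all nodes is orthogonal to itself.
\<close>
lemma gram_solvable: "\<exists>v. \<forall>i<n. on_disc (X v) (w i) = e i"
proof -
  have "\<exists>v. \<forall>i<n. (\<Sum>j<n. on_disc (dkernel (w j)) (w i) * v j) = e i"
  proof (rule injective_system_solvable)
    fix v j assume h: "\<And>i. i < n \<Longrightarrow> (\<Sum>j<n. on_disc (dkernel (w j)) (w i) * v j) = 0" and j: "j < n"
    have "on_disc (X v) (w i) = 0" if "i < n" for i using h[OF that] unfolding on_disc_X by (simp add: mult.commute)
    hence "dirichlet_inner (on_disc (X v)) (on_disc (X v)) = 0" unfolding inner_X[OF X_in] by simp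
    hence "on_disc (X v) = (\<lambda>z. 0)" by (rule dirichlet.ip_definite[OF X_in])
    thus "v j = 0" using X_zero_imp j by blast
  qed
  thus ?thesis unfolding on_disc_X by (simp add: mult.commute)
qed

lemma l_norm: "cmod l < 1"
  using w_phi[of 0] phi_disc[OF w[of 0]] n by simp

lemma fibre_set: "finite (w ` {..<n})" "card (w ` {..<n}) = n" "\<And>z. z \<in> w ` {..<n} \<Longrightarrow> cmod z \<le> 1 \<and> phi z = l"
  using w w_phi card_image[OF w_inj] by (auto simp: less_imp_le)

lemma dirichlet_divide_fibre:
  assumes s: "s \<in> dirichlet_space" "\<And>i. i < n \<Longrightarrow> s (w i) = 0"
  shows "\<exists>g\<in>dirichlet_space. s = mult_op (\<lambda>z. phi z - l) g"
proof -
  obtain k where k: "k \<noteq> 0" "\<And>z. poly (fib l) z = k * (\<Prod>a\<in>w ` {..<n}. z - a)"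
    using fib_factor[OF less_imp_le[OF l_norm] fibre_set] by metis
  obtain h where h: "h \<in> dirichlet_space" "\<And>z. s z = (\<Prod>a\<in>w ` {..<n}. z - a) * h z"
    using dirichlet_divide_roots[OF fibre_set(1), of s] s w by auto
  have d: "holo_past (\<lambda>z. poly den z / k)" by (rule holo_pastI[of _ 2]) (auto intro!: holomorphic_intros simp: k)
  define g where "g = mult_op (\<lambda>z. poly den z / k) h"
  have g: "g \<in> dirichlet_space" unfolding g_def by (rule mult_op_dirichlet[OF d h(1)])
  have "s z = mult_op (\<lambda>z. phi z - l) g z" for z
  proof (cases "cmod z < 1")
    case True
    hence dz: "poly den z \<noteq> 0" by (intro den_nonzero) simp
    hence "phi z - l = poly (fib l) z / poly den z" by (simp add: phi_eq fib_def field_simps)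
    thus ?thesis using h(2)[of z] k dz by (simp add: g_def mult_op_def)
  next
    case False
    thus ?thesis using dirichlet_spaceD(2)[OF s(1)] dirichlet_spaceD(2)[OF g] by (simp add: mult_op_def)
  qed
  thus ?thesis using g by (intro bexI[of _ g]) auto
qed

lemma holo_past_phi_l: "holo_past (\<lambda>z. phi z - l)"
  by (intro holo_past_diff holo_past_phi holo_past_const)

text \<open>
  Subtract the combination with the same values at the nodes. The difference is divisible by
  \<open>\<phi> - l\<close>, hence orthogonal to \<open>h\<close> and to all combinations, in
  particular to itself.
\<close>
lemma annihilated_imp_X:
  assumes h: "h \<in> dirichlet_space" "\<And>g. g \<in> dirichlet_space \<Longrightarrow> dirichlet_inner (mult_op (\<lambda>z. phi z - l) g) h = 0"
  shows "\<exists>v. h = on_disc (X v)"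
proof -
  obtain v where v: "\<And>i. i < n \<Longrightarrow> on_disc (X v) (w i) = h (w i)" using gram_solvable[of "\<lambda>i. h (w i)"] by blast
  define s where "s = (\<lambda>z. h z - on_disc (X v) z)"
  have s: "s \<in> dirichlet_space" unfolding s_def by (rule dirichlet.diff[OF h(1) X_in])
  have "s (w i) = 0" if "i < n" for i using v[OF that] by (simp add: s_def)
  then obtain g where g: "g \<in> dirichlet_space" "s = mult_op (\<lambda>z. phi z - l) g" using dirichlet_divide_fibre[OF s] by blast
  have gD: "mult_op (\<lambda>z. phi z - l) g \<in> dirichlet_space" using s g by simp
  have "dirichlet_inner s s = dirichlet_inner (mult_op (\<lambda>z. phi z - l) g) (\<lambda>z. h z - on_disc (X v) z)"
    unfolding g(2)[symmetric] s_def[symmetric] ..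
  also have "\<dots> = dirichlet_inner (mult_op (\<lambda>z. phi z - l) g) h - dirichlet_inner (mult_op (\<lambda>z. phi z - l) g) (on_disc (X v))"
    by (rule dirichlet.ip_diff_right[OF h(1) X_in gD])
  also have "\<dots> = 0" unfolding h(2)[OF g(1)] inner_X[OF gD] by (simp add: mult_op_def w_phi)
  finally have "s = (\<lambda>z. 0)" by (rule dirichlet.ip_definite[OF s])
  thus ?thesis by (intro exI[of _ v]) (auto simp: s_def fun_eq_iff)
qed

text \<open>
  If \<open>X v\<close> vanishes on the boundary fibre over \<open>\<mu>\<close>, then \<open>X v
  = (\<phi> - \<mu>) g\<close>; as it is orthogonal to \<open>(\<phi> - l) g\<close>, the numbers
  \<open>A = \<parallel>\<phi> g\<parallel>\<^sup>2\<close>, \<open>B =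
  \<parallel>g\<parallel>\<^sup>2\<close> and \<open>x = cnj \<mu> \<langle>\<phi> g,
  g\<rangle>\<close> satisfy \<open>A - x = l cnj \<mu> (cnj x - B)\<close>. Here \<open>\<bar>l
  cnj \<mu>\<bar> < 1\<close> forces \<open>A = B\<close>, and since multiplication by
  \<open>\<phi>\<close> strictly increases the norm of nonzero functions, \<open>g = 0\<close>.
  Consequently the combinations attain all vectors over every boundary fibre.
\<close>
lemma X_zero_on_fibre_imp:
  assumes z: "\<And>m. m < n \<Longrightarrow> tr (X v) (sh \<tau> m) = 0"
  shows "on_disc (X v) = (\<lambda>z. 0)"
proof -
  define \<mu> where "\<mu> = kappa * cis \<tau>"
  have mu: "cmod \<mu> = 1" by (simp add: \<mu>_def norm_mult kappa_norm)
  define A where "A = (\<lambda>m. gam (sh \<tau> m)) ` {..<n}"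
  have A: "finite A" "card A = n" "\<And>z. z \<in> A \<Longrightarrow> cmod z \<le> 1 \<and> phi z = \<mu>"
    using card_image[OF gam_shift_inj[of \<tau>]] by (auto simp: A_def gam_norm phi_gam_shift \<mu>_def)
  obtain R1 where R1: "R1 > 1" "X v holomorphic_on ball 0 R1" using holo_past_X unfolding holo_past_def by blast
  obtain R2 where R2: "R2 > 1" "\<forall>z\<in>ball 0 R2. poly den z \<noteq> 0" using den_nonzero_past by blast
  define R where "R = min R1 R2"
  have R: "R > 1" using R1 R2 by (simp add: R_def)
  have XA: "X v u = 0" if u: "u \<in> A" for u
  proof -
    obtain m where m: "m < n" "u = gam (sh \<tau> m)" using u by (auto simp: A_def)
    have "gam (sh \<tau> m) \<noteq> 0" using gam_norm[of "sh \<tau> m"] by auto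
    thus ?thesis using z[OF m(1)] m(2) by (simp add: tr_def)
  qed
  have "\<exists>g. g holomorphic_on ball 0 R \<and> (\<forall>z\<in>ball 0 R. X v z = (phi z - \<mu>) * g z)"
  proof (rule divide_by_fibre[OF _ A])
    show "X v holomorphic_on ball 0 R" using R1(2) by (rule holomorphic_on_subset) (auto simp: R_def)
    show "A \<subseteq> ball 0 R" using R by (auto simp: A_def gam_norm)
  qed (use mu XA R2 in \<open>auto simp: R_def\<close>)
  then obtain g where g: "g holomorphic_on ball 0 R" "\<And>z. z \<in> ball 0 R \<Longrightarrow> X v z = (phi z - \<mu>) * g z" by blast
  have gp: "holo_past g" by (rule holo_pastI[OF g(1) R])
  define G where "G = on_disc g"
  have G: "G \<in> dirichlet_space" unfolding G_def by (rule on_disc_dirichlet[OF gp])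
  define F where "F = mult_op phi G"
  have F: "F \<in> dirichlet_space" unfolding F_def by (rule mult_phi_in[OF G])
  have XG: "on_disc (X v) = (\<lambda>z. F z - \<mu> * G z)"
    using g(2) R by (auto simp: fun_eq_iff on_disc_def F_def G_def mult_op_def algebra_simps)
  have "dirichlet_inner (\<lambda>z. F z - l * G z) (on_disc (X v)) = 0"
    using inner_X[OF dirichlet.diff[OF F dirichlet.scale[OF G]], of l v] w_phi by (simp add: F_def mult_op_def)
  hence eq: "dirichlet_inner (\<lambda>z. F z - l * G z) (\<lambda>z. F z - \<mu> * G z) = 0" unfolding XG .
  define Ad Bd where "Ad = (dirichlet.nrm F)\<^sup>2" and "Bd = (dirichlet.nrm G)\<^sup>2"
  define x where "x = cnj \<mu> * dirichlet_inner F G"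
  have mm: "\<mu> * cnj \<mu> = 1" using mu by (simp add: complex_norm_square[symmetric])
  have "dirichlet_inner (\<lambda>z. F z - l * G z) (\<lambda>z. F z - \<mu> * G z)
      = of_real Ad - cnj \<mu> * dirichlet_inner F G - l * cnj (dirichlet_inner F G) + l * cnj \<mu> * of_real Bd"
    using F G dirichlet.ip_cnj[OF F G]
    by (simp add: dirichlet.ip_simps dirichlet.ip_self[OF F] dirichlet.ip_self[OF G] Ad_def Bd_def algebra_simps)
  also have "l * cnj (dirichlet_inner F G) = l * cnj \<mu> * cnj x"
  proof -
    have cx: "cnj x = \<mu> * cnj (dirichlet_inner F G)" by (simp add: x_def)
    have "l * cnj \<mu> * cnj x = l * (\<mu> * cnj \<mu>) * cnj (dirichlet_inner F G)"
      unfolding cx by (simp only: mult_ac)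
    thus ?thesis unfolding mm by (simp only: mult_1_right)
  qed
  finally have e: "of_real Ad - x = (l * cnj \<mu>) * (cnj x - of_real Bd)"
    unfolding eq x_def[symmetric] by (simp add: algebra_simps)
  have FA: "F = on_disc (\<lambda>z. phi z * g z)" unfolding F_def G_def on_disc_mult_op ..
  have ex: "Bd \<le> Ad" "Ad = Bd \<Longrightarrow> G = (\<lambda>z. 0)"
    using phi_expands[OF gp] unfolding FA[symmetric] G_def[symmetric] Ad_def Bd_def by auto
  have "Ad = Bd"
  proof (rule equal_distance_imp[OF ex(1) _ _ _ e])
    show "0 \<le> Bd" by (simp add: Bd_def)
    have "cmod x \<le> dirichlet.nrm F * dirichlet.nrm G"
      unfolding x_def norm_mult using dirichlet.cauchy_schwarz[OF F G] mu by simp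
    hence "(cmod x)\<^sup>2 \<le> (dirichlet.nrm F * dirichlet.nrm G)\<^sup>2" by (intro power_mono) auto
    thus "(cmod x)\<^sup>2 \<le> Ad * Bd" by (simp add: Ad_def Bd_def power_mult_distrib)
    show "cmod (l * cnj \<mu>) < 1" using l_norm mu by (simp add: norm_mult)
  qed
  hence "G = (\<lambda>z. 0)" by (rule ex(2))
  thus ?thesis unfolding XG F_def by (auto simp: mult_op_def)
qed

lemma tr_X: "tr (X v) \<tau> = (\<Sum>i<n. v i * tr (dkernel (w i)) \<tau>)"
  by (simp add: tr_def X_def sum_distrib_left mult_ac)

lemma tr'_X: "tr' (X v) \<tau> = (\<Sum>i<n. v i * tr' (dkernel (w i)) \<tau>)"
proof -
  have "(tr (X v) has_vector_derivative (\<Sum>i<n. v i * tr' (dkernel (w i)) \<tau>)) (at \<tau>)"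
    unfolding tr_X[abs_def]
    by (intro has_vector_derivative_sum has_vector_derivative_mult_right tr_deriv holo_past_dkernel w)
  from vector_derivative_unique_at[OF tr_deriv[OF holo_past_X] this] show ?thesis .
qed

lemma tr_X_diff: "tr (X (\<lambda>i. u i - v i)) \<tau> = tr (X u) \<tau> - tr (X v) \<tau>" "tr' (X (\<lambda>i. u i - v i)) \<tau> = tr' (X u) \<tau> - tr' (X v) \<tau>"
  by (simp_all add: tr_X tr'_X left_diff_distrib sum_subtractf)

lemma fibre_values_solvable: "\<exists>v. \<forall>m<n. tr (X v) (sh \<tau> m) = e m"
proof -
  have "\<exists>v. \<forall>m<n. (\<Sum>i<n. tr (dkernel (w i)) (sh \<tau> m) * v i) = e m"
  proof (rule injective_system_solvable)
    fix v j assume h: "\<And>m. m < n \<Longrightarrow> (\<Sum>i<n. tr (dkernel (w i)) (sh \<tau> m) * v i) = 0" and j: "j < n"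
    have "on_disc (X v) = (\<lambda>z. 0)"
      by (rule X_zero_on_fibre_imp[of v \<tau>]) (use h in \<open>simp add: tr_X mult.commute\<close>)
    thus "v j = 0" using X_zero_imp j by blast
  qed
  thus ?thesis unfolding tr_X by (simp add: mult.commute)
qed

text \<open>
  The projection commutes with multiplication by \<open>\<phi>\<close> and therefore preserves the
  functions annihilated by the adjoint of multiplication by \<open>\<phi> - l\<close>.
\<close>
lemma proj_X_is_X:
  assumes M: "reduces M"
  shows "\<exists>v'. dirichlet.proj M (on_disc (X v)) = on_disc (X v')"
proof (rule annihilated_imp_X)
  note cl = reducesD(1)[OF M]
  show "dirichlet.proj M (on_disc (X v)) \<in> dirichlet_space" by (rule dirichlet.proj_H[OF cl X_in])
  fix g assume g: "g \<in> dirichlet_space"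
  have Pg: "dirichlet.proj M g \<in> dirichlet_space" by (rule dirichlet.proj_H[OF cl g])
  have e: "mult_op (\<lambda>z. phi z - l) f = (\<lambda>z. mult_op phi f z + (-l) * f z)" for f by (auto simp: mult_op_def algebra_simps)
  have "dirichlet_inner (mult_op (\<lambda>z. phi z - l) g) (dirichlet.proj M (on_disc (X v)))
     = dirichlet_inner (dirichlet.proj M (mult_op (\<lambda>z. phi z - l) g)) (on_disc (X v))"
    by (rule dirichlet.proj_self_adjoint[OF cl mult_op_dirichlet[OF holo_past_phi_l g] X_in, symmetric])
  also have "dirichlet.proj M (mult_op (\<lambda>z. phi z - l) g) = mult_op (\<lambda>z. phi z - l) (dirichlet.proj M g)"
    unfolding e dirichlet.proj_lin[OF cl mult_phi_in[OF g] g] proj_mult_phi[OF M g] ..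
  also have "dirichlet_inner (mult_op (\<lambda>z. phi z - l) (dirichlet.proj M g)) (on_disc (X v)) = 0"
    unfolding inner_X[OF mult_op_dirichlet[OF holo_past_phi_l Pg]] by (simp add: mult_op_def w_phi)
  finally show "dirichlet_inner (mult_op (\<lambda>z. phi z - l) g) (dirichlet.proj M (on_disc (X v))) = 0" .
qed

definition proj_coeffs :: "(complex \<Rightarrow> complex) set \<Rightarrow> (nat \<Rightarrow> complex) \<Rightarrow> (nat \<Rightarrow> complex)" where
  "proj_coeffs M v = (SOME v'. dirichlet.proj M (on_disc (X v)) = on_disc (X v'))"

lemma proj_coeffs: "reduces M \<Longrightarrow> dirichlet.proj M (on_disc (X v)) = on_disc (X (proj_coeffs M v))"
  unfolding proj_coeffs_def using someI_ex[OF proj_X_is_X] .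

lemma proj_coeffs_parts:
  assumes M: "reduces M"
  shows "on_disc (X (proj_coeffs M v)) \<in> M" "y \<in> M \<Longrightarrow> dirichlet_inner (on_disc (X (\<lambda>i. v i - proj_coeffs M v i))) y = 0"
  using dirichlet.proj_in[OF reducesD(1)[OF M] X_in, of v] dirichlet.proj_orth[OF reducesD(1)[OF M] X_in, of y v]
  unfolding proj_coeffs[OF M] on_disc_X_diff by auto

lemma proj_coeffs_orth:
  assumes M: "reduces M"
  defines "Q \<equiv> \<lambda>v i. v i - proj_coeffs M v i"
  shows "S0 (X (proj_coeffs M u)) (X (Q v)) \<tau> = 0" "S1 (X (proj_coeffs M u)) (X (Q v)) \<tau> = 0"
    "S0 (X (Q v)) (X (proj_coeffs M u)) \<tau> = 0" "S1 (X (Q v)) (X (proj_coeffs M u)) \<tau> = 0"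
  unfolding Q_def
  using reducing_orthogonal_fibres[OF M holo_past_X proj_coeffs_parts(1)[OF M] holo_past_X proj_coeffs_parts(2)[OF M]] by blast+

text \<open>
  At a fixed \<open>\<tau>\<close>, the vectors of the combinations in \<open>M\<close> and of
  those orthogonal to \<open>M\<close> are orthogonal and together fill
  \<open>\<complex>\<^sup>n\<close>, so that the projection acts on fibre vectors as an orthogonal
  projection. The derivatives of the vectors of combinations in \<open>M\<close> are still
  orthogonal to the second family, and vice versa; hence they split in the same way, and the
  fibrewise action, of which \<open>p\<close> is the first row, is compatible with
  differentiation.
\<close>
lemma symbol_respects_derivative:
  assumes M: "reduces M" and p: "\<And>v. (\<Sum>m<n. p m * tr (X v) (sh \<tau> m)) = tr (X (proj_coeffs M v)) \<tau>"
  shows "(\<Sum>m<n. p m * tr' (X v) (sh \<tau> m)) = tr' (X (proj_coeffs M v)) \<tau>"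
proof -
  define Q where "Q = (\<lambda>v i. v i - proj_coeffs M v i)"
  \<comment> \<open>The combination whose fibre vector at \<open>\<tau>\<close> is the derivative of that of \<open>X v\<close>; the vector \<open>d\<close> measures the failure of the claim.\<close>
  obtain y where y: "\<And>m. m < n \<Longrightarrow> tr (X y) (sh \<tau> m) = tr' (X v) (sh \<tau> m)"
    using fibre_values_solvable[where e="\<lambda>m. tr' (X v) (sh \<tau> m)" and \<tau>=\<tau>] by blast
  define d where "d m = tr (X (proj_coeffs M y)) (sh \<tau> m) - tr' (X (proj_coeffs M v)) (sh \<tau> m)" for m
  have d2: "d m = tr' (X (Q v)) (sh \<tau> m) - tr (X (Q y)) (sh \<tau> m)" if "m < n" for m
    unfolding d_def Q_def tr_X_diff y[OF that] by simp
  \<comment> \<open>Both parts of this combination are orthogonal to \<open>d\<close>, so that \<open>d\<close> is orthogonal to itself.\<close>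
  obtain z where z: "\<And>m. m < n \<Longrightarrow> tr (X z) (sh \<tau> m) = d m"
    using fibre_values_solvable[where e=d and \<tau>=\<tau>] by blast
  have 1: "(\<Sum>m<n. d m * cnj (tr (X (Q z)) (sh \<tau> m))) = 0"
  proof -
    have "(\<Sum>m<n. d m * cnj (tr (X (Q z)) (sh \<tau> m))) = S0 (X (proj_coeffs M y)) (X (Q z)) \<tau> - S1 (X (proj_coeffs M v)) (X (Q z)) \<tau>"
      unfolding S0_def S1_def d_def by (simp only: left_diff_distrib sum_subtractf)
    thus ?thesis unfolding Q_def proj_coeffs_orth[OF M] by simp
  qed
  have 2: "(\<Sum>m<n. d m * cnj (tr (X (proj_coeffs M z)) (sh \<tau> m))) = 0"
  proof -
    have "(\<Sum>m<n. d m * cnj (tr (X (proj_coeffs M z)) (sh \<tau> m))) = (\<Sum>m<n. (tr' (X (Q v)) (sh \<tau> m) - tr (X (Q y)) (sh \<tau> m)) * cnj (tr (X (proj_coeffs M z)) (sh \<tau> m)))"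
      by (rule sum.cong) (simp_all add: d2)
    also have "\<dots> = S1 (X (Q v)) (X (proj_coeffs M z)) \<tau> - S0 (X (Q y)) (X (proj_coeffs M z)) \<tau>"
      unfolding S0_def S1_def by (simp only: left_diff_distrib sum_subtractf)
    finally show ?thesis unfolding Q_def proj_coeffs_orth[OF M] by simp
  qed
  have "(\<Sum>m<n. of_real ((cmod (d m))\<^sup>2)) = (\<Sum>m<n. d m * cnj (tr (X z) (sh \<tau> m)))"
    by (rule sum.cong) (simp_all only: z complex_norm_square lessThan_iff)
  also have "\<dots> = (\<Sum>m<n. d m * cnj (tr (X (Q z)) (sh \<tau> m))) + (\<Sum>m<n. d m * cnj (tr (X (proj_coeffs M z)) (sh \<tau> m)))"
    unfolding sum.distrib[symmetric] Q_def tr_X_diff by (simp add: algebra_simps)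
  finally have "of_real (\<Sum>m<n. (cmod (d m))\<^sup>2) = (0 :: complex)" unfolding 1 2 by simp
  hence "(\<Sum>m<n. (cmod (d m))\<^sup>2) = 0" by (simp only: of_real_eq_0_iff)
  hence "\<forall>m\<in>{..<n}. (cmod (d m))\<^sup>2 = 0" by (subst (asm) sum_nonneg_eq_0_iff) auto
  from bspec[OF this, of 0] n have "(cmod (d 0))\<^sup>2 = 0" by simp
  hence "tr (X (proj_coeffs M y)) \<tau> = tr' (X (proj_coeffs M v)) \<tau>" by (simp add: d_def)
  moreover have "(\<Sum>m<n. p m * tr' (X v) (sh \<tau> m)) = (\<Sum>m<n. p m * tr (X y) (sh \<tau> m))"
    using y by (intro sum.cong) auto
  ultimately show ?thesis using p[of y] by simp
qed

definition unit_vec :: "nat \<Rightarrow> nat \<Rightarrow> complex" where "unit_vec i j = (if j = i then 1 else 0)"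

lemma X_unit_vec: "i < n \<Longrightarrow> X (unit_vec i) z = dkernel (w i) z"
  by (simp add: X_def unit_vec_def if_distrib[of "\<lambda>c. c * _"] cong: if_cong)

lemma X_proj_coeffs_sum:
  assumes M: "reduces M"
  shows "X (proj_coeffs M v) z = (\<Sum>i<n. v i * X (proj_coeffs M (unit_vec i)) z)"
proof -
  define u where "u j = (\<Sum>i<n. v i * proj_coeffs M (unit_vec i) j)" for j
  have Xu: "X u z = (\<Sum>i<n. v i * X (proj_coeffs M (unit_vec i)) z)" for z
    unfolding X_def u_def sum_distrib_left sum_distrib_right by (subst sum.swap) (simp add: mult.assoc)
  have Xd: "on_disc (dkernel (w i)) = on_disc (X (unit_vec i))" if "i < n" for i
    using X_unit_vec[OF that] by (auto simp: on_disc_def)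
  have "on_disc (X (proj_coeffs M v)) = dirichlet.proj M (on_disc (X v))" by (rule proj_coeffs[OF M, symmetric])
  also have "\<dots> = dirichlet.proj M (\<lambda>z. \<Sum>i<n. v i * on_disc (dkernel (w i)) z)" unfolding on_disc_X ..
  also have "\<dots> = (\<lambda>z. \<Sum>i<n. v i * dirichlet.proj M (on_disc (dkernel (w i))) z)"
    by (rule dirichlet.proj_sum[OF reducesD(1)[OF M]]) (use w dkernel_in in auto)
  also have "\<dots> = (\<lambda>z. \<Sum>i<n. v i * on_disc (X (proj_coeffs M (unit_vec i))) z)"
    by (intro ext sum.cong refl) (simp add: Xd proj_coeffs[OF M])
  also have "\<dots> = on_disc (X u)" by (auto simp: on_disc_def Xu)
  finally have "X (proj_coeffs M v) = X u" by (rule X_eqI)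
  thus ?thesis by (simp add: Xu)
qed

lemma tr_X_proj_coeffs_sum:
  assumes M: "reduces M"
  shows "tr (X (proj_coeffs M v)) \<tau> = (\<Sum>i<n. v i * tr (X (proj_coeffs M (unit_vec i))) \<tau>)"
  unfolding tr_def X_proj_coeffs_sum[OF M, of v] by (simp add: sum_distrib_left mult_ac)

text \<open>
  At every \<open>\<tau>\<close> the coefficients \<open>p\<close> are determined by a uniquely
  solvable linear system. They also solve the differentiated system, hence do not depend on
  \<open>\<tau>\<close>.
\<close>
lemma projection_symbol:
  assumes M: "reduces M"
  shows "\<exists>p. \<forall>v \<tau>. tr (X (proj_coeffs M v)) \<tau> = (\<Sum>m<n. p m * tr (X v) (sh \<tau> m))"
proof -
  define U where "U \<tau> m i = tr (dkernel (w i)) (sh \<tau> m)" for \<tau> m i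
  define V where "V \<tau> i = tr (X (proj_coeffs M (unit_vec i))) \<tau>" for \<tau> i
  have inv: "\<exists>B. \<forall>m<n. \<forall>k<n. (\<Sum>i<n. U \<tau> m i * B i k) = (if m = k then 1 else 0)" for \<tau>
  proof -
    have "\<forall>k. \<exists>v. \<forall>m<n. tr (X v) (sh \<tau> m) = (if m = k then 1 else 0)"
      by (rule allI, rule fibre_values_solvable)
    from choice[OF this] obtain v where v: "\<And>k m. m < n \<Longrightarrow> tr (X (v k)) (sh \<tau> m) = (if m = k then 1 else 0)" by blast
    show ?thesis
      by (rule exI[of _ "\<lambda>i k. v k i"]) (use v in \<open>auto simp: tr_X U_def mult.commute\<close>)
  qed
  have "\<exists>p. \<forall>i<n. (\<Sum>m<n. U \<tau> m i * p m) = V \<tau> i" for \<tau>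
  proof (rule injective_system_solvable)
    fix p k assume h: "\<And>i. i < n \<Longrightarrow> (\<Sum>m<n. U \<tau> m i * p m) = 0" and k: "k < n"
    obtain B where B: "\<And>m k. m < n \<Longrightarrow> k < n \<Longrightarrow> (\<Sum>i<n. U \<tau> m i * B i k) = (if m = k then 1 else 0)" using inv[of \<tau>] by blast
    have "p k = (\<Sum>m<n. p m * (if m = k then 1 else 0))" using k by (simp add: if_distrib cong: if_cong)
    also have "\<dots> = (\<Sum>m<n. p m * (\<Sum>i<n. U \<tau> m i * B i k))" using B k by (intro sum.cong) auto
    also have "\<dots> = (\<Sum>i<n. (\<Sum>m<n. U \<tau> m i * p m) * B i k)"
      unfolding sum_distrib_left sum_distrib_right by (subst sum.swap) (simp add: mult_ac)
    also have "\<dots> = 0" using h by simp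
    finally show "p k = 0" .
  qed
  hence "\<forall>\<tau>. \<exists>p. \<forall>i<n. (\<Sum>m<n. U \<tau> m i * p m) = V \<tau> i" by (rule allI)
  from choice[OF this] obtain p where p: "\<And>\<tau> i. i < n \<Longrightarrow> (\<Sum>m<n. U \<tau> m i * p \<tau> m) = V \<tau> i" by blast
  have pv: "(\<Sum>m<n. p \<tau> m * tr (X v) (sh \<tau> m)) = tr (X (proj_coeffs M v)) \<tau>" for v \<tau>
  proof -
    have "(\<Sum>m<n. p \<tau> m * tr (X v) (sh \<tau> m)) = (\<Sum>i<n. v i * (\<Sum>m<n. U \<tau> m i * p \<tau> m))"
      unfolding tr_X U_def sum_distrib_left by (subst sum.swap) (simp add: mult_ac)
    also have "\<dots> = (\<Sum>i<n. v i * V \<tau> i)" using p by (intro sum.cong) auto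
    also have "\<dots> = tr (X (proj_coeffs M v)) \<tau>" unfolding tr_X_proj_coeffs_sum[OF M, of v] V_def ..
    finally show ?thesis .
  qed
  define U' where "U' \<tau> m i = tr' (dkernel (w i)) (sh \<tau> m)" for \<tau> m i
  define V' where "V' \<tau> i = tr' (X (proj_coeffs M (unit_vec i))) \<tau>" for \<tau> i
  have Xdl: "X (unit_vec i) = dkernel (w i)" if "i < n" for i using X_unit_vec[OF that] by auto
  have const: "p \<tau> k = p 0 k" if k: "k < n" for \<tau> k
  proof (rule solution_of_moving_system_constant[where U=U and U'=U' and V=V and V'=V', OF inv _ _ _ _ k])
    show "((\<lambda>t. U t m i) has_vector_derivative U' \<tau> m i) (at \<tau>)" for \<tau> m i
    proof -
      have "((\<lambda>t. sh t m) has_vector_derivative 1) (at \<tau>)" by (auto intro!: derivative_eq_intros)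
      from vector_diff_chain_at[OF this tr_deriv[OF holo_past_dkernel[OF w]]]
      show ?thesis by (simp add: U_def U'_def o_def)
    qed
    show "((\<lambda>t. V t i) has_vector_derivative V' \<tau> i) (at \<tau>)" for \<tau> i
      unfolding V_def V'_def by (rule tr_deriv[OF holo_past_X])
    show "(\<Sum>m<n. p \<tau> m * U \<tau> m i) = V \<tau> i" if "i < n" for \<tau> i
      using p[OF that] by (simp add: mult.commute)
    show "(\<Sum>m<n. p \<tau> m * U' \<tau> m i) = V' \<tau> i" if "i < n" for \<tau> i
      using symbol_respects_derivative[OF M pv, of \<tau> "unit_vec i"] unfolding Xdl[OF that] U'_def V'_def .
  qed
  show ?thesis
  proof (intro exI[of _ "p 0"] allI)
    fix v \<tau>
    have "(\<Sum>m<n. p 0 m * tr (X v) (sh \<tau> m)) = (\<Sum>m<n. p \<tau> m * tr (X v) (sh \<tau> m))"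
      by (rule sum.cong) (simp_all add: const[of _ \<tau>])
    thus "tr (X (proj_coeffs M v)) \<tau> = (\<Sum>m<n. p 0 m * tr (X v) (sh \<tau> m))" using pv by simp
  qed
qed

text \<open>
  On boundary values both projections are combinations with constant coefficients of the
  translations \<open>\<tau> \<mapsto> \<tau> + 2 \<pi> m\<close>, and translations commute.
\<close>
lemma projections_commute_on_kernels:
  assumes M1: "reduces M1" and M2: "reduces M2"
  shows "dirichlet.proj M1 (dirichlet.proj M2 (on_disc (X v))) = dirichlet.proj M2 (dirichlet.proj M1 (on_disc (X v)))"
proof -
  obtain p where p: "\<And>v \<tau>. tr (X (proj_coeffs M1 v)) \<tau> = (\<Sum>m<n. p m * tr (X v) (sh \<tau> m))" using projection_symbol[OF M1] by blast
  obtain q where q: "\<And>v \<tau>. tr (X (proj_coeffs M2 v)) \<tau> = (\<Sum>m<n. q m * tr (X v) (sh \<tau> m))" using projection_symbol[OF M2] by blast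
  have "tr (X (proj_coeffs M1 (proj_coeffs M2 v))) \<tau> = tr (X (proj_coeffs M2 (proj_coeffs M1 v))) \<tau>" for \<tau>
  proof -
    have "tr (X (proj_coeffs M1 (proj_coeffs M2 v))) \<tau> = (\<Sum>m<n. \<Sum>k<n. p m * (q k * tr (X v) (sh (sh \<tau> m) k)))"
      unfolding p[of "proj_coeffs M2 v"] q sum_distrib_left ..
    also have "\<dots> = (\<Sum>k<n. \<Sum>m<n. q k * (p m * tr (X v) (sh (sh \<tau> k) m)))"
      by (subst sum.swap) (simp add: algebra_simps)
    also have "\<dots> = tr (X (proj_coeffs M2 (proj_coeffs M1 v))) \<tau>"
      unfolding q[of "proj_coeffs M1 v"] p sum_distrib_left ..
    finally show ?thesis .
  qed
  hence "on_disc (X (\<lambda>i. proj_coeffs M1 (proj_coeffs M2 v) i - proj_coeffs M2 (proj_coeffs M1 v) i)) = (\<lambda>z. 0)"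
    by (intro tr_eq_0_imp holo_past_X) (simp add: tr_X_diff)
  hence "on_disc (X (proj_coeffs M1 (proj_coeffs M2 v))) = on_disc (X (proj_coeffs M2 (proj_coeffs M1 v)))"
    unfolding on_disc_X_diff by (auto simp: fun_eq_iff)
  thus ?thesis by (simp only: proj_coeffs[OF M1] proj_coeffs[OF M2])
qed

end

section \<open>Commuting projections and orthogonality\<close>

context finite_blaschke
begin

text \<open>
  Evaluation at \<open>z\<close> is the inner product with the kernel at \<open>z\<close>, which
  for generic \<open>z\<close> is one of the kernels of a fibre. The finitely many exceptional
  points are recovered by analytic continuation.
\<close>
lemma projections_commute:
  assumes M1: "reduces M1" and M2: "reduces M2" and f: "f \<in> dirichlet_space"
  shows "dirichlet.proj M1 (dirichlet.proj M2 f) = dirichlet.proj M2 (dirichlet.proj M1 f)"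
proof -
  note c1 = reducesD(1)[OF M1] and c2 = reducesD(1)[OF M2]
  define d where "d = (\<lambda>z. dirichlet.proj M1 (dirichlet.proj M2 f) z - dirichlet.proj M2 (dirichlet.proj M1 f) z)"
  have D: "dirichlet.proj M1 g \<in> dirichlet_space" "dirichlet.proj M2 g \<in> dirichlet_space" if "g \<in> dirichlet_space" for g
    using dirichlet.proj_H[OF c1 that] dirichlet.proj_H[OF c2 that] .
  have dD: "d \<in> dirichlet_space" unfolding d_def by (intro dirichlet.diff D f)
  obtain B where B: "finite B" "\<And>z. cmod z < 1 \<Longrightarrow> z \<notin> B \<Longrightarrow>
      \<exists>A. finite A \<and> card A = n \<and> (\<forall>u\<in>A. cmod u < 1 \<and> phi u = phi z) \<and> z \<in> A"
    using generic_fibre by blast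
  have dz: "d z = 0" if z: "cmod z < 1" "z \<notin> B" for z
  proof -
    obtain A where A: "finite A" "card A = n" "\<And>u. u \<in> A \<Longrightarrow> cmod u < 1 \<and> phi u = phi z" "z \<in> A" using B(2)[OF z] by blast
    obtain e where e: "bij_betw e {..<n} A"
      using ex_bij_betw_nat_finite[OF A(1)] unfolding A(2) atLeast0LessThan by blast
    define w where "w i = (if i < n then e i else 0)" for i
    have wA: "w i \<in> A" if "i < n" for i using e that by (auto simp: w_def bij_betw_def)
    interpret fibre_kernels n c a w "phi z"
    proof
      show "cmod (w i) < 1" for i using A(3)[OF wA[of i]] by (cases "i < n") (auto simp: w_def)
      show "inj_on w {..<n}" using e by (auto simp: bij_betw_def inj_on_def w_def)
      show "phi (w i) = phi z" if "i < n" for i using A(3)[OF wA[OF that]] by simp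
    qed
    obtain i where i: "i < n" "e i = z" using e A(4) unfolding bij_betw_def by auto
    have kz: "on_disc (dkernel z) = on_disc (X (unit_vec i))" using X_unit_vec[OF i(1)] i by (auto simp: on_disc_def w_def)
    have k: "on_disc (dkernel z) \<in> dirichlet_space" by (rule dkernel_in[OF z(1)])
    have ev: "g z = dirichlet_inner g (on_disc (dkernel z))" if "g \<in> dirichlet_space" for g
      using dkernel_reproduces[OF that z(1)] by simp
    have "dirichlet.proj M1 (dirichlet.proj M2 f) z = dirichlet_inner f (dirichlet.proj M2 (dirichlet.proj M1 (on_disc (dkernel z))))"
      by (simp add: ev D f k dirichlet.proj_self_adjoint[OF c1] dirichlet.proj_self_adjoint[OF c2])
    also have "\<dots> = dirichlet_inner f (dirichlet.proj M1 (dirichlet.proj M2 (on_disc (dkernel z))))"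
      unfolding kz projections_commute_on_kernels[OF M1 M2] ..
    also have "\<dots> = dirichlet.proj M2 (dirichlet.proj M1 f) z"
      by (simp add: ev D f k dirichlet.proj_self_adjoint[OF c1] dirichlet.proj_self_adjoint[OF c2])
    finally show ?thesis by (simp add: d_def)
  qed
  have "d z = 0" for z
  proof (cases "cmod z < 1")
    case True
    show ?thesis
    proof (rule analytic_continuation_open[where s="unit_disc - B" and s'=unit_disc and f=d and g="\<lambda>_. 0"])
      show "open (unit_disc - B)" using B(1) by (intro open_Diff finite_imp_closed) auto
      show "unit_disc - B \<noteq> {}"
      proof
        assume "unit_disc - B = {}"
        hence "unit_disc \<subseteq> B" by auto
        hence "finite unit_disc" using B(1) finite_subset by blast
        thus False using finite_imp_not_open[of "unit_disc"] by auto
      qed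
    qed (use dirichlet_spaceD(1)[OF dD] True dz in auto)
  qed (use dirichlet_spaceD(2)[OF dD] in auto)
  thus ?thesis by (auto simp: d_def fun_eq_iff)
qed

lemma reduces_Int: "reduces M1 \<Longrightarrow> reduces M2 \<Longrightarrow> reduces (M1 \<inter> M2)"
  unfolding reduces_def dirichlet.closed_sub_def by blast

text \<open>
  By commutation, the projection of \<open>f\<close> to \<open>M2\<close> stays in
  \<open>M1\<close> and so is \<open>0\<close>.
\<close>
lemma orthogonal_of_trivial_Int:
  assumes M1: "reduces M1" and M2: "reduces M2" and triv: "M1 \<inter> M2 = {\<lambda>z. 0}" and f: "f \<in> M1" and g: "g \<in> M2"
  shows "dirichlet_inner f g = 0"
proof -
  note c1 = reducesD(1)[OF M1] and c2 = reducesD(1)[OF M2]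
  note fD = reducesD(3)[OF M1 f] and gD = reducesD(3)[OF M2 g]
  have P1f: "dirichlet.proj M1 f = f" by (rule dirichlet.proj_id[OF c1 f])
  have "dirichlet.proj M2 f \<in> M2" by (rule dirichlet.proj_in[OF c2 fD])
  moreover have "dirichlet.proj M2 f \<in> M1"
    using projections_commute[OF M1 M2 fD] dirichlet.proj_in[OF c1 dirichlet.proj_H[OF c2 fD]] unfolding P1f by simp
  ultimately have "dirichlet.proj M2 f = (\<lambda>z. 0)" using triv by blast
  moreover have "dirichlet_inner f g = dirichlet_inner (dirichlet.proj M2 f) g"
    using dirichlet.proj_self_adjoint[OF c2 fD gD] dirichlet.proj_id[OF c2 g] by simp
  ultimately show ?thesis using dirichlet.ip_zero_left[OF gD] by simp
qed

end

text \<open>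
  A Blaschke product is prescribed on the disc only, and the elements of the Dirichlet space
  vanish elsewhere.
\<close>
lemma reducing_subspace_cong:
  assumes "\<And>z. z \<in> unit_disc \<Longrightarrow> \<phi> z = \<psi> z"
  shows "reducing_subspace (mult_op \<phi>) M = reducing_subspace (mult_op \<psi>) M"
proof -
  have e: "mult_op \<phi> f = mult_op \<psi> f" if "f \<in> dirichlet_space" for f
    using assms dirichlet_spaceD(2)[OF that] by (auto simp: mult_op_def fun_eq_iff)
  have "dirichlet_adjoint (mult_op \<phi>) = dirichlet_adjoint (mult_op \<psi>)"
    unfolding dirichlet_adjoint_def using e by (simp cong: ball_cong)
  moreover have "closed_dirichlet_subspace M \<Longrightarrow> f \<in> M \<Longrightarrow> mult_op \<phi> f = mult_op \<psi> f" for f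
    using e unfolding closed_dirichlet_subspace_def by blast
  ultimately show ?thesis unfolding reducing_subspace_def by auto
qed

theorem theorem2p7:
  fixes \<phi> :: "complex \<Rightarrow> complex" and n :: nat
    and M1 M2 :: "(complex \<Rightarrow> complex) set"
  assumes "finite_blaschke_product n \<phi>"
    and "minimal_reducing_subspace (mult_op \<phi>) M1"
    and "minimal_reducing_subspace (mult_op \<phi>) M2"
    and "M1 \<noteq> M2"
  shows "\<forall>f\<in>M1. \<forall>g\<in>M2. dirichlet_inner f g = 0"
proof -
  obtain c a where n: "n \<ge> 1" and ca: "cmod c = 1" "\<forall>i<n. a i \<in> unit_disc"
    and phi: "\<forall>z\<in>unit_disc. \<phi> z = c * (\<Prod>i<n. blaschke_factor (a i) z)"
    using assms(1) unfolding finite_blaschke_product_def by blast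
  interpret finite_blaschke n c a by unfold_locales (use n ca in auto)
  have red: "reducing_subspace (mult_op \<phi>) M \<longleftrightarrow> reduces M" for M
    using reducing_subspace_cong[of \<phi> phi M] phi
    unfolding reducing_subspace_def[of "mult_op phi"] reduces_def closed_dirichlet_subspace_iff by (simp add: phi_def)
  have M: "reduces M1" "reduces M2" "M1 \<noteq> {\<lambda>z. 0}" "M2 \<noteq> {\<lambda>z. 0}"
    and min1: "\<And>N. reduces N \<Longrightarrow> N \<subseteq> M1 \<Longrightarrow> N = M1 \<or> N = {\<lambda>z. 0}"
    and min2: "\<And>N. reduces N \<Longrightarrow> N \<subseteq> M2 \<Longrightarrow> N = M2 \<or> N = {\<lambda>z. 0}"
    using assms(2,3) unfolding minimal_reducing_subspace_def nontrivial_subspace_def red by blast+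
  have "M1 \<inter> M2 = {\<lambda>z. 0}"
    using min1[OF reduces_Int[OF M(1,2)]] min2[OF reduces_Int[OF M(1,2)]] assms(4) by blast
  thus ?thesis using orthogonal_of_trivial_Int[OF M(1,2)] by blast
qed



end
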